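(* Let $\alpha\in(\frac12,1]$, $p\in\mathcal{P}([0,1])$ and $q\in\mathcal{P}^{\log}(\mathbb{R}^3)$ with $q^->2$, $q_\infty=\infty$, $p^->2$ and $\frac{2\alpha}{p^-}+\frac{3}{q^-}<\alpha-\frac12$. If $f\in L^1\big(0,1;L^{q(\cdot)}(\mathbb{R}^3)\big)$ is a divergence-free exterior force and $u_0\in L^{q(\cdot)}(\mathbb{R}^3)$ is a divergence-free initial datum, then there exist a time $T\in(0,1]$ and a unique mild solution of the fractional Navier–Stokes equations with data $u_0,f$ in the space $L^{p(\cdot)}\big(0,T;L^{q(\cdot)}(\mathbb{R}^3)\big)$.
   Context: Variable Lebesgue spaces. For $\Omega=\mathbb{R}^3$ or an interval, $\mathcal{P}(\Omega)$ is the set of measurable $p:\Omega\to[1,\infty]$; $p^-,p^+$ are the essential infimum and supremum; $\frac a\infty:=0$. With $\omega_p(s)=s^p$ for $p<\infty$, $\omega_\infty(s)=0$ for $s\le1$ and $\omega_\infty(s)=\infty$ for $s>1$, put $\varrho_{p(\cdot)}(f)=\int_\Omega\omega_{p(x)}(|f(x)|)dx$; $L^{p(\cdot)}(\Omega)$ is the space of measurable $f$ with $\varrho_{p(\cdot)}(\lambda f)<\infty$ for some $\lambda>0$, with norm $\inf\{\lambda>0:\varrho_{p(\cdot)}(f/\lambda)\le1\}$ (similarly for vector fields). $L^{p(\cdot)}(0,T;X)$ has norm $\big\|\,\|u(t,\cdot)\|_X\big\|_{L^{p(\cdot)}((0,T))}$. $\mathcal{P}^{\log}(\mathbb{R}^3)$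 is the set of $q\in\mathcal{P}(\mathbb{R}^3)$ such that $g=1/q$ satisfies, for some $c>0$, $g_\infty\in\mathbb{R}$ and all $x,y$, $|g(x)-g(y)|\le\frac{c}{\log(e+1/|x-y|)}$ and $|g(x)-g_\infty|\le\frac{c}{\log(e+|x|)}$; $q_\infty\in[1,\infty]$ is defined by $\frac1{q_\infty}=\lim_{|x|\to\infty}\frac1{q(x)}$. Fractional Navier–Stokes equations on $\mathbb{R}^3$: $\partial_tu=-(-\Delta)^\alpha u-(u\cdot\nabla)u+\nabla P+f$, $\operatorname{div}u=0$, $u(0,\cdot)=u_0$, $\operatorname{div}u_0=0$, with unknown velocity $u$ and pressure $P$; $(-\Delta)^\alpha$ has symbol $|\xi|^{2\alpha}$. A mild solution on $(0,T)$ is a solution $u$ of $$u(t,x)=g_{\alpha,t}*u_0(x)+\int_0^tg_{\alpha,t-s}*f(s,x)\,ds-\int_0^tK_{\alpha,t-s}*(u\otimes u)(s,x)\,ds,$$ where $g_{\alpha,t}$ is the convolution kernel of $e^{-t(-\Delta)^\alpha}$ (symbol $e^{-t|\xi|^{2\alpha}}$) and $K_{\alpha,t}$ is the kernel of $e^{-t(-\Delta)^\alpha}\mathbb{P}\operatorname{div}$, $\mathbb{P}$ the Leray projector; i.e. the $j$-th component of $K_{\alpha,t}*(u\otimes u)$ is $\sum_{h,k=1}^3K^{j;h,k}_{\alpha,t}*(u_hu_k)$, where $K^{j;h,k}_{\alpha,t}$ has symbol $i\xi_k\big(\delta_{jh}-\frac{\xi_j\xi_h}{|\xi|^2}\big)e^{-t|\xi|^{2\alpha}}$.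 *)

theory Defs
  imports "HOL-Analysis.Analysis"
begin

section \<open>Variable Lebesgue spaces\<close>

definition variable_exponent :: "'a measure \<Rightarrow> ('a \<Rightarrow> ennreal) \<Rightarrow> bool" where
  "variable_exponent M p \<longleftrightarrow> p \<in> borel_measurable M \<and> (\<forall>x\<in>space M. 1 \<le> p x)"

definition essinf :: "'a measure \<Rightarrow> ('a \<Rightarrow> ennreal) \<Rightarrow> ennreal" where
  "essinf M p = Sup {z. AE x in M. z \<le> p x}"

definition omega :: "ennreal \<Rightarrow> real \<Rightarrow> ennreal" where
  "omega p s =
     (if p = \<infinity> then (if s \<le> 1 then 0 else \<infinity>) else ennreal (s powr enn2real p))"

definition modular ::
  "'a measure \<Rightarrow> ('a \<Rightarrow> ennreal) \<Rightarrow> ('a \<Rightarrow> 'b::real_normed_vector) \<Rightarrow> ennreal" where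
  "modular M p f = (\<integral>\<^sup>+ x. omega (p x) (norm (f x)) \<partial>M)"

definition Lvar :: "'a measure \<Rightarrow> ('a \<Rightarrow> ennreal) \<Rightarrow> ('a \<Rightarrow> 'b::real_normed_vector) set" where
  "Lvar M p = {f. f \<in> borel_measurable M \<and> (\<exists>l>0. modular M p (\<lambda>x. l *\<^sub>R f x) < \<infinity>)}"

text \<open>The value is meaningful only for members of \<open>Lvar M p\<close>; otherwise the
  infimum may be taken over the empty set.\<close>

definition Lvar_norm ::
  "'a measure \<Rightarrow> ('a \<Rightarrow> ennreal) \<Rightarrow> ('a \<Rightarrow> 'b::real_normed_vector) \<Rightarrow> real" where
  "Lvar_norm M p f = Inf {l. 0 < l \<and> modular M p (\<lambda>x. f x /\<^sub>R l) \<le> 1}"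

text \<open>The space of functions of time in \<open>I\<close> with exponent \<open>p\<close> and of space with exponent \<open>q\<close>.
  Its members are jointly Lebesgue measurable functions, not equivalence classes.\<close>

definition mixed_Lvar ::
  "real set \<Rightarrow> (real \<Rightarrow> ennreal) \<Rightarrow> (real^3 \<Rightarrow> ennreal) \<Rightarrow> (real \<Rightarrow> real^3 \<Rightarrow> real^3) set" where
  "mixed_Lvar I p q =
     {u. (\<lambda>(t, x). u t x) \<in> borel_measurable (lebesgue_on (I \<times> UNIV)) \<and>
         (AE t in lebesgue_on I. u t \<in> Lvar lebesgue q) \<and>
         (\<lambda>t. Lvar_norm lebesgue q (u t)) \<in> Lvar (lebesgue_on I) p}"

text \<open>At \<open>x = y\<close> the first bound holds trivially, whatever the value of \<open>1 / 0\<close>.\<close>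

definition log_exponent :: "(real^3 \<Rightarrow> ennreal) \<Rightarrow> bool" where
  "log_exponent q \<longleftrightarrow> variable_exponent lebesgue q \<and>
     (\<exists>c g_inf :: real. c > 0 \<and>
        (\<forall>x y. \<bar>enn2real (1 / q x) - enn2real (1 / q y)\<bar> \<le> c / ln (exp 1 + 1 / norm (x - y))) \<and>
        (\<forall>x. \<bar>enn2real (1 / q x) - g_inf\<bar> \<le> c / ln (exp 1 + norm x)))"

definition exponent_at_infinity :: "(real^3 \<Rightarrow> ennreal) \<Rightarrow> ennreal" where
  "exponent_at_infinity q = 1 / Lim at_infinity (\<lambda>x. 1 / q x)"


section \<open>Divergence-free vector fields\<close>

definition partial :: "3 \<Rightarrow> (real^3 \<Rightarrow> real) \<Rightarrow> real^3 \<Rightarrow> real" where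
  "partial i \<phi> x = frechet_derivative \<phi> (at x) (axis i 1)"

fun times_cont_diff :: "nat \<Rightarrow> (real^3 \<Rightarrow> real) \<Rightarrow> bool" where
  "times_cont_diff 0 \<phi> \<longleftrightarrow> continuous_on UNIV \<phi>"
| "times_cont_diff (Suc n) \<phi> \<longleftrightarrow>
     \<phi> differentiable_on UNIV \<and> (\<forall>i. times_cont_diff n (partial i \<phi>))"

definition test_function :: "(real^3 \<Rightarrow> real) \<Rightarrow> bool" where
  "test_function \<phi> \<longleftrightarrow> (\<forall>n. times_cont_diff n \<phi>) \<and> compact (closure {x. \<phi> x \<noteq> 0})"

text \<open>Vanishing divergence in the sense of distributions, meant for locally integrable fields
  (in particular for members of \<open>Lvar lebesgue q\<close> with \<open>q \<ge> 1\<close>).\<close>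

definition divergence_free :: "(real^3 \<Rightarrow> real^3) \<Rightarrow> bool" where
  "divergence_free v \<longleftrightarrow>
     (\<forall>\<phi>. test_function \<phi> \<longrightarrow> (LINT x|lebesgue. (\<Sum>i\<in>UNIV. v x $ i * partial i \<phi> x)) = 0)"


section \<open>Mild solutions of the fractional Navier--Stokes equations\<close>

text \<open>The Fourier normalisation is the one for which the derivative in direction \<open>k\<close> has
  symbol \<open>\<i> \<xi>\<^sub>k\<close>, so that the kernel of a multiplier is the following integral of its symbol.\<close>

definition kernel_of_symbol :: "(real^3 \<Rightarrow> complex) \<Rightarrow> real^3 \<Rightarrow> complex" where
  "kernel_of_symbol m x = (LINT \<xi>|lebesgue. cis (x \<bullet> \<xi>) * m \<xi>) / of_real ((2 * pi) ^ 3)"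

text \<open>Both symbols below are integrable for \<open>t > 0\<close> and satisfy \<open>m (- \<xi>) = cnj (m \<xi>)\<close>. Hence
  the kernels are real, and taking the real part only changes the type.\<close>

definition heat_kernel :: "real \<Rightarrow> real \<Rightarrow> real^3 \<Rightarrow> real" where
  "heat_kernel \<alpha> t x =
     Re (kernel_of_symbol (\<lambda>\<xi>. of_real (exp (- t * norm \<xi> powr (2 * \<alpha>)))) x)"

definition oseen_kernel :: "real \<Rightarrow> real \<Rightarrow> 3 \<Rightarrow> 3 \<Rightarrow> 3 \<Rightarrow> real^3 \<Rightarrow> real" where
  "oseen_kernel \<alpha> t j h k x =
     Re (kernel_of_symbol
          (\<lambda>\<xi>. \<i> * of_real (\<xi> $ k * ((if j = h then 1 else 0) - \<xi> $ j * \<xi> $ h / (norm \<xi>)\<^sup>2)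
                           * exp (- t * norm \<xi> powr (2 * \<alpha>)))) x)"

definition conv_exists ::
  "(real^3 \<Rightarrow> real) \<Rightarrow> (real^3 \<Rightarrow> 'b::{banach, second_countable_topology}) \<Rightarrow> real^3 \<Rightarrow> bool" where
  "conv_exists K v x \<longleftrightarrow> integrable lebesgue (\<lambda>y. K (x - y) *\<^sub>R v y)"

definition conv ::
  "(real^3 \<Rightarrow> real) \<Rightarrow> (real^3 \<Rightarrow> 'b::{banach, second_countable_topology}) \<Rightarrow> real^3 \<Rightarrow> 'b" where
  "conv K v x = (LINT y|lebesgue. K (x - y) *\<^sub>R v y)"

definition tensor_square :: "(real^3 \<Rightarrow> real^3) \<Rightarrow> real^3 \<Rightarrow> real^3^3" where
  "tensor_square v y = (\<chi> h k. v y $ h * v y $ k)"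

definition oseen_conv_exists :: "real \<Rightarrow> real \<Rightarrow> (real^3 \<Rightarrow> real^3^3) \<Rightarrow> real^3 \<Rightarrow> bool" where
  "oseen_conv_exists \<alpha> t F x \<longleftrightarrow>
     (\<forall>j h k. conv_exists (oseen_kernel \<alpha> t j h k) (\<lambda>y. F y $ h $ k) x)"

definition oseen_conv :: "real \<Rightarrow> real \<Rightarrow> (real^3 \<Rightarrow> real^3^3) \<Rightarrow> real^3 \<Rightarrow> real^3" where
  "oseen_conv \<alpha> t F x =
     (\<chi> j. \<Sum>h\<in>UNIV. \<Sum>k\<in>UNIV. conv (oseen_kernel \<alpha> t j h k) (\<lambda>y. F y $ h $ k) x)"

text \<open>The convergence requirements only say that the integrals in the equation exist; they exclude
  the default value \<open>0\<close> of the integral of a non-integrable function.\<close>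

definition mild_solution ::
  "real \<Rightarrow> (real^3 \<Rightarrow> real^3) \<Rightarrow> (real \<Rightarrow> real^3 \<Rightarrow> real^3) \<Rightarrow> real \<Rightarrow> (real \<Rightarrow> real^3 \<Rightarrow> real^3) \<Rightarrow> bool"
  where
  "mild_solution \<alpha> u0 f T u \<longleftrightarrow>
     (AE (t, x) in lebesgue_on ({0<..<T} \<times> UNIV).
        conv_exists (heat_kernel \<alpha> t) u0 x \<and>
        (AE s in lebesgue_on {0<..<t}. conv_exists (heat_kernel \<alpha> (t - s)) (f s) x) \<and>
        set_integrable lebesgue {0<..<t} (\<lambda>s. conv (heat_kernel \<alpha> (t - s)) (f s) x) \<and>
        (AE s in lebesgue_on {0<..<t}. oseen_conv_exists \<alpha> (t - s) (tensor_square (u s)) x) \<and>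
        set_integrable lebesgue {0<..<t} (\<lambda>s. oseen_conv \<alpha> (t - s) (tensor_square (u s)) x) \<and>
        u t x = conv (heat_kernel \<alpha> t) u0 x
              + (LINT s:{0<..<t}|lebesgue. conv (heat_kernel \<alpha> (t - s)) (f s) x)
              - (LINT s:{0<..<t}|lebesgue. oseen_conv \<alpha> (t - s) (tensor_square (u s)) x))"

end

theory Submission
  imports Defs "HOL-Complex_Analysis.Complex_Analysis"
begin

text \<open>
Since \<open>1 / q\<close> decays logarithmically, bounded functions belong to \<open>L\<^sup>q\<close>; conversely a member of \<open>L\<^sup>q\<close> is the sum
of a bounded function and a member of \<open>L\<^sup>r\<close>, for every \<open>r\<close> below the essential infimum of \<open>q\<close>. Hence the
Oseen kernel at time \<open>t \<le> 1\<close> maps products of members of \<open>L\<^sup>q\<close> to bounded functions, with norm of order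
\<open>t powr - \<gamma>\<close> for \<open>\<gamma> = (1 + 6 / r) / (2 * \<alpha>)\<close>, and the hypothesis on the exponents provides \<open>r\<close> and some \<open>\<rho>\<close>
below the essential infimum of \<open>p\<close> with \<open>\<gamma> < 1 - 2 / \<rho>\<close>. So the Duhamel term of a field in \<open>L\<^sup>p L\<^sup>q\<close> is bounded
in space and time. A solution is found as the linear part plus a bounded function, by Picard iteration
in the supremum norm. The difference of two solutions is bounded, and Young's inequality in time halves its bound
on every sufficiently short time interval, so it vanishes.

The linear part stays in \<open>L\<^sup>q\<close> because the heat kernel has a radially decreasing integrable majorant and
\<open>1 / q\<close> is log-Hoelder continuous. The decay of both kernels is obtained without derivatives of the symbols: if
\<open>x \<bullet> h = pi\<close>, replacing a symbol by its difference with step \<open>h\<close> multiplies the kernel at \<open>x\<close> by \<open>- 2\<close>, and along lines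
the symbols extend holomorphically to discs whose radius is proportional to the distance from the origin, so that
Cauchy's inequality bounds their differences.
\<close>

text \<open>Boundedness on L^q of convolution with an approximate identity is usually read off from
  the maximal function. Here it is a pointwise bound: if v has modular at most one, the convolution
  at x is at most a constant times \<open>max 1 (S x) powr g x\<close>, where g = 1/q and S is the
  modular density of v averaged by the majorant. This form sums, integrates in time and turns back
  into a modular, which is why norms mostly appear as modulars at an explicit scale. Since the
  quadratic map takes values in bounded functions, a correction bounded by one can be added to the
  linear part without leaving a fixed modular ball, and membership in L^p of time comes from
  boundedness on a finite interval. Uniqueness starts from an arbitrary solution, whose L^q norm is
  merely a function of time in L^p; there the full strength of the inequality between the exponents
  is used. The decay rate 7/2 is a compromise: it must exceed 3 for integrability and stay below 4,
  the order permitted by the Oseen symbol, which is not smooth at the origin.\<close>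

section \<open>Integrable weights in three dimensions\<close>

text \<open>Each coordinate is at most the norm in modulus, so monotonicity bounds the cube by a
  product of functions of one coordinate each, and the integral of such a product factorises. This
  replaces polar coordinates.\<close>

lemma nn_integral_radial_le:
  fixes \<phi> :: "real \<Rightarrow> ennreal"
  assumes [measurable]: "\<phi> \<in> borel_measurable borel"
    and anti: "\<And>a b. 0 \<le> a \<Longrightarrow> a \<le> b \<Longrightarrow> \<phi> b \<le> \<phi> a"
  shows "(\<integral>\<^sup>+x. \<phi> (norm x) ^ 3 \<partial>(lborel :: (real^3) measure)) \<le> (\<integral>\<^sup>+s. \<phi> \<bar>s\<bar> \<partial>lborel) ^ 3"
proof -
  have card: "card (Basis :: (real^3) set) = 3" by simp
  have "\<phi> (norm x) ^ 3 \<le> (\<Prod>b\<in>Basis. \<phi> \<bar>x \<bullet> b\<bar>)" for x :: "real^3"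
  proof -
    have "\<phi> (norm x) ^ 3 = (\<Prod>b\<in>(Basis :: (real^3) set). \<phi> (norm x))"
      by (simp only: prod_constant card)
    also have "\<dots> \<le> (\<Prod>b\<in>Basis. \<phi> \<bar>x \<bullet> b\<bar>)"
      by (intro prod_mono_ennreal anti) (auto simp: Basis_le_norm)
    finally show ?thesis .
  qed
  then have "(\<integral>\<^sup>+x. \<phi> (norm x) ^ 3 \<partial>(lborel :: (real^3) measure))
      \<le> (\<integral>\<^sup>+x. (\<Prod>b\<in>Basis. \<phi> \<bar>x \<bullet> b\<bar>) \<partial>(lborel :: (real^3) measure))"
    by (intro nn_integral_mono)
  also have "\<dots> = (\<Prod>b\<in>(Basis :: (real^3) set). (\<integral>\<^sup>+s. \<phi> \<bar>s\<bar> \<partial>lborel))"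
    by (rule nn_integral_lborel_prod) auto
  also have "\<dots> = (\<integral>\<^sup>+s. \<phi> \<bar>s\<bar> \<partial>lborel) ^ 3"
    by (simp only: prod_constant card)
  finally show ?thesis .
qed

text \<open>Size of a fourth difference of a symbol relative to \<open>norm h powr (7/2)\<close>:
  order -7/2 far out and -5/2 at the origin, hence integrable at both ends.\<close>

definition weight :: "real^3 \<Rightarrow> real" where
  "weight x = norm x powr (-7/2) * min (norm x) 1"

lemma weight_nonneg: "0 \<le> weight x" by (simp add: weight_def)

lemma borel_measurable_weight [measurable]: "weight \<in> borel_measurable borel"
  unfolding weight_def[abs_def] by measurable

lemma integrable_weight: "integrable lborel weight"
proof -
  \<comment> \<open>The cube root of \<open>weight\<close>, so that the exponents lie on the two
    sides of -1. The value infinity at 0 is needed for monotonicity because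
    \<open>0 powr a = 0\<close>.\<close>
  define \<phi> :: "real \<Rightarrow> ennreal" where
    "\<phi> s = (if s = 0 then \<infinity> else ennreal (min (s powr (-5/6)) (s powr (-7/6))))" for s
  have [measurable]: "\<phi> \<in> borel_measurable borel" unfolding \<phi>_def[abs_def] by measurable
  have anti: "\<phi> b \<le> \<phi> a" if "0 \<le> a" "a \<le> b" for a b
  proof (cases "a = 0")
    case False
    then have "b powr (-5/6) \<le> a powr (-5/6)" "b powr (-7/6) \<le> a powr (-7/6)"
      using that by (auto intro!: powr_mono2')
    then show ?thesis using False that by (auto simp: \<phi>_def intro!: ennreal_leI)
  qed (simp add: \<phi>_def)
  have wle: "ennreal (weight x) \<le> \<phi> (norm x) ^ 3" for x :: "real^3"
  proof (cases "x = 0")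
    case False
    let ?s = "norm x"
    have s: "?s > 0" using False by simp
    have "min (?s powr (-5/6)) (?s powr (-7/6)) ^ 3 = weight x"
    proof (cases "?s \<le> 1")
      case True
      have "?s powr (-5/6) \<le> ?s powr (-7/6)" using s True by (intro powr_mono') auto
      moreover have "(?s powr (-5/6)) ^ 3 = ?s powr (-5/2)" using s by (simp add: powr_power)
      moreover have "?s powr (-7/2) * ?s = ?s powr (-7/2) * ?s powr 1" using s by simp
      moreover have "\<dots> = ?s powr (-5/2)" by (subst powr_add[symmetric]) simp
      ultimately show ?thesis using True by (simp add: weight_def min_def)
    next
      case f: False
      have "?s powr (-7/6) \<le> ?s powr (-5/6)" using s f by (intro powr_mono) auto
      moreover have "(?s powr (-7/6)) ^ 3 = ?s powr (-7/2)" using s by (simp add: powr_power)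
      ultimately show ?thesis using f by (simp add: weight_def min_def)
    qed
    then show ?thesis using False by (simp add: \<phi>_def ennreal_power)
  qed (simp add: weight_def)
  let ?f = "\<lambda>s::real. ennreal (s powr (-5/6)) * indicator {0..1} s + ennreal (s powr (-7/6)) * indicator {1..} s"
  have I1: "(\<integral>\<^sup>+s. ennreal (s powr (-5/6)) * indicator {0..1} s \<partial>lborel) < \<infinity>"
    by (subst nn_integral_has_integral_lebesgue'[OF _ has_integral_powr_from_0]) auto
  have I2: "(\<integral>\<^sup>+s. ennreal (s powr (-7/6)) * indicator {1..} s \<partial>lborel) < \<infinity>"
    by (subst nn_integral_has_integral_lebesgue'[OF _ has_integral_powr_to_inf]) auto
  have If: "(\<integral>\<^sup>+s. ?f s \<partial>lborel) < \<infinity>"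
    using I1 I2 by (subst nn_integral_add) (auto simp: less_top)
  have "(\<integral>\<^sup>+s. \<phi> \<bar>s\<bar> \<partial>lborel) \<le> (\<integral>\<^sup>+s. ?f s + ?f (- s) \<partial>lborel)"
  proof (rule nn_integral_mono_AE)
    have "AE s in lborel. s \<noteq> (0::real)" by (rule AE_lborel_singleton)
    moreover have "\<phi> \<bar>s\<bar> \<le> ?f \<bar>s\<bar>" if "s \<noteq> 0" for s
      using that by (cases "\<bar>s\<bar> \<le> 1"; cases "\<bar>s\<bar> = 1") (auto simp: \<phi>_def intro!: ennreal_leI)
    moreover have "?f \<bar>s\<bar> \<le> ?f s + ?f (- s)" for s
      by (cases "s \<ge> 0") (auto simp: abs_if)
    ultimately show "AE s in lborel. \<phi> \<bar>s\<bar> \<le> ?f s + ?f (- s)"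
      by (auto elim!: eventually_mono intro: order_trans)
  qed
  also have "\<dots> = (\<integral>\<^sup>+s. ?f s \<partial>lborel) + (\<integral>\<^sup>+s. ?f (- s) \<partial>lborel)"
    by (rule nn_integral_add) measurable
  also have "(\<integral>\<^sup>+s. ?f (- s) \<partial>lborel) = (\<integral>\<^sup>+s. ?f s \<partial>lborel)"
    using nn_integral_real_affine[of ?f "-1" 0] by simp
  also have "(\<integral>\<^sup>+s. ?f s \<partial>lborel) + (\<integral>\<^sup>+s. ?f s \<partial>lborel) < \<infinity>"
    using If by simp
  finally have "(\<integral>\<^sup>+s. \<phi> \<bar>s\<bar> \<partial>lborel) ^ 3 < \<infinity>"
    by (simp add: power_less_top_ennreal)
  with nn_integral_radial_le[OF _ anti, of "\<lambda>x. x"]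
  have "(\<integral>\<^sup>+x. \<phi> (norm x) ^ 3 \<partial>(lborel :: (real^3) measure)) < \<infinity>"
    by (metis (no_types, lifting) \<open>\<phi> \<in> borel_measurable borel\<close> anti nn_integral_radial_le order_le_less_trans)
  moreover have "(\<integral>\<^sup>+x. ennreal (weight x) \<partial>lborel) \<le> (\<integral>\<^sup>+x. \<phi> (norm x) ^ 3 \<partial>(lborel :: (real^3) measure))"
    by (intro nn_integral_mono wle)
  ultimately show ?thesis
    by (intro integrableI_nonneg) (auto simp: weight_nonneg)
qed

text \<open>The common profile of the kernels at time one. It also dominates the symbols, which
  yields their integrability.\<close>

definition bump :: "real^3 \<Rightarrow> real" where "bump x = (1 + norm x) powr (-7/2)"

lemma bump_nonneg: "0 \<le> bump x" by (simp add: bump_def)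

lemma borel_measurable_bump [measurable]: "bump \<in> borel_measurable borel"
  unfolding bump_def[abs_def] by measurable

lemma bump_le_1: "bump x \<le> 1"
  unfolding bump_def by (rule order_trans[OF powr_mono2'[of _ 1]]) auto

lemma bump_le_weight: "x \<noteq> 0 \<Longrightarrow> bump x \<le> weight x"
proof -
  assume "x \<noteq> 0"
  then have s: "norm x > 0" by simp
  show ?thesis
  proof (cases "norm x \<le> 1")
    case True
    have "1 \<le> norm x powr (-5/2)" using s True powr_mono2'[of "-5/2" "norm x" 1] by simp
    also have "\<dots> = norm x powr (-7/2) * norm x powr 1" by (subst powr_add[symmetric]) simp
    also have "\<dots> = weight x" using True s by (simp add: weight_def)
    finally show ?thesis using bump_le_1[of x] by simp
  next
    case False
    then show ?thesis using s by (auto simp: weight_def bump_def intro!: powr_mono2')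
  qed
qed

lemma integrable_bump: "integrable lborel bump"
proof (rule Bochner_Integration.integrable_bound[OF integrable_weight])
  have "AE x in lborel. x \<noteq> (0::real^3)" by (rule AE_lborel_singleton)
  then show "AE x in lborel. norm (bump x) \<le> norm (weight x)"
    by (rule eventually_mono) (auto simp: bump_nonneg weight_nonneg bump_le_weight)
qed measurable

section \<open>Decay of kernels with analytic symbols\<close>

lemma borel_measurable_cis_inner [measurable]:
  "(\<lambda>\<xi>::real^3. cis (x \<bullet> \<xi>)) \<in> borel_measurable borel"
  by (intro borel_measurable_continuous_onI continuous_intros)

lemma kernel_of_symbol_lborel:
  assumes [measurable]: "m \<in> borel_measurable borel"
  shows "kernel_of_symbol m x = (LINT \<xi>|lborel. cis (x \<bullet> \<xi>) * m \<xi>) / of_real ((2 * pi) ^ 3)"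
  unfolding kernel_of_symbol_def by (subst integral_completion) auto

lemma norm_kernel_le:
  assumes [measurable]: "m \<in> borel_measurable borel"
  shows "norm (kernel_of_symbol m x) \<le> (LINT \<xi>|lborel. norm (m \<xi>))"
proof -
  have "1 \<le> 2 * pi" using pi_gt3 by linarith
  then have one: "1 \<le> (2 * pi) ^ 3" by (rule one_le_power)
  have "norm (LINT \<xi>|lborel. cis (x \<bullet> \<xi>) * m \<xi>) \<le> (LINT \<xi>|lborel. norm (cis (x \<bullet> \<xi>) * m \<xi>))"
    by (rule integral_norm_bound)
  also have "\<dots> = (LINT \<xi>|lborel. norm (m \<xi>))" by (simp add: norm_mult)
  finally have le: "norm (LINT \<xi>|lborel. cis (x \<bullet> \<xi>) * m \<xi>) \<le> (LINT \<xi>|lborel. norm (m \<xi>))" .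
  have "norm (kernel_of_symbol m x) = norm (LINT \<xi>|lborel. cis (x \<bullet> \<xi>) * m \<xi>) / (2 * pi) ^ 3"
    by (simp add: kernel_of_symbol_lborel norm_divide norm_power norm_mult)
  also have "\<dots> \<le> norm (LINT \<xi>|lborel. cis (x \<bullet> \<xi>) * m \<xi>) / 1"
    using one by (intro divide_left_mono) auto
  finally show ?thesis using le by simp
qed

section \<open>Finite differences of symbols and of holomorphic functions\<close>

text \<open>Polymorphic because differences on \<open>real^3\<close> along a line are compared with
  differences in the complex plane.\<close>

definition fdiff :: "'a::plus \<Rightarrow> ('a \<Rightarrow> 'b::minus) \<Rightarrow> 'a \<Rightarrow> 'b" where
  "fdiff h f = (\<lambda>x. f (x + h) - f x)"

lemma borel_measurable_fdiff [measurable]: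
  fixes f :: "real^3 \<Rightarrow> complex"
  assumes [measurable]: "f \<in> borel_measurable borel"
  shows "fdiff h f \<in> borel_measurable borel"
  unfolding fdiff_def by measurable

lemma borel_measurable_fdiff_iter [measurable]:
  fixes f :: "real^3 \<Rightarrow> complex"
  assumes [measurable]: "f \<in> borel_measurable borel"
  shows "(fdiff h ^^ n) f \<in> borel_measurable borel"
  by (induct n) auto

lemma integrable_translation:
  fixes f :: "'a::euclidean_space \<Rightarrow> 'b::{banach, second_countable_topology}"
  assumes "integrable lborel f"
  shows "integrable lborel (\<lambda>x. f (x + h))"
proof -
  have [measurable]: "f \<in> borel_measurable borel" using assms by auto
  have "integrable (distr lborel borel ((+) h)) f" using assms by (simp add: lborel_distr_plus)
  then show ?thesis by (subst (asm) integrable_distr_eq) (auto simp: add.commute)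
qed

lemma integral_translation:
  fixes f :: "'a::euclidean_space \<Rightarrow> 'b::{banach, second_countable_topology}"
  assumes [measurable]: "f \<in> borel_measurable borel"
  shows "(LINT x|lborel. f (x + h)) = (LINT x|lborel. f x)"
proof -
  have "(LINT x|lborel. f x) = (LINT x|distr lborel borel ((+) h). f x)" by (simp add: lborel_distr_plus)
  also have "\<dots> = (LINT x|lborel. f (x + h))" by (subst integral_distr) (auto simp: add.commute)
  finally show ?thesis ..
qed

lemma integrable_fdiff_iter:
  fixes f :: "real^3 \<Rightarrow> complex"
  assumes "integrable lborel f"
  shows "integrable lborel ((fdiff h ^^ n) f)"
  using assms by (induct n) (auto simp: fdiff_def intro: integrable_translation)

lemma integrable_cis_mult:
  assumes "integrable lborel m"
  shows "integrable lborel (\<lambda>\<xi>::real^3. cis (x \<bullet> \<xi>) * m \<xi>)"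
proof (rule Bochner_Integration.integrable_bound[OF assms])
  have [measurable]: "m \<in> borel_measurable borel" using assms by auto
  show "(\<lambda>\<xi>. cis (x \<bullet> \<xi>) * m \<xi>) \<in> borel_measurable lborel" by measurable
qed (simp add: norm_mult)

text \<open>After translation the phase has changed by \<open>cis pi = -1\<close>, so the shifted
  symbol contributes minus the kernel and the subtracted one another minus.\<close>

lemma kernel_fdiff:
  assumes m: "integrable lborel m" and xh: "x \<bullet> h = pi"
  shows "kernel_of_symbol (fdiff h m) x = - 2 * kernel_of_symbol m x"
proof -
  have [measurable]: "m \<in> borel_measurable borel" using m by auto
  let ?e = "\<lambda>\<xi>. cis (x \<bullet> \<xi>) * m \<xi>"
  have e: "?e \<in> borel_measurable borel" by measurable
  have sh: "cis (x \<bullet> \<xi>) * m (\<xi> + h) = - ?e (\<xi> + h)" for \<xi>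
    by (simp add: inner_add_right xh flip: cis_mult)
  have "(LINT \<xi>|lborel. cis (x \<bullet> \<xi>) * fdiff h m \<xi>) = (LINT \<xi>|lborel. - ?e (\<xi> + h) - ?e \<xi>)"
    by (simp add: fdiff_def right_diff_distrib sh)
  also have "\<dots> = (LINT \<xi>|lborel. - ?e (\<xi> + h)) - (LINT \<xi>|lborel. ?e \<xi>)"
    by (intro Bochner_Integration.integral_diff integrable_minus integrable_translation[OF integrable_cis_mult[OF m]]
        integrable_cis_mult[OF m])
  also have "\<dots> = - 2 * (LINT \<xi>|lborel. ?e \<xi>)"
    using integral_translation[OF e, of h] by simp
  finally show ?thesis by (simp add: kernel_of_symbol_lborel)
qed

lemma kernel_fdiff_iter:
  assumes m: "integrable lborel m" and xh: "x \<bullet> h = pi"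
  shows "kernel_of_symbol ((fdiff h ^^ n) m) x = (- 2) ^ n * kernel_of_symbol m x"
proof (induct n)
  case (Suc n)
  have "kernel_of_symbol ((fdiff h ^^ Suc n) m) x = - 2 * kernel_of_symbol ((fdiff h ^^ n) m) x"
    using kernel_fdiff[OF integrable_fdiff_iter[OF m] xh] by simp
  then show ?case using Suc by simp
qed simp

lemma fdiff_diff_const: "fdiff h (\<lambda>x. f x - (b::complex)) = fdiff h f"
  by (simp add: fdiff_def)

text \<open>Allows a symbol to be normalised by whichever constant makes it small in the region at
  hand.\<close>

lemma fdiff_iter_diff_const:
  "0 < n \<Longrightarrow> (fdiff h ^^ n) (\<lambda>x. f x - (b::complex)) = (fdiff h ^^ n) f"
  by (cases n) (simp_all only: funpow_Suc_right o_apply fdiff_diff_const less_irrefl)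

text \<open>The crude bound for frequencies comparable with the step, where the discs of analyticity
  are too small: all 2^n terms are evaluated within \<open>n * norm h\<close> of x.\<close>

lemma norm_fdiff_iter_le:
  fixes f :: "real^3 \<Rightarrow> complex"
  assumes "\<And>x. norm (f x) \<le> C * norm x" "0 \<le> C"
  shows "norm ((fdiff h ^^ n) f x) \<le> 2 ^ n * C * (norm x + n * norm h)"
proof (induct n arbitrary: x)
  case (Suc n)
  have "norm ((fdiff h ^^ Suc n) f x) \<le> norm ((fdiff h ^^ n) f (x + h)) + norm ((fdiff h ^^ n) f x)"
    by (simp add: fdiff_def norm_triangle_ineq4)
  also have "\<dots> \<le> 2 ^ n * C * (norm (x + h) + n * norm h) + 2 ^ n * C * (norm x + n * norm h)"
    by (intro add_mono Suc)
  also have "\<dots> \<le> 2 ^ n * C * (norm x + norm h + n * norm h) + 2 ^ n * C * (norm x + norm h + n * norm h)"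
    using assms by (intro add_mono mult_left_mono) (auto intro: norm_triangle_ineq)
  also have "\<dots> = 2 ^ Suc n * C * (norm x + real (Suc n) * norm h)" by (simp add: algebra_simps)
  finally show ?case .
qed (use assms in auto)

text \<open>Cauchy's inequality on discs of radius \<delta> bounds the derivative by
  \<open>B / \<delta>\<close>, and the mean value inequality over a segment of length r gives the
  factor. The radius shrinks by \<delta> for Cauchy and by r for the shift.\<close>

lemma fdiff_holomorphic_bound:
  fixes f :: "complex \<Rightarrow> complex" and r :: real
  assumes f: "f holomorphic_on ball 0 \<rho>" and b: "\<And>z. z \<in> ball 0 \<rho> \<Longrightarrow> norm (f z) \<le> B"
    and "0 < \<delta>" "0 \<le> r" "\<rho>' \<le> \<rho> - \<delta> - r"
  shows "fdiff (of_real r) f holomorphic_on ball 0 \<rho>'"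
    and "\<And>z. z \<in> ball 0 \<rho>' \<Longrightarrow> norm (fdiff (of_real r) f z) \<le> B * (r / \<delta>)"
proof -
  have sub: "z + of_real r \<in> ball 0 (\<rho> - \<delta>)" "z \<in> ball 0 (\<rho> - \<delta>)" if "z \<in> ball 0 \<rho>'" for z :: complex
  proof -
    have "norm (z + of_real r) \<le> norm z + r" using norm_triangle_ineq[of z "of_real r"] assms by simp
    then show "z + of_real r \<in> ball 0 (\<rho> - \<delta>)" "z \<in> ball 0 (\<rho> - \<delta>)" using that assms by auto
  qed
  have bs: "ball 0 (\<rho> - \<delta>) \<subseteq> ball (0::complex) \<rho>" using assms by auto
  show "fdiff (of_real r) f holomorphic_on ball 0 \<rho>'"
    unfolding fdiff_def
  proof (intro holomorphic_on_diff)
    show "(\<lambda>z. f (z + of_real r)) holomorphic_on ball 0 \<rho>'"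
      using sub bs by (intro holomorphic_on_compose_gen[OF _ f, unfolded o_def] holomorphic_intros) blast
    show "f holomorphic_on ball 0 \<rho>'" using sub bs by (intro holomorphic_on_subset[OF f]) blast
  qed
  have d: "norm (deriv f w) \<le> B / \<delta>" if "w \<in> ball 0 (\<rho> - \<delta>)" for w
  proof -
    have c: "cball w \<delta> \<subseteq> ball 0 \<rho>"
    proof
      fix y assume "y \<in> cball w \<delta>"
      then have "norm y \<le> norm w + \<delta>" using norm_triangle_ineq[of w "y - w"] by (simp add: dist_norm norm_minus_commute)
      then show "y \<in> ball 0 \<rho>" using that by auto
    qed
    have "norm ((deriv ^^ 1) f w) \<le> fact 1 * B / \<delta> ^ 1"
    proof (rule Cauchy_inequality)
      show "f holomorphic_on ball w \<delta>" using c by (intro holomorphic_on_subset[OF f]) auto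
      show "continuous_on (cball w \<delta>) f"
        by (rule holomorphic_on_imp_continuous_on[OF holomorphic_on_subset[OF f c]])
      show "norm (f y) \<le> B" if "norm (w - y) = \<delta>" for y
        using that c by (intro b) (auto simp: dist_norm)
    qed fact
    then show ?thesis by simp
  qed
  fix z assume z: "z \<in> ball (0::complex) \<rho>'"
  have "norm (f (z + of_real r) - f z) \<le> B / \<delta> * norm (z + of_real r - z)"
  proof (rule field_differentiable_bound[where S = "ball 0 (\<rho> - \<delta>)" and f' = "deriv f"])
    fix w assume w: "w \<in> ball (0::complex) (\<rho> - \<delta>)"
    then have "(f has_field_derivative deriv f w) (at w)"
      using bs f by (intro holomorphic_derivI[of f "ball 0 \<rho>"]) auto
    then show "(f has_field_derivative deriv f w) (at w within ball 0 (\<rho> - \<delta>))"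
      by (rule has_field_derivative_at_within)
    show "norm (deriv f w) \<le> B / \<delta>" using d w .
  qed (use sub[OF z] in auto)
  then show "norm (fdiff (of_real r) f z) \<le> B * (r / \<delta>)" using assms by (simp add: fdiff_def)
qed

text \<open>Every difference spends R/8 on Cauchy's inequality and at most R/16 on the shift,
  together 3R/16, so that after four differences a disc of radius R/4 survives.\<close>

lemma fdiff_iter_holomorphic_bound:
  fixes f :: "complex \<Rightarrow> complex"
  assumes f: "f holomorphic_on ball 0 R" and b: "\<And>z. z \<in> ball 0 R \<Longrightarrow> norm (f z) \<le> B"
    and "0 < R" "0 \<le> r" "r \<le> R / 16"
  shows "(fdiff (of_real r) ^^ n) f holomorphic_on ball 0 (R - n * (3 * R / 16)) \<and>
     (\<forall>z \<in> ball 0 (R - n * (3 * R / 16)). norm ((fdiff (of_real r) ^^ n) f z) \<le> B * (8 * r / R) ^ n)"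
proof (induct n)
  case (Suc n)
  have R: "R - real (Suc n) * (3 * R / 16) \<le> R - real n * (3 * R / 16) - R / 8 - r"
    using assms by (simp add: algebra_simps)
  note * = fdiff_holomorphic_bound[of "(fdiff (of_real r) ^^ n) f" "R - real n * (3 * R / 16)" "B * (8 * r / R) ^ n" "R / 8" r,
     OF _ _ _ \<open>0 \<le> r\<close> R]
  show ?case using *(1) *(2) Suc \<open>0 < R\<close> by (auto simp: mult_ac)
qed (use assms in auto)

lemma fdiff_iter_along_line:
  fixes m :: "real^3 \<Rightarrow> complex"
  assumes "\<And>s::real. \<bar>s\<bar> < R \<Longrightarrow> \<phi> (of_real s) = m (\<xi> + s *\<^sub>R e)" "0 \<le> r" "0 \<le> s" "s + n * r < R"
  shows "(fdiff (r *\<^sub>R e) ^^ n) m (\<xi> + s *\<^sub>R e) = (fdiff (complex_of_real r) ^^ n) \<phi> (of_real s)"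
  using assms(3,4)
proof (induct n arbitrary: s)
  case 0
  then show ?case using assms(1)[of s] by simp
next
  case (Suc n)
  have "(fdiff (r *\<^sub>R e) ^^ n) m (\<xi> + (s + r) *\<^sub>R e) = (fdiff (complex_of_real r) ^^ n) \<phi> (of_real (s + r))"
    using Suc.prems assms(2) by (intro Suc.hyps) (auto simp: algebra_simps)
  moreover have "(fdiff (r *\<^sub>R e) ^^ n) m (\<xi> + s *\<^sub>R e) = (fdiff (complex_of_real r) ^^ n) \<phi> (of_real s)"
    using Suc.prems assms(2) by (intro Suc.hyps) (auto simp: algebra_simps)
  ultimately show ?case by (simp add: fdiff_def[of _ "(fdiff _ ^^ n) _"] scaleR_left_distrib add.assoc)
qed

text \<open>The fourth difference gains the factor \<open>\<bar>h\<bar>\<^sup>4\<close> away from the origin, where the symbol is analytic;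
  trading half a power of it makes the resulting weight integrable at infinity and at the origin.\<close>

lemma kernel_decay:
  fixes m :: "real^3 \<Rightarrow> complex"
  assumes m: "integrable lborel m" and "0 \<le> C"
    and lip: "\<And>\<xi>. norm (m \<xi> - b0) \<le> C * norm \<xi>"
    and ext: "\<And>\<xi> e. \<xi> \<noteq> 0 \<Longrightarrow> norm e = 1 \<Longrightarrow>
      \<exists>b \<phi>. \<phi> holomorphic_on ball 0 (norm \<xi> / 8) \<and>
        (\<forall>z\<in>ball 0 (norm \<xi> / 8). norm (\<phi> z - b) \<le> C * min (norm \<xi>) 1) \<and>
        (\<forall>s::real. \<bar>s\<bar> < norm \<xi> / 8 \<longrightarrow> \<phi> (of_real s) = m (\<xi> + s *\<^sub>R e))"
  shows "\<exists>B\<ge>0. \<forall>x. norm (kernel_of_symbol m x) \<le> B * bump x"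
proof -
  have [measurable]: "m \<in> borel_measurable borel" using m by auto
  \<comment> \<open>The summands serve the two cases below. Far out,
    \<open>8 * r / (norm \<xi> / 8) = 64 * (r / norm \<xi>)\<close> enters to the fourth power. Near
    the origin, 2112 = 16 * 132 comes from
    \<open>norm \<xi> + 4 * norm h \<le> 132 * norm h\<close>, the 512 from
    \<open>128 * pi \<le> 512\<close>, and the power of 128 from the threshold.\<close>
  define D where "D = C * 64 ^ 4 + C * 2112 * 512 * 128 powr (5/2)"
  have D: "0 \<le> D" using \<open>0 \<le> C\<close> by (simp add: D_def)
  have main: "norm ((fdiff h ^^ 4) m \<xi>) \<le> D * norm h powr (7/2) * weight \<xi>"
    if h: "0 < norm h" "norm h \<le> pi" and \<xi>: "\<xi> \<noteq> 0" for h \<xi> :: "real^3"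
  \<comment> \<open>The factor 128 = 8 * 16 makes the step at most a sixteenth of the radius
    \<open>norm \<xi> / 8\<close> of analyticity.\<close>
  proof (cases "128 * norm h \<le> norm \<xi>")
    case True
    define r where "r = norm h"
    define e where "e = h /\<^sub>R r"
    have r: "0 < r" "128 * r \<le> norm \<xi>" using h True by (auto simp: r_def)
    have he: "h = r *\<^sub>R e" "norm e = 1" using h by (auto simp: e_def r_def)
    obtain b \<phi> where \<phi>: "\<phi> holomorphic_on ball 0 (norm \<xi> / 8)"
      "\<And>z. z\<in>ball 0 (norm \<xi> / 8) \<Longrightarrow> norm (\<phi> z - b) \<le> C * min (norm \<xi>) 1"
      "\<And>s::real. \<bar>s\<bar> < norm \<xi> / 8 \<Longrightarrow> \<phi> (of_real s) = m (\<xi> + s *\<^sub>R e)"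
      using ext[OF \<xi> he(2)] by blast
    have "(fdiff h ^^ 4) m \<xi> = (fdiff (complex_of_real r) ^^ 4) \<phi> 0"
      using fdiff_iter_along_line[of "norm \<xi> / 8" \<phi> m \<xi> e r 0 4] \<phi>(3) r by (simp add: he del: funpow.simps)
    also have "\<dots> = (fdiff (complex_of_real r) ^^ 4) (\<lambda>z. \<phi> z - b) 0"
      by (subst fdiff_iter_diff_const) auto
    finally have eq: "(fdiff h ^^ 4) m \<xi> = (fdiff (complex_of_real r) ^^ 4) (\<lambda>z. \<phi> z - b) 0" .
    have "norm ((fdiff h ^^ 4) m \<xi>) \<le> (C * min (norm \<xi>) 1) * (8 * r / (norm \<xi> / 8)) ^ 4"
      unfolding eq using r \<xi> \<phi>(1,2)
      by (intro fdiff_iter_holomorphic_bound[of "\<lambda>z. \<phi> z - b" "norm \<xi> / 8" "C * min (norm \<xi>) 1" r 4,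
            THEN conjunct2, rule_format]) (auto intro!: holomorphic_intros)
    also have "\<dots> = C * 64 ^ 4 * min (norm \<xi>) 1 * (r / norm \<xi>) ^ 4" by (simp add: power_divide power_mult_distrib)
    also have "\<dots> \<le> C * 64 ^ 4 * min (norm \<xi>) 1 * (r / norm \<xi>) powr (7/2)"
    proof (rule mult_left_mono)
      have pos: "0 < r / norm \<xi>" and le1: "r / norm \<xi> \<le> 1" using r \<xi> by auto
      have "(r / norm \<xi>) ^ 4 = (r / norm \<xi>) powr real 4" by (rule powr_realpow[OF pos, symmetric])
      also have "\<dots> \<le> (r / norm \<xi>) powr (7/2)" using pos le1 by (intro powr_mono') auto
      finally show "(r / norm \<xi>) ^ 4 \<le> (r / norm \<xi>) powr (7/2)" .
    qed (use \<open>0 \<le> C\<close> in auto)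
    also have "\<dots> = C * 64 ^ 4 * r powr (7/2) * weight \<xi>"
      using r \<xi> by (simp add: weight_def powr_divide powr_minus_divide)
    also have "\<dots> \<le> D * r powr (7/2) * weight \<xi>"
      using \<open>0 \<le> C\<close> by (intro mult_right_mono) (auto simp: D_def weight_nonneg)
    finally show ?thesis by (simp add: r_def)
  next
    case False
    define r where "r = norm h"
    have r: "0 < r" "norm \<xi> < 128 * r" "r \<le> pi" using h False by (auto simp: r_def)
    have \<xi>0: "0 < norm \<xi>" using \<xi> by simp
    have "(fdiff h ^^ 4) m \<xi> = (fdiff h ^^ 4) (\<lambda>x. m x - b0) \<xi>"
      by (subst fdiff_iter_diff_const) auto
    then have "norm ((fdiff h ^^ 4) m \<xi>) \<le> 2 ^ 4 * C * (norm \<xi> + real 4 * norm h)"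
      using norm_fdiff_iter_le[of "\<lambda>x. m x - b0", OF lip \<open>0 \<le> C\<close>] by (simp only:)
    also have "\<dots> \<le> 2 ^ 4 * C * (132 * r)"
      using r \<open>0 \<le> C\<close> by (intro mult_left_mono) (auto simp: r_def)
    also have "\<dots> = C * 2112 * r" by simp
    also have "r \<le> 512 * 128 powr (5/2) * r powr (7/2) * weight \<xi>"
    proof -
      have "norm \<xi> \<le> 512" using r pi_less_4 by linarith
      then have min: "norm \<xi> \<le> 512 * min (norm \<xi>) 1" using \<xi>0 by (auto simp: min_def)
      have "r = r powr (7/2) * r powr (-5/2)" using r by (subst powr_add[symmetric]) simp
      also have "r powr (-5/2) = 128 powr (5/2) * (128 * r) powr (-5/2)"
      proof -
        have "128 powr (5/2) * 128 powr (-5/2) = (128::real) powr 0" by (subst powr_add[symmetric]) simp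
        moreover have "(128 * r) powr (-5/2) = 128 powr (-5/2) * r powr (-5/2)" by (rule powr_mult)
        ultimately show ?thesis by simp
      qed
      also have "(128 * r) powr (-5/2) \<le> norm \<xi> powr (-5/2)" using r \<xi>0 by (intro powr_mono2') auto
      also have "norm \<xi> powr (-5/2) = norm \<xi> powr (-7/2) * norm \<xi>"
      proof -
        have "norm \<xi> powr (-7/2) * norm \<xi> = norm \<xi> powr (-7/2) * norm \<xi> powr 1" using \<xi>0 by simp
        also have "\<dots> = norm \<xi> powr (-5/2)" by (subst powr_add[symmetric]) simp
        finally show ?thesis ..
      qed
      also have "norm \<xi> powr (-7/2) * norm \<xi> \<le> norm \<xi> powr (-7/2) * (512 * min (norm \<xi>) 1)"
        by (rule mult_left_mono[OF min]) simp
      also have "\<dots> = 512 * weight \<xi>" by (simp add: weight_def)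
      finally show ?thesis using r by (simp add: mult_ac)
    qed
    also have "C * 2112 * (512 * 128 powr (5/2) * r powr (7/2) * weight \<xi>) = (C * 2112 * 512 * 128 powr (5/2)) * r powr (7/2) * weight \<xi>"
      by simp
    also have "\<dots> \<le> D * r powr (7/2) * weight \<xi>"
      using \<open>0 \<le> C\<close> by (intro mult_right_mono) (auto simp: D_def weight_nonneg)
    finally show ?thesis using \<open>0 \<le> C\<close> by (simp add: r_def mult_right_mono)
  qed
  define W where "W = (LINT \<xi>|lborel. weight \<xi>)"
  have W: "0 \<le> W" unfolding W_def by (intro integral_nonneg_AE) (auto simp: weight_nonneg)
  have far: "norm (kernel_of_symbol m x) \<le> (D * pi powr (7/2) * W * 2 powr (7/2)) * bump x" if x: "1 \<le> norm x" for x :: "real^3"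
  proof -
    have x0: "x \<noteq> 0" using x by auto
    \<comment> \<open>The shortest step with \<open>x \<bullet> h = pi\<close>; its length
      \<open>pi / norm x\<close> turns the gain in \<open>norm h\<close> into decay in x.\<close>
    define h where "h = (pi / (norm x)\<^sup>2) *\<^sub>R x"
    have xh: "x \<bullet> h = pi" using x0 by (simp add: h_def power2_norm_eq_inner)
    have nh: "norm h = pi / norm x" using x0 by (simp add: h_def power2_eq_square)
    have h: "0 < norm h" using nh x0 by simp
    have h': "norm h \<le> pi" using divide_left_mono[of 1 "norm x" pi] x x0 nh by simp
    \<comment> \<open>Of the factor \<open>(- 2) ^ 4\<close> only the fact that its modulus is at
      least one is used.\<close>
    have "norm (kernel_of_symbol m x) \<le> norm (kernel_of_symbol ((fdiff h ^^ 4) m) x)"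
      using kernel_fdiff_iter[OF m xh, of 4] by (simp add: norm_mult)
    also have "\<dots> \<le> (LINT \<xi>|lborel. norm ((fdiff h ^^ 4) m \<xi>))" by (rule norm_kernel_le) measurable
    also have "\<dots> \<le> (LINT \<xi>|lborel. D * norm h powr (7/2) * weight \<xi>)"
    proof (rule integral_mono_AE)
      have "AE x in lborel. x \<noteq> (0::real^3)" by (rule AE_lborel_singleton)
      then show "AE \<xi> in lborel. norm ((fdiff h ^^ 4) m \<xi>) \<le> D * norm h powr (7/2) * weight \<xi>"
        by (rule eventually_mono) (use main[OF h h'] in auto)
    qed (intro integrable_norm integrable_fdiff_iter[OF m] integrable_mult_right integrable_weight)+
    also have "\<dots> = D * norm h powr (7/2) * W" by (simp add: W_def)
    also have "norm h powr (7/2) = pi powr (7/2) * norm x powr (-7/2)"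
      using x0 by (simp add: nh powr_divide powr_minus_divide)
    finally have le: "norm (kernel_of_symbol m x) \<le> D * (pi powr (7/2) * norm x powr (-7/2)) * W" .
    have le2: "norm x powr (-7/2) \<le> 2 powr (7/2) * bump x"
    proof -
      have "norm x powr (-7/2) = 2 powr (7/2) * (2 * norm x) powr (-7/2)"
      proof -
        have "2 powr (7/2) * 2 powr (-7/2) = (2::real) powr 0" by (subst powr_add[symmetric]) simp
        moreover have "(2 * norm x) powr (-7/2) = 2 powr (-7/2) * norm x powr (-7/2)" by (rule powr_mult)
        ultimately show ?thesis by simp
      qed
      also have "(2 * norm x) powr (-7/2) \<le> bump x" unfolding bump_def using x by (intro powr_mono2') auto
      finally show ?thesis by simp
    qed
    have "D * (pi powr (7/2) * norm x powr (-7/2)) * W \<le> D * (pi powr (7/2) * (2 powr (7/2) * bump x)) * W"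
      using D W by (intro mult_right_mono mult_left_mono le2) auto
    then show ?thesis using le by (simp add: mult_ac)
  qed
  define I where "I = (LINT \<xi>|lborel. norm (m \<xi>))"
  have I: "0 \<le> I" unfolding I_def by (intro integral_nonneg_AE) auto
  \<comment> \<open>On the unit ball the trivial bound is enough, since \<open>bump\<close> is at
    least \<open>2 powr (-7/2)\<close> there.\<close>
  have near: "norm (kernel_of_symbol m x) \<le> (I * 2 powr (7/2)) * bump x" if x: "norm x \<le> 1" for x :: "real^3"
  proof -
    have "1 = 2 powr (7/2) * (2::real) powr (-7/2)" by (subst powr_add[symmetric]) simp
    also have "(2::real) powr (-7/2) \<le> bump x" unfolding bump_def using x by (intro powr_mono2') (auto intro: add_pos_nonneg)
    finally have "1 \<le> 2 powr (7/2) * bump x" by simp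
    then have "I * 1 \<le> I * (2 powr (7/2) * bump x)" using I by (intro mult_left_mono) auto
    then show ?thesis using norm_kernel_le[of m x] by (simp add: I_def)
  qed
  show ?thesis
  proof (intro exI[of _ "D * pi powr (7/2) * W * 2 powr (7/2) + I * 2 powr (7/2)"] conjI allI)
    fix x :: "real^3"
    show "norm (kernel_of_symbol m x) \<le> (D * pi powr (7/2) * W * 2 powr (7/2) + I * 2 powr (7/2)) * bump x"
    proof (cases "norm x \<le> 1")
      case True
      have "(I * 2 powr (7/2)) * bump x \<le> (D * pi powr (7/2) * W * 2 powr (7/2) + I * 2 powr (7/2)) * bump x"
        using D W by (intro mult_right_mono) (auto simp: bump_nonneg)
      then show ?thesis using near[OF True] by linarith
    next
      case False
      have "(D * pi powr (7/2) * W * 2 powr (7/2)) * bump x \<le> (D * pi powr (7/2) * W * 2 powr (7/2) + I * 2 powr (7/2)) * bump x"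
        using I by (intro mult_right_mono) (auto simp: bump_nonneg)
      then show ?thesis using far[of x] False by linarith
    qed
  qed (use D W I in auto)
qed

section \<open>The fractional heat and Oseen kernels\<close>

text \<open>For a \<ge> 1 the power is at least y - 1, and the degree five term of the exponential
  series bounds \<open>(1 + y) ^ 5\<close> by \<open>120 * exp (1 + y)\<close>. Five powers leave
  four after the linear factor of the Oseen symbol is paid, more than the 7/2 of
  \<open>bump\<close>.\<close>

lemma exp_powr_decay:
  fixes a y :: real
  assumes "1 \<le> a" "0 \<le> y"
  shows "exp (- (y powr a)) \<le> 120 * exp 2 / (1 + y) ^ 5"
proof -
  have "y - 1 \<le> y powr a"
  proof (cases "1 \<le> y")
    case True
    then have "y powr 1 \<le> y powr a" using assms by (intro powr_mono) auto
    then show ?thesis using True by simp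
  qed (use assms powr_ge_zero[of y a] in linarith)
  then have "exp (- (y powr a)) \<le> exp (1 - y)" by simp
  moreover have "(1 + y) ^ 5 / 120 \<le> exp (1 + y)"
    using sum_le_suminf[OF summable_exp, of "{5}" "1 + y"] assms by (simp add: exp_def fact_numeral field_simps)
  then have "exp (1 - y) * (1 + y) ^ 5 \<le> exp (1 - y) * (120 * exp (1 + y))"
    by (intro mult_left_mono) auto
  moreover have "exp (1 - y) * exp (1 + y) = exp (2::real)" by (simp flip: exp_add)
  ultimately have "exp (1 - y) * (1 + y) ^ 5 \<le> 120 * exp 2" by (metis mult.left_commute)
  moreover have "exp (- (y powr a)) * (1 + y) ^ 5 \<le> exp (1 - y) * (1 + y) ^ 5"
    using assms \<open>exp (- (y powr a)) \<le> exp (1 - y)\<close> by (intro mult_right_mono) auto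
  ultimately have "exp (- (y powr a)) * (1 + y) ^ 5 \<le> 120 * exp 2" by (rule order_trans[rotated])
  moreover have "0 < (1 + y) ^ 5" using assms by simp
  ultimately show ?thesis by (simp only: pos_le_divide_eq)
qed

lemma symbol_decay:
  fixes \<xi> :: "real^3"
  assumes "1 \<le> a"
  shows "(1 + norm \<xi>) * exp (- (norm \<xi> powr a)) \<le> 120 * exp 2 * bump \<xi>"
proof -
  let ?y = "1 + norm \<xi>"
  have y: "1 \<le> ?y" by simp
  have "?y * exp (- (norm \<xi> powr a)) \<le> ?y * (120 * exp 2 / ?y ^ 5)"
    using assms by (intro mult_left_mono exp_powr_decay) auto
  also have "\<dots> = 120 * exp 2 * ?y powr (-4)"
  proof -
    have "?y ^ 5 = ?y * ?y ^ 4" by (simp add: eval_nat_numeral)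
    moreover have "?y powr (-4) = 1 / ?y ^ 4" using y by (simp add: powr_minus_divide powr_numeral)
    moreover have "?y \<noteq> 0" using y by linarith
    ultimately show ?thesis by simp
  qed
  also have "?y powr (-4) \<le> bump \<xi>" unfolding bump_def using y by (intro powr_mono) auto
  finally show ?thesis by (simp add: mult_left_mono)
qed

text \<open>The derivative of exp is bounded by one on the closed left half plane, which is
  convex.\<close>

lemma norm_exp_minus_one_le:
  fixes w :: complex
  assumes "0 \<le> Re w"
  shows "norm (exp (- w) - 1) \<le> norm w"
proof -
  have "norm (exp (- w) - exp 0) \<le> 1 * norm (- w - 0)"
  proof (rule field_differentiable_bound[where S = "{z. Re z \<le> 0}" and f' = exp])
    show "convex {z. Re z \<le> 0}" by (rule convex_halfspace_Re_le)
  qed (use assms in \<open>auto intro!: derivative_eq_intros\<close>)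
  then show ?thesis by simp
qed

text \<open>In this disc Re w / |w| is at least (1/2) / (3/2) = 1/3, and a power \<alpha> \<le> 1
  only shrinks the argument, so its cosine stays at least 1/3. Since |w| to the power \<alpha> is at
  least half of \<open>R powr (2 * \<alpha>)\<close>, this gives the 1/6. The complex extension of
  the heat symbol therefore still decays.\<close>

lemma powr_in_sector:
  fixes w :: complex and R \<alpha> :: real
  assumes w: "norm (w - of_real (R\<^sup>2)) \<le> R\<^sup>2 / 2" and R: "0 < R" and a: "1/2 < \<alpha>" "\<alpha> \<le> 1"
  shows "R powr (2 * \<alpha>) / 6 \<le> Re (w powr of_real \<alpha>)" "norm (w powr of_real \<alpha>) \<le> 2 * R powr (2 * \<alpha>)"
    "0 < Re w" "R\<^sup>2 / 2 \<le> norm w"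
proof -
  have Rw: "R\<^sup>2 / 2 \<le> Re w" using abs_Re_le_cmod[of "w - of_real (R\<^sup>2)"] w by (simp add: abs_le_iff)
  then show Rw0: "0 < Re w" using R by (meson half_gt_zero less_le_trans zero_less_power)
  have nw: "norm w \<le> 3/2 * R\<^sup>2" using norm_triangle_ineq[of "w - of_real (R\<^sup>2)" "of_real (R\<^sup>2)"] w
    by (simp add: norm_power)
  show nw2: "R\<^sup>2 / 2 \<le> norm w" using Rw complex_Re_le_cmod[of w] by linarith
  have w0: "w \<noteq> 0" using Rw0 by auto
  then have nw0: "0 < norm w" by simp
  have RR: "(R\<^sup>2) powr \<alpha> = R powr (2 * \<alpha>)" using R by (simp add: powr_powr flip: powr_numeral)
  have n: "norm (w powr of_real \<alpha>) = norm w powr \<alpha>" using w0 by (simp add: norm_powr_real_powr' norm_powr_real_powr)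
  also have "\<dots> \<le> (3/2 * R\<^sup>2) powr \<alpha>" using nw a by (intro powr_mono2) auto
  also have "\<dots> = (3/2) powr \<alpha> * R powr (2 * \<alpha>)" by (simp only: powr_mult RR)
  also have "\<dots> \<le> 2 * R powr (2 * \<alpha>)"
  proof (rule mult_right_mono)
    have "(3/2::real) powr \<alpha> \<le> (3/2) powr 1" using a by (intro powr_mono) auto
    then show "(3/2::real) powr \<alpha> \<le> 2" by simp
  qed simp
  finally show "norm (w powr of_real \<alpha>) \<le> 2 * R powr (2 * \<alpha>)" .
  define \<theta> where "\<theta> = Im (Ln w)"
  have \<theta>: "\<bar>\<theta>\<bar> < pi / 2" unfolding \<theta>_def by (rule Re_Ln_pos_lt_imp[OF Rw0])
  have "Re w = Re (exp (Ln w))" using w0 by simp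
  also have "\<dots> = norm w * cos \<theta>" using w0 by (simp only: Re_exp \<theta>_def Re_Ln) simp
  finally have cos\<theta>: "cos \<theta> = Re w / norm w" using w0 by simp
  have "cos \<bar>\<theta>\<bar> \<le> cos \<bar>\<alpha> * \<theta>\<bar>"
    using \<theta> a by (intro cos_monotone_0_pi_le) (auto simp: abs_mult mult_left_le_one_le)
  then have cc: "Re w / norm w \<le> cos (\<alpha> * \<theta>)" using cos\<theta> by simp
  have third: "1/3 \<le> Re w / norm w" using nw0 nw Rw by (simp add: pos_le_divide_eq)
  have "Re (w powr of_real \<alpha>) = norm w powr \<alpha> * cos (\<alpha> * \<theta>)"
    using w0 by (simp add: powr_def Re_exp \<theta>_def)
  moreover have "R powr (2 * \<alpha>) / 2 \<le> norm w powr \<alpha>"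
  proof -
    have "(R\<^sup>2) powr \<alpha> / 2 \<le> (R\<^sup>2) powr \<alpha> / 2 powr \<alpha>"
      using a powr_mono[of \<alpha> 1 2] by (intro divide_left_mono) auto
    also have "\<dots> = (R\<^sup>2 / 2) powr \<alpha>" by (simp add: powr_divide)
    also have "\<dots> \<le> norm w powr \<alpha>" using nw2 a by (intro powr_mono2) auto
    finally show ?thesis by (simp add: RR)
  qed
  moreover have "1/3 \<le> cos (\<alpha> * \<theta>)" using third cc by (rule order_trans)
  ultimately show "R powr (2 * \<alpha>) / 6 \<le> Re (w powr of_real \<alpha>)"
    using mult_mono[of "R powr (2 * \<alpha>) / 2" "norm w powr \<alpha>" "1/3" "cos (\<alpha> * \<theta>)"] by simp
qed

section \<open>Holomorphic extension of the symbols along lines\<close>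

context
  fixes \<xi> e :: "real^3"
  assumes \<xi>: "\<xi> \<noteq> 0" and e: "norm e = 1"
begin

text \<open>The complexified squared norm of \<open>\<xi> + s *\<^sub>R e\<close>. The norm is not
  analytic in s, but its square is a polynomial, and a complex power of it restores the
  symbol.\<close>

definition qform :: "complex \<Rightarrow> complex" where
  "qform s = of_real ((norm \<xi>)\<^sup>2) + 2 * s * of_real (\<xi> \<bullet> e) + s\<^sup>2"

lemma qform_of_real: "qform (of_real s) = of_real ((norm (\<xi> + s *\<^sub>R e))\<^sup>2)"
proof -
  have "(norm (\<xi> + s *\<^sub>R e))\<^sup>2 = (norm \<xi>)\<^sup>2 + 2 * s * (\<xi> \<bullet> e) + s\<^sup>2"
    using e unfolding norm_eq_1 power2_norm_eq_inner
    by (simp add: inner_add_left inner_add_right inner_commute[of e \<xi>] power2_eq_square algebra_simps)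
  then show ?thesis by (simp add: qform_def)
qed

text \<open>For s up to an eighth of the norm the relative error is at most 2/8 + 1/64, below the
  half that the sector estimate permits. This is the origin of the radius
  \<open>norm \<xi> / 8\<close>.\<close>

lemma qform_near:
  assumes "s \<in> ball 0 (norm \<xi> / 8)"
  shows "norm (qform s - of_real ((norm \<xi>)\<^sup>2)) \<le> (norm \<xi>)\<^sup>2 / 2"
proof -
  have s: "norm s \<le> norm \<xi> / 8" using assms by simp
  have "norm (qform s - of_real ((norm \<xi>)\<^sup>2)) \<le> norm (2 * s * of_real (\<xi> \<bullet> e)) + norm (s\<^sup>2)"
    unfolding qform_def by (simp add: norm_triangle_ineq)
  also have "\<dots> = 2 * norm s * \<bar>\<xi> \<bullet> e\<bar> + (norm s)\<^sup>2" by (simp add: norm_mult norm_power)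
  also have "\<dots> \<le> 2 * (norm \<xi> / 8) * norm \<xi> + (norm \<xi> / 8)\<^sup>2"
  proof (intro add_mono mult_mono)
    show "\<bar>\<xi> \<bullet> e\<bar> \<le> norm \<xi>" using e Cauchy_Schwarz_ineq2[of \<xi> e] by simp
    show "(norm s)\<^sup>2 \<le> (norm \<xi> / 8)\<^sup>2" using s by (rule power_mono) simp
  qed (use s in auto)
  also have "\<dots> \<le> (norm \<xi>)\<^sup>2 / 2" by (simp add: power2_eq_square)
  finally show ?thesis .
qed

lemma holomorphic_qform: "qform holomorphic_on S"
  unfolding qform_def[abs_def] by (intro holomorphic_intros)

text \<open>The exponential bound serves large frequencies, the bound on \<open>\<phi> s - 1\<close>
  small ones, where the heat symbol is close to 1 instead of 0.\<close>

lemma heat_symbol_extension: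
  assumes a: "1/2 < \<alpha>" "\<alpha> \<le> 1"
  defines "\<phi> \<equiv> \<lambda>s. exp (- (qform s powr of_real \<alpha>))"
  shows "\<phi> holomorphic_on ball 0 (norm \<xi> / 8)"
    and "\<And>s. s \<in> ball 0 (norm \<xi> / 8) \<Longrightarrow> norm (\<phi> s) \<le> exp (- (norm \<xi> powr (2 * \<alpha>)) / 6)"
    and "\<And>s. s \<in> ball 0 (norm \<xi> / 8) \<Longrightarrow> norm (\<phi> s - 1) \<le> 2 * norm \<xi> powr (2 * \<alpha>)"
    and "\<And>s. \<phi> (of_real s) = of_real (exp (- (norm (\<xi> + s *\<^sub>R e) powr (2 * \<alpha>))))"
proof -
  have \<xi>0: "0 < norm \<xi>" using \<xi> by simp
  note pw = powr_in_sector[OF qform_near \<xi>0 a]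
  have np: "z \<notin> \<real>\<^sub>\<le>\<^sub>0" if "0 < Re z" for z :: complex
    using that by (auto simp: complex_nonpos_Reals_iff)
  show "\<phi> holomorphic_on ball 0 (norm \<xi> / 8)"
    unfolding \<phi>_def using pw(3) np by (intro holomorphic_intros holomorphic_qform) blast+
  fix s assume s: "s \<in> ball (0::complex) (norm \<xi> / 8)"
  show "norm (\<phi> s) \<le> exp (- (norm \<xi> powr (2 * \<alpha>)) / 6)"
    unfolding \<phi>_def using pw(1)[OF s] by simp
  have "0 \<le> Re (qform s powr of_real \<alpha>)" using pw(1)[OF s] by (rule order_trans[rotated]) simp
  then show "norm (\<phi> s - 1) \<le> 2 * norm \<xi> powr (2 * \<alpha>)"
    unfolding \<phi>_def using norm_exp_minus_one_le pw(2)[OF s] by (meson order_trans)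
next
  fix s :: real
  let ?n = "norm (\<xi> + s *\<^sub>R e)"
  have "of_real (?n\<^sup>2) powr complex_of_real \<alpha> = of_real ((?n\<^sup>2) powr \<alpha>)" by (rule powr_of_real) simp
  also have "(?n\<^sup>2) powr \<alpha> = ?n powr (2 * \<alpha>)"
    using powr_powr[of ?n 2 \<alpha>] by (cases "?n = 0") (simp_all add: powr_numeral)
  finally show "\<phi> (of_real s) = of_real (exp (- (?n powr (2 * \<alpha>))))"
    unfolding \<phi>_def qform_of_real by (simp flip: exp_of_real)
qed

end

section \<open>Symbols at time one and the decay of their kernels\<close>

definition heat_symbol :: "real \<Rightarrow> real^3 \<Rightarrow> complex" where
  "heat_symbol \<alpha> \<xi> = of_real (exp (- (norm \<xi> powr (2 * \<alpha>))))"

definition oseen_symbol :: "real \<Rightarrow> 3 \<Rightarrow> 3 \<Rightarrow> 3 \<Rightarrow> real^3 \<Rightarrow> complex" where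
  "oseen_symbol \<alpha> j h k \<xi> = \<i> * of_real (\<xi> $ k * ((if j = h then 1 else 0) - \<xi> $ j * \<xi> $ h / (norm \<xi>)\<^sup>2)
                           * exp (- (norm \<xi> powr (2 * \<alpha>))))"

lemma borel_measurable_vec_nth [measurable]: "(\<lambda>x::real^'n. x $ i) \<in> borel_measurable borel"
  by (intro borel_measurable_continuous_onI continuous_intros)

lemma borel_measurable_heat_symbol [measurable]: "heat_symbol \<alpha> \<in> borel_measurable borel"
  unfolding heat_symbol_def[abs_def] by measurable

lemma borel_measurable_oseen_symbol [measurable]: "oseen_symbol \<alpha> j h k \<in> borel_measurable borel"
  unfolding oseen_symbol_def[abs_def] by measurable

lemma norm_leray_le:
  fixes \<xi> :: "real^3"
  shows "\<bar>(if j = h then 1 else 0) - \<xi> $ j * \<xi> $ h / (norm \<xi>)\<^sup>2\<bar> \<le> 2"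
proof -
  have "\<bar>\<xi> $ j * \<xi> $ h\<bar> \<le> norm \<xi> * norm \<xi>"
    unfolding abs_mult by (intro mult_mono component_le_norm_cart) auto
  then have "\<bar>\<xi> $ j * \<xi> $ h / (norm \<xi>)\<^sup>2\<bar> \<le> 1"
    by (auto simp: abs_divide power2_eq_square divide_le_eq_1)
  moreover have "(if j = h then 1 else 0) \<in> {0, 1::real}" by simp
  ultimately show ?thesis unfolding abs_le_iff by (elim insertE) auto
qed

lemma norm_oseen_symbol_le:
  "norm (oseen_symbol \<alpha> j h k \<xi>) \<le> 2 * norm \<xi> * exp (- (norm \<xi> powr (2 * \<alpha>)))"
proof -
  have "norm (oseen_symbol \<alpha> j h k \<xi>) =
      \<bar>\<xi> $ k\<bar> * \<bar>(if j = h then 1 else 0) - \<xi> $ j * \<xi> $ h / (norm \<xi>)\<^sup>2\<bar> * exp (- (norm \<xi> powr (2 * \<alpha>)))"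
    unfolding oseen_symbol_def norm_mult norm_of_real by (simp add: abs_mult)
  also have "\<dots> \<le> norm \<xi> * 2 * exp (- (norm \<xi> powr (2 * \<alpha>)))"
    by (intro mult_right_mono mult_mono component_le_norm_cart norm_leray_le) auto
  finally show ?thesis by simp
qed

lemma integrable_heat_symbol:
  assumes "1/2 < \<alpha>" shows "integrable lborel (heat_symbol \<alpha>)"
proof (rule Bochner_Integration.integrable_bound[OF integrable_mult_right[OF integrable_bump]])
  have "exp (- (norm \<xi> powr (2 * \<alpha>))) \<le> 120 * exp 2 * bump \<xi>" for \<xi> :: "real^3"
  proof -
    have "1 * exp (- (norm \<xi> powr (2 * \<alpha>))) \<le> (1 + norm \<xi>) * exp (- (norm \<xi> powr (2 * \<alpha>)))"
      by (intro mult_right_mono) auto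
    also have "\<dots> \<le> 120 * exp 2 * bump \<xi>" using assms by (intro symbol_decay) auto
    finally show ?thesis by simp
  qed
  then show "AE x in lborel. norm (heat_symbol \<alpha> x) \<le> norm (120 * exp 2 * bump x)"
    by (simp add: heat_symbol_def bump_nonneg abs_mult)
qed measurable

lemma integrable_oseen_symbol:
  assumes "1/2 < \<alpha>" shows "integrable lborel (oseen_symbol \<alpha> j h k)"
proof (rule Bochner_Integration.integrable_bound[OF integrable_mult_right[OF integrable_bump]])
  have "norm (oseen_symbol \<alpha> j h k \<xi>) \<le> 240 * exp 2 * bump \<xi>" for \<xi> :: "real^3"
  proof -
    have "norm (oseen_symbol \<alpha> j h k \<xi>) \<le> 2 * norm \<xi> * exp (- (norm \<xi> powr (2 * \<alpha>)))"
      by (rule norm_oseen_symbol_le)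
    also have "\<dots> \<le> 2 * (1 + norm \<xi>) * exp (- (norm \<xi> powr (2 * \<alpha>)))"
      by (intro mult_right_mono) auto
    also have "\<dots> = 2 * ((1 + norm \<xi>) * exp (- (norm \<xi> powr (2 * \<alpha>))))" by simp
    also have "\<dots> \<le> 2 * (120 * exp 2 * bump \<xi>)" using assms by (intro mult_left_mono symbol_decay) auto
    finally show ?thesis by simp
  qed
  then show "AE x in lborel. norm (oseen_symbol \<alpha> j h k x) \<le> norm (240 * exp 2 * bump x)"
    by (simp add: bump_nonneg abs_mult)
qed measurable

text \<open>The constant to subtract is 1 for small frequencies and 0 for large ones. Near the
  origin the symbol differs from 1 by order \<open>norm \<xi> powr (2 * \<alpha>)\<close>, which is
  at most linear there because 2 \<alpha> \<ge> 1.\<close>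

lemma heat_symbol_kernel_decay:
  assumes a: "1/2 < \<alpha>" "\<alpha> \<le> 1"
  shows "\<exists>B\<ge>0. \<forall>x. norm (kernel_of_symbol (heat_symbol \<alpha>) x) \<le> B * bump x"
proof (rule kernel_decay[OF integrable_heat_symbol, where C = 2 and ?b0.0 = 1])
  fix \<xi> :: "real^3"
  have "1 - exp (- (norm \<xi> powr (2 * \<alpha>))) \<le> norm \<xi>"
  proof (cases "norm \<xi> \<le> 1")
    case True
    have "norm \<xi> powr (2 * \<alpha>) \<le> norm \<xi> powr 1" using a True by (intro powr_mono') auto
    then show ?thesis using exp_ge_add_one_self[of "- (norm \<xi> powr (2 * \<alpha>))"] by simp
  qed (use exp_gt_zero[of "- (norm \<xi> powr (2 * \<alpha>))"] in linarith)
  moreover have "heat_symbol \<alpha> \<xi> - 1 = of_real (exp (- (norm \<xi> powr (2 * \<alpha>))) - 1)"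
    by (simp add: heat_symbol_def)
  ultimately show "norm (heat_symbol \<alpha> \<xi> - 1) \<le> 2 * norm \<xi>" by (simp only: norm_of_real) (use norm_ge_zero[of \<xi>] in \<open>simp del: norm_ge_zero\<close>)
next
  fix \<xi> e :: "real^3" assume \<xi>: "\<xi> \<noteq> 0" and e: "norm e = 1"
  note ext = heat_symbol_extension[OF \<xi> e a]
  let ?\<phi> = "\<lambda>s. exp (- (qform \<xi> e s powr of_real \<alpha>))"
  show "\<exists>b \<phi>. \<phi> holomorphic_on ball 0 (norm \<xi> / 8) \<and>
       (\<forall>z\<in>ball 0 (norm \<xi> / 8). cmod (\<phi> z - b) \<le> 2 * min (norm \<xi>) 1) \<and>
       (\<forall>s. \<bar>s\<bar> < norm \<xi> / 8 \<longrightarrow> \<phi> (complex_of_real s) = heat_symbol \<alpha> (\<xi> + s *\<^sub>R e))"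
  proof (intro exI[of _ "if norm \<xi> \<le> 1 then 1 else 0"] exI[of _ ?\<phi>] conjI ballI allI impI)
    fix z assume z: "z \<in> ball (0::complex) (norm \<xi> / 8)"
    show "cmod (?\<phi> z - (if norm \<xi> \<le> 1 then 1 else 0)) \<le> 2 * min (norm \<xi>) 1"
    proof (cases "norm \<xi> \<le> 1")
      case True
      have "norm \<xi> powr (2 * \<alpha>) \<le> norm \<xi> powr 1" using a True by (intro powr_mono') auto
      then show ?thesis using ext(3)[OF z] True by simp
    next
      case False
      have "norm (?\<phi> z) \<le> exp (- (norm \<xi> powr (2 * \<alpha>)) / 6)" by (rule ext(2)[OF z])
      also have "\<dots> \<le> 1" by simp
      finally have "norm (?\<phi> z) \<le> 1" .
      moreover have "min (norm \<xi>) 1 = 1" using False by simp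
      ultimately show ?thesis using False by (simp only: if_False diff_0_right)
    qed
  qed (use ext(1,4) in \<open>auto simp: heat_symbol_def\<close>)
qed (use a in auto)

text \<open>The symbol vanishes to first order at the origin, so the constant is 0 throughout. On
  the disc a coordinate is at most 9/8 R and the quotient at most 2 (9/8)^2 \<le> 3, so an entry of
  the projector is at most 4; with R exp (- R / 6) \<le> 6 the product is at most 27.\<close>

lemma oseen_symbol_kernel_decay:
  assumes a: "1/2 < \<alpha>" "\<alpha> \<le> 1"
  shows "\<exists>B\<ge>0. \<forall>x. norm (kernel_of_symbol (oseen_symbol \<alpha> j h k) x) \<le> B * bump x"
proof (rule kernel_decay[OF integrable_oseen_symbol, where C = 30 and ?b0.0 = 0])
  fix \<xi> :: "real^3"
  have "2 * norm \<xi> * exp (- (norm \<xi> powr (2 * \<alpha>))) \<le> 2 * norm \<xi> * 1" by (intro mult_left_mono) auto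
  then show "norm (oseen_symbol \<alpha> j h k \<xi> - 0) \<le> 30 * norm \<xi>"
    using norm_oseen_symbol_le[of \<alpha> j h k \<xi>] norm_ge_zero[of \<xi>] unfolding diff_0_right by linarith
next
  fix \<xi> e :: "real^3" assume \<xi>: "\<xi> \<noteq> 0" and e: "norm e = 1"
  note ext = heat_symbol_extension[OF \<xi> e a]
  let ?R = "norm \<xi>"
  have R: "0 < ?R" using \<xi> by simp
  let ?z = "\<lambda>s i. of_real (\<xi> $ i) + s * of_real (e $ i) :: complex"
  let ?\<phi> = "\<lambda>s. \<i> * (?z s k * ((if j = h then 1 else 0) - ?z s j * ?z s h / qform \<xi> e s) * exp (- (qform \<xi> e s powr of_real \<alpha>)))"
  have Q: "qform \<xi> e s \<noteq> 0" "?R\<^sup>2 / 2 \<le> norm (qform \<xi> e s)" if "s \<in> ball 0 (?R / 8)" for s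
    using powr_in_sector(3,4)[OF qform_near[OF \<xi> e that] R a] by auto
  show "\<exists>b \<phi>. \<phi> holomorphic_on ball 0 (norm \<xi> / 8) \<and>
       (\<forall>z\<in>ball 0 (norm \<xi> / 8). cmod (\<phi> z - b) \<le> 30 * min (norm \<xi>) 1) \<and>
       (\<forall>s. \<bar>s\<bar> < norm \<xi> / 8 \<longrightarrow> \<phi> (complex_of_real s) = oseen_symbol \<alpha> j h k (\<xi> + s *\<^sub>R e))"
  proof (intro exI[of _ 0] exI[of _ ?\<phi>] conjI ballI allI impI)
    show "?\<phi> holomorphic_on ball 0 (norm \<xi> / 8)"
      using Q(1) by (intro holomorphic_intros holomorphic_qform ext(1) \<xi> e) auto
  next
    fix s assume s: "s \<in> ball (0::complex) (norm \<xi> / 8)"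
    have z: "norm (?z s i) \<le> 9/8 * ?R" for i
    proof -
      have "norm (?z s i) \<le> \<bar>\<xi> $ i\<bar> + norm s * \<bar>e $ i\<bar>"
        by (rule order_trans[OF norm_triangle_ineq]) (simp add: norm_mult)
      also have "\<dots> \<le> ?R + ?R / 8 * 1"
        using s component_le_norm_cart[of e i] e
        by (intro add_mono mult_mono component_le_norm_cart) auto
      finally show ?thesis by simp
    qed
    have "norm (?z s j * ?z s h / qform \<xi> e s) \<le> (9/8 * ?R * (9/8 * ?R)) / (?R\<^sup>2 / 2)"
      unfolding norm_divide norm_mult using R Q(2)[OF s] by (intro frac_le mult_mono z) auto
    also have "\<dots> \<le> 3" using R by (simp add: power2_eq_square)
    finally have 3: "norm (?z s j * ?z s h / qform \<xi> e s) \<le> 3" .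
    have 4: "norm ((if j = h then 1 else 0) - ?z s j * ?z s h / qform \<xi> e s) \<le> 4"
      by (rule order_trans[OF norm_triangle_ineq4]) (use 3 in auto)
    have "norm (?\<phi> s) \<le> 9/8 * ?R * 4 * exp (- (?R powr (2 * \<alpha>)) / 6)"
      unfolding norm_mult using R by (simp only: norm_ii mult_1_left) (intro mult_mono z 4 ext(2)[OF s]; simp)
    also have "\<dots> \<le> 30 * min ?R 1"
    proof (cases "?R \<le> 1")
      case True
      have "9/8 * ?R * 4 * exp (- (?R powr (2 * \<alpha>)) / 6) \<le> 9/8 * ?R * 4 * 1"
        by (intro mult_left_mono) auto
      also have "\<dots> \<le> 30 * min ?R 1" using True R by simp
      finally show ?thesis .
    next
      case False
      have "?R powr 1 \<le> ?R powr (2 * \<alpha>)" using a False by (intro powr_mono) auto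
      then have "exp (- (?R powr (2 * \<alpha>)) / 6) \<le> exp (- (?R / 6))" using R by simp
      moreover have "?R * exp (- (?R / 6)) \<le> 6"
        using exp_ge_add_one_self[of "?R / 6"] by (simp add: exp_minus divide_simps)
      moreover have "?R * exp (- (?R powr (2 * \<alpha>)) / 6) \<le> ?R * exp (- (?R / 6))"
        using calculation(1) by (intro mult_left_mono) auto
      ultimately have "?R * exp (- (?R powr (2 * \<alpha>)) / 6) \<le> 6" by linarith
      then show ?thesis using False by simp
    qed
    finally show "norm (?\<phi> s - 0) \<le> 30 * min ?R 1" by simp
  next
    fix s :: real
    show "?\<phi> (of_real s) = oseen_symbol \<alpha> j h k (\<xi> + s *\<^sub>R e)"
      unfolding ext(4) unfolding qform_of_real[OF \<xi> e] oseen_symbol_def by simp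
  qed
qed (use a in auto)

section \<open>Scaling to arbitrary times\<close>

text \<open>The mass preserving dilation of \<open>bump\<close>. The scale belonging to time t is
  \<open>t powr (1 / (2 * \<alpha>))\<close>.\<close>

definition majorant :: "real \<Rightarrow> real^3 \<Rightarrow> real" where
  "majorant \<tau> x = bump (x /\<^sub>R \<tau>) / \<tau> ^ 3"

lemma kernel_of_symbol_scale:
  assumes [measurable]: "m \<in> borel_measurable borel" and "0 < \<tau>"
  shows "kernel_of_symbol (\<lambda>\<xi>. m (\<tau> *\<^sub>R \<xi>)) x = kernel_of_symbol m (x /\<^sub>R \<tau>) / of_real (\<tau> ^ 3)"
proof -
  let ?F = "\<lambda>\<eta>. cis ((x /\<^sub>R \<tau>) \<bullet> \<eta>) * m \<eta>"
  have "(LINT \<eta>|lborel. ?F \<eta>) = (LINT \<eta>|density (distr lborel borel (\<lambda>\<xi>. 0 + \<tau> *\<^sub>R \<xi>)) (\<lambda>_. \<bar>\<tau>\<bar> ^ DIM(real^3)). ?F \<eta>)"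
    by (subst lborel_affine[of \<tau> 0]) (use \<open>0 < \<tau>\<close> in auto)
  also have "\<dots> = (LINT \<eta>|distr lborel borel (\<lambda>\<xi>. 0 + \<tau> *\<^sub>R \<xi>). (\<bar>\<tau>\<bar> ^ DIM(real^3)) *\<^sub>R ?F \<eta>)"
    by (rule integral_density) measurable
  also have "\<dots> = (LINT \<xi>|lborel. (\<bar>\<tau>\<bar> ^ DIM(real^3)) *\<^sub>R ?F (0 + \<tau> *\<^sub>R \<xi>))"
    by (rule integral_distr) measurable
  also have "\<dots> = (LINT \<xi>|lborel. \<tau> ^ 3 *\<^sub>R ?F (\<tau> *\<^sub>R \<xi>))"
    using \<open>0 < \<tau>\<close> by simp
  also have "\<dots> = of_real (\<tau> ^ 3) * (LINT \<xi>|lborel. cis (x \<bullet> \<xi>) * m (\<tau> *\<^sub>R \<xi>))"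
  proof -
    have "(x /\<^sub>R \<tau>) \<bullet> (\<tau> *\<^sub>R \<xi>) = x \<bullet> \<xi>" for \<xi> using \<open>0 < \<tau>\<close> by simp
    then show ?thesis by (simp only: integral_mult_right_zero scaleR_conv_of_real[where 'a = complex])
  qed
  finally show ?thesis using \<open>0 < \<tau>\<close> by (simp add: kernel_of_symbol_lborel)
qed

lemma kernel_of_symbol_cmult:
  "kernel_of_symbol (\<lambda>\<xi>. c * m \<xi>) x = c * kernel_of_symbol m x"
  unfolding kernel_of_symbol_def by (subst mult.left_commute) simp

lemma powr_scale:
  assumes "0 < t" "1/2 < \<alpha>"
  shows "norm (t powr (1 / (2 * \<alpha>)) *\<^sub>R (\<xi>::real^3)) powr (2 * \<alpha>) = t * norm \<xi> powr (2 * \<alpha>)"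
  using assms by (simp add: powr_mult powr_powr)

lemma heat_kernel_bound:
  assumes a: "1/2 < \<alpha>" "\<alpha> \<le> 1"
  shows "\<exists>B\<ge>0. \<forall>t x. 0 < t \<longrightarrow> \<bar>heat_kernel \<alpha> t x\<bar> \<le> B * majorant (t powr (1 / (2 * \<alpha>))) x"
proof -
  obtain B where B: "0 \<le> B" "\<And>x. norm (kernel_of_symbol (heat_symbol \<alpha>) x) \<le> B * bump x"
    using heat_symbol_kernel_decay[OF a] by blast
  have "\<bar>heat_kernel \<alpha> t x\<bar> \<le> B * majorant (t powr (1 / (2 * \<alpha>))) x" if t: "0 < t" for t x
  proof -
    define \<tau> where "\<tau> = t powr (1 / (2 * \<alpha>))"
    have \<tau>: "0 < \<tau>" using t by (simp add: \<tau>_def)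
    have "(\<lambda>\<xi>. complex_of_real (exp (- t * norm \<xi> powr (2 * \<alpha>)))) = (\<lambda>\<xi>::real^3. heat_symbol \<alpha> (\<tau> *\<^sub>R \<xi>))"
      unfolding heat_symbol_def \<tau>_def powr_scale[OF t a(1)] by simp
    then have "\<bar>heat_kernel \<alpha> t x\<bar> \<le> norm (kernel_of_symbol (\<lambda>\<xi>::real^3. heat_symbol \<alpha> (\<tau> *\<^sub>R \<xi>)) x)"
      unfolding heat_kernel_def by (simp only: abs_Re_le_cmod)
    also have "\<dots> = norm (kernel_of_symbol (heat_symbol \<alpha>) (x /\<^sub>R \<tau>)) / \<tau> ^ 3"
      using \<tau> by (subst kernel_of_symbol_scale) (auto simp: norm_divide norm_power)
    also have "\<dots> \<le> B * bump (x /\<^sub>R \<tau>) / \<tau> ^ 3"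
      using \<tau> by (intro divide_right_mono B) auto
    finally show ?thesis by (simp add: majorant_def \<tau>_def)
  qed
  then show ?thesis using B(1) by blast
qed

text \<open>Apart from the exponential the symbol is homogeneous of degree one, so at time t it is
  the dilated symbol of time one divided by the scale; hence the extra factor.\<close>

lemma oseen_kernel_bound:
  assumes a: "1/2 < \<alpha>" "\<alpha> \<le> 1"
  shows "\<exists>B\<ge>0. \<forall>t j h k x. 0 < t \<longrightarrow>
     \<bar>oseen_kernel \<alpha> t j h k x\<bar> \<le> B / t powr (1 / (2 * \<alpha>)) * majorant (t powr (1 / (2 * \<alpha>))) x"
proof -
  have "\<forall>j h k. \<exists>B. 0 \<le> B \<and> (\<forall>x. norm (kernel_of_symbol (oseen_symbol \<alpha> j h k) x) \<le> B * bump x)"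
    using oseen_symbol_kernel_decay[OF a] by blast
  then obtain b where b: "\<And>j h k. 0 \<le> b j h k"
    "\<And>j h k x. norm (kernel_of_symbol (oseen_symbol \<alpha> j h k) x) \<le> b j h k * bump x"
    by metis
  \<comment> \<open>The sum over the 27 index triples dominates every single constant.\<close>
  define B where "B = (\<Sum>j\<in>UNIV. \<Sum>h\<in>UNIV. \<Sum>k\<in>UNIV. b j h k)"
  have B0: "0 \<le> B" unfolding B_def by (intro sum_nonneg b)
  have bB: "b j h k \<le> B" for j h k
  proof -
    have "b j h k \<le> (\<Sum>k\<in>UNIV. b j h k)" by (rule member_le_sum) (auto intro: b)
    also have "\<dots> \<le> (\<Sum>h\<in>UNIV. \<Sum>k\<in>UNIV. b j h k)"
      by (rule member_le_sum[where f = "\<lambda>h. \<Sum>k\<in>UNIV. b j h k"]) (auto intro!: b sum_nonneg)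
    also have "\<dots> \<le> B" unfolding B_def
      by (rule member_le_sum[where f = "\<lambda>j. \<Sum>h\<in>UNIV. \<Sum>k\<in>UNIV. b j h k"]) (auto intro!: b sum_nonneg)
    finally show ?thesis .
  qed
  have "\<bar>oseen_kernel \<alpha> t j h k x\<bar> \<le> B / t powr (1 / (2 * \<alpha>)) * majorant (t powr (1 / (2 * \<alpha>))) x"
    if t: "0 < t" for t x j h k
  proof -
    define \<tau> where "\<tau> = t powr (1 / (2 * \<alpha>))"
    have \<tau>: "0 < \<tau>" using t by (simp add: \<tau>_def)
    have "\<i> * complex_of_real (\<xi> $ k * ((if j = h then 1 else 0) - \<xi> $ j * \<xi> $ h / (norm \<xi>)\<^sup>2)
                           * exp (- t * norm \<xi> powr (2 * \<alpha>))) = of_real (1 / \<tau>) * oseen_symbol \<alpha> j h k (\<tau> *\<^sub>R \<xi>)" for \<xi> :: "real^3"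
    proof -
      have "(\<tau> *\<^sub>R \<xi>) $ j * (\<tau> *\<^sub>R \<xi>) $ h / (norm (\<tau> *\<^sub>R \<xi>))\<^sup>2 = \<xi> $ j * \<xi> $ h / (norm \<xi>)\<^sup>2"
        using \<tau> by (simp add: power2_eq_square)
      moreover have "norm (\<tau> *\<^sub>R \<xi>) powr (2 * \<alpha>) = t * norm \<xi> powr (2 * \<alpha>)"
        unfolding \<tau>_def by (rule powr_scale[OF t a(1)])
      ultimately show ?thesis unfolding oseen_symbol_def using \<tau> by (simp only:) simp
    qed
    then have "\<bar>oseen_kernel \<alpha> t j h k x\<bar> \<le> norm (kernel_of_symbol (\<lambda>\<xi>::real^3. of_real (1 / \<tau>) * oseen_symbol \<alpha> j h k (\<tau> *\<^sub>R \<xi>)) x)"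
      unfolding oseen_kernel_def by (simp only: abs_Re_le_cmod)
    also have "\<dots> = 1 / \<tau> * (norm (kernel_of_symbol (oseen_symbol \<alpha> j h k) (x /\<^sub>R \<tau>)) / \<tau> ^ 3)"
      using \<tau> by (subst kernel_of_symbol_cmult, subst kernel_of_symbol_scale) (auto simp: norm_divide norm_power norm_mult)
    also have "\<dots> \<le> 1 / \<tau> * (B * bump (x /\<^sub>R \<tau>) / \<tau> ^ 3)"
      using \<tau> bB by (intro mult_left_mono divide_right_mono order_trans[OF b(2)] mult_right_mono) (auto simp: bump_nonneg)
    finally show ?thesis by (simp add: majorant_def \<tau>_def)
  qed
  then show ?thesis using B0 by blast
qed

lemma borel_measurable_kernel_of_symbol:
  fixes m :: "real \<Rightarrow> real^3 \<Rightarrow> complex"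
  assumes [measurable]: "(\<lambda>(t, \<xi>). m t \<xi>) \<in> borel_measurable (borel \<Otimes>\<^sub>M borel)"
  shows "(\<lambda>(t, x). kernel_of_symbol (m t) x) \<in> borel_measurable (borel \<Otimes>\<^sub>M borel)"
proof -
  have m[measurable]: "m t \<in> borel_measurable borel" for t
    using measurable_compose[OF measurable_Pair1' assms, of t] by simp
  have [measurable]: "cis \<in> borel_measurable borel"
    by (intro borel_measurable_continuous_onI continuous_intros)
  have [measurable]: "(\<lambda>((t, x), \<xi>). cis (x \<bullet> \<xi>) * m t \<xi>) \<in> borel_measurable ((borel \<Otimes>\<^sub>M borel) \<Otimes>\<^sub>M lborel)"
  proof -
    have "(\<lambda>z. cis (snd (fst z) \<bullet> snd z)) \<in> borel_measurable (((borel :: real measure) \<Otimes>\<^sub>M (borel :: (real^3) measure)) \<Otimes>\<^sub>M (lborel :: (real^3) measure))"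
      by measurable
    then show ?thesis by (simp add: case_prod_unfold)
  qed
  show ?thesis unfolding kernel_of_symbol_lborel[OF m] case_prod_unfold
    by measurable
qed

section \<open>Variable exponents tending to infinity\<close>

lemma nn_integral_affine:
  fixes F :: "real^3 \<Rightarrow> ennreal"
  assumes [measurable]: "F \<in> borel_measurable borel" and "c \<noteq> 0"
  shows "(\<integral>\<^sup>+y. F y \<partial>lborel) = ennreal (\<bar>c\<bar> ^ 3) * (\<integral>\<^sup>+w. F (t + c *\<^sub>R w) \<partial>lborel)"
  by (subst lborel_affine[OF \<open>c \<noteq> 0\<close>, of t])
     (simp add: nn_integral_density nn_integral_distr nn_integral_cmult)

lemma borel_measurable_majorant [measurable (raw)]:
  assumes [measurable]: "t \<in> borel_measurable M" "f \<in> borel_measurable M"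
  shows "(\<lambda>x. majorant (t x) (f x)) \<in> borel_measurable M"
  unfolding majorant_def by measurable

lemma majorant_nonneg: "0 < \<tau> \<Longrightarrow> 0 \<le> majorant \<tau> x"
  by (simp add: majorant_def bump_nonneg)

lemma majorant_le: "0 < \<tau> \<Longrightarrow> majorant \<tau> x \<le> 1 / \<tau> ^ 3"
  unfolding majorant_def by (intro divide_right_mono bump_le_1) auto

definition bump_mass where "bump_mass = (LINT x|lborel. bump x)"

lemma bump_mass_nonneg: "0 \<le> bump_mass" unfolding bump_mass_def by (intro integral_nonneg_AE) (auto simp: bump_nonneg)

lemma nn_integral_bump: "(\<integral>\<^sup>+x. bump x \<partial>lborel) = ennreal bump_mass"
  unfolding bump_mass_def by (rule nn_integral_eq_integral[OF integrable_bump]) (simp add: bump_nonneg)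

lemma nn_integral_majorant:
  assumes "0 < \<tau>"
  shows "(\<integral>\<^sup>+y. majorant \<tau> (x - y) \<partial>lborel) = ennreal bump_mass" "(\<integral>\<^sup>+y. majorant \<tau> (y - x) \<partial>lborel) = ennreal bump_mass"
proof -
  have *: "(\<integral>\<^sup>+w. ennreal (bump (a *\<^sub>R w) / \<tau> ^ 3) \<partial>lborel) = ennreal bump_mass / ennreal (\<tau> ^ 3)"
    if a: "\<bar>a\<bar> = 1" for a :: real
  proof -
    have "bump (a *\<^sub>R w) = bump w" for w using a by (simp add: bump_def)
    then have "(\<integral>\<^sup>+w. ennreal (bump (a *\<^sub>R w) / \<tau> ^ 3) \<partial>lborel) = (\<integral>\<^sup>+w. ennreal (bump w) / ennreal (\<tau> ^ 3) \<partial>lborel)"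
      using assms by (simp add: divide_ennreal bump_nonneg)
    also have "\<dots> = (\<integral>\<^sup>+w. ennreal (bump w) \<partial>lborel) / ennreal (\<tau> ^ 3)" by (rule nn_integral_divide) measurable
    finally show ?thesis by (simp add: nn_integral_bump)
  qed
  have "ennreal (\<tau> ^ 3) * (ennreal bump_mass / ennreal (\<tau> ^ 3)) = ennreal bump_mass"
    using assms bump_mass_nonneg by (simp add: divide_ennreal flip: ennreal_mult)
  moreover have "(\<integral>\<^sup>+y. majorant \<tau> (x - y) \<partial>lborel) = ennreal (\<tau> ^ 3) * (ennreal bump_mass / ennreal (\<tau> ^ 3))"
    using assms nn_integral_affine[of "\<lambda>y. majorant \<tau> (x - y)" "- \<tau>" x] *[of 1] by (simp add: majorant_def)
  moreover have "(\<integral>\<^sup>+y. majorant \<tau> (y - x) \<partial>lborel) = ennreal (\<tau> ^ 3) * (ennreal bump_mass / ennreal (\<tau> ^ 3))"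
    using assms nn_integral_affine[of "\<lambda>y. majorant \<tau> (y - x)" "\<tau>" x] *[of 1] by (simp add: majorant_def)
  ultimately show "(\<integral>\<^sup>+y. majorant \<tau> (x - y) \<partial>lborel) = ennreal bump_mass" "(\<integral>\<^sup>+y. majorant \<tau> (y - x) \<partial>lborel) = ennreal bump_mass"
    by simp_all
qed

text \<open>\<open>decay\<close> is log-Hoelder continuity at infinity with limit value 0 of 1/q.
  The bound by r holds only almost everywhere, which is all that an essential infimum
  supplies.\<close>

locale log_exp =
  fixes q :: "real^3 \<Rightarrow> ennreal" and c r :: real
  assumes q_ge_1: "\<And>x. 1 \<le> q x" and c_pos: "0 < c" and r_ge_2: "2 \<le> r"
    and loc: "\<And>x y. \<bar>enn2real (1 / q x) - enn2real (1 / q y)\<bar> \<le> c / ln (exp 1 + 1 / norm (x - y))"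
    and decay: "\<And>x. enn2real (1 / q x) \<le> c / ln (exp 1 + norm x)"
    and r_le: "AE x in lborel. ennreal r \<le> q x"
begin

definition g :: "real^3 \<Rightarrow> real" where "g x = enn2real (1 / q x)"

lemma g_nonneg: "0 \<le> g x" by (simp add: g_def)

lemma q_cases:
  obtains "q x = \<infinity>" "g x = 0" | a where "1 \<le> a" "q x = ennreal a" "g x = 1 / a"
proof (cases "q x")
  case (real a)
  have "1 \<le> a" using q_ge_1[of x] real by (metis ennreal_le_iff ennreal_1)
  then have "1 / q x = ennreal (1 / a)" using real by (metis divide_ennreal ennreal_1 less_le_trans zero_less_one zero_le_one)
  then show ?thesis using that(2)[of a] real \<open>1 \<le> a\<close> by (simp add: g_def)
qed (use that(1) in \<open>simp add: g_def\<close>)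

lemma g_le_1: "g x \<le> 1" by (rule q_cases[of x]) (auto simp: divide_le_eq_1)

text \<open>In terms of g the infinite exponent is the single case \<open>g x = 0\<close>, and
  measurability of the modular density reduces to that of a real function.\<close>

lemma omega_eq:
  "omega (q x) s = (if g x = 0 then (if s \<le> 1 then 0 else \<infinity>) else ennreal (s powr (1 / g x)))"
  by (rule q_cases[of x]) (auto simp: omega_def)

lemma ln_ge_1: "0 \<le> a \<Longrightarrow> 1 \<le> ln (exp 1 + a)" for a :: real
  by (subst ln_ge_iff) (auto intro: add_pos_nonneg)

text \<open>The modulus of continuity \<open>c / ln (exp 1 + 1 / s)\<close> tends to 0 with s. Hence
  g is Borel and not merely Lebesgue measurable, so that modulars can be computed over
  \<open>lborel\<close>.\<close>

lemma continuous_g: "continuous_on UNIV g"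
proof (rule continuous_at_imp_continuous_on, rule ballI)
  fix x :: "real^3"
  have "((\<lambda>s::real. c / ln (exp 1 + 1 / s)) \<longlongrightarrow> 0) (at_right 0)"
    by (rule tendsto_divide_0[OF tendsto_const]) 
       (intro filterlim_at_top_imp_at_infinity filterlim_compose[OF ln_at_top] filterlim_tendsto_add_at_top[OF tendsto_const] filterlim_inverse_at_top_right[unfolded inverse_eq_divide])
  moreover have "filterlim (\<lambda>y. norm (y - x)) (at_right 0) (at x)"
    unfolding filterlim_at
    by (auto intro!: tendsto_eq_intros simp: eventually_at_filter)
  ultimately have lim: "((\<lambda>y. c / ln (exp 1 + 1 / norm (y - x))) \<longlongrightarrow> 0) (at x)"
    by (rule filterlim_compose)
  have "((\<lambda>y. g y - g x) \<longlongrightarrow> 0) (at x)"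
    by (rule tendsto_rabs_zero_cancel, rule tendsto_sandwich[OF _ _ tendsto_const lim]) (use loc in \<open>auto simp: g_def\<close>)
  then show "isCont g x" unfolding isCont_def using LIM_zero_iff by blast
qed

lemma borel_measurable_g [measurable]: "g \<in> borel_measurable borel"
  by (rule borel_measurable_continuous_onI[OF continuous_g])

lemma borel_measurable_omega [measurable (raw)]:
  assumes [measurable]: "f \<in> borel_measurable M" "z \<in> borel_measurable M"
  shows "(\<lambda>w. omega (q (f w)) (z w)) \<in> borel_measurable M"
  unfolding omega_eq by measurable

lemma omega_mono: "0 \<le> s \<Longrightarrow> s \<le> s' \<Longrightarrow> omega (q x) s \<le> omega (q x) s'"
  unfolding omega_eq using g_nonneg[of x] by (auto intro!: ennreal_leI powr_mono2)

lemma omega_scale: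
  assumes "0 \<le> s" "1 \<le> D"
  shows "omega (q x) (s / D) \<le> ennreal (1 / D) * omega (q x) s"
proof (cases "g x = 0")
  case True
  have "s \<le> 1 \<Longrightarrow> s / D \<le> 1" using assms by (simp add: divide_le_eq)
  then show ?thesis using True assms by (auto simp: omega_eq ennreal_mult_top)
next
  case False
  then have g: "0 < g x" "g x \<le> 1" using g_nonneg[of x] g_le_1[of x] by auto
  have "(s / D) powr (1 / g x) = s powr (1 / g x) / D powr (1 / g x)" using assms by (simp add: powr_divide)
  also have "\<dots> \<le> s powr (1 / g x) / D powr 1"
    using g assms by (intro divide_left_mono powr_mono) (auto simp: field_simps)
  finally show ?thesis using assms False by (simp add: omega_eq flip: ennreal_mult)
qed

lemma omega_max: "omega (q x) (max a b) \<le> omega (q x) a + omega (q x) b"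
  by (cases "a \<le> b") (auto simp: max_def)

text \<open>A substitute for Jensen's inequality at level X: either z is below
  \<open>X powr \<kappa>\<close>, or their quotient exceeds one, grows under the power 1 / g y, and
  then is at most the modular density over X because \<kappa> / g y \<ge> 1. The point is that the
  right side is affine in the density.\<close>

lemma le_omega:
  assumes X: "1 \<le> X" and \<kappa>: "g y \<le> \<kappa>" "0 \<le> \<kappa>" and z: "0 \<le> z"
  shows "ennreal z \<le> ennreal (X powr \<kappa>) * (1 + omega (q y) z / ennreal X)"
proof -
  let ?M = "X powr \<kappa>"
  have M: "1 \<le> ?M" using X \<kappa> by (simp add: ge_one_powr_ge_zero)
  show ?thesis
  proof (cases "z \<le> ?M")
    case True
    then have "ennreal z \<le> ennreal ?M * 1" by (simp add: ennreal_leI)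
    also have "\<dots> \<le> ennreal ?M * (1 + omega (q y) z / ennreal X)" by (intro mult_left_mono) auto
    finally show ?thesis .
  next
    case False
    show ?thesis
    proof (cases "g y = 0")
      case True
      then have "omega (q y) z = \<infinity>" using False M by (simp add: omega_eq)
      then show ?thesis using M X by (simp add: ennreal_top_divide ennreal_mult_top)
    next
      case g0: False
      then have g: "0 < g y" "g y \<le> 1" using g_nonneg[of y] g_le_1[of y] by auto
      have zM: "1 < z / ?M" using False M X by (simp add: less_divide_eq)
      then have "(z / ?M) powr 1 \<le> (z / ?M) powr (1 / g y)" using g by (intro powr_mono) (auto simp: field_simps)
      also have "\<dots> = z powr (1 / g y) / X powr (\<kappa> / g y)" using z by (simp add: powr_divide powr_powr)
      also have "\<dots> \<le> z powr (1 / g y) / X powr 1"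
        using X g \<kappa> by (intro divide_left_mono powr_mono) (auto simp: le_divide_eq)
      finally have "z / ?M \<le> z powr (1 / g y) / X" using zM X z by simp
      moreover have "0 < ?M" using M by linarith
      ultimately have "z \<le> ?M * (z powr (1 / g y) / X)" by (simp only: pos_divide_le_eq mult.commute)
      then have "ennreal z \<le> ennreal ?M * (omega (q y) z / ennreal X)"
        using X g0 M by (simp add: omega_eq divide_ennreal flip: ennreal_mult)
      also have "\<dots> \<le> ennreal ?M * (1 + omega (q y) z / ennreal X)" by (intro mult_left_mono) auto
      finally show ?thesis .
    qed
  qed
qed

text \<open>Above the height M the exponent 2 may be raised to q y \<ge> r at the cost
  \<open>M powr (2 - r)\<close>. This is the quantitative form of the decomposition into a bounded
  part and an L^r part.\<close>

lemma square_le_omega: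
  assumes M: "1 \<le> M" and r: "ennreal r \<le> q y" and z: "0 \<le> z"
  shows "ennreal (z\<^sup>2) \<le> ennreal (M powr 2) + ennreal (M powr (2 - r)) * omega (q y) z"
proof (cases "z \<le> M")
  case True
  then have "z\<^sup>2 \<le> M powr 2" using z M by (simp add: powr_numeral power_mono)
  then have "ennreal (z\<^sup>2) \<le> ennreal (M powr 2)" by (rule ennreal_leI)
  then show ?thesis by (simp add: add_increasing2)
next
  case False
  show ?thesis
  proof (cases rule: q_cases[of y])
    case 1
    then have "omega (q y) z = \<infinity>" unfolding omega_eq using False M by simp
    then show ?thesis using M by (simp add: ennreal_mult_top)
  next
    case (2 a)
    have ra: "r \<le> a" using r 2 r_ge_2 by simp
    have zM: "1 < z / M" using False M by (simp add: less_divide_eq)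
    have "(z / M) powr 2 \<le> (z / M) powr a" using zM ra r_ge_2 by (intro powr_mono) auto
    also have "\<dots> = z powr a / M powr a" using z M by (simp add: powr_divide)
    also have "\<dots> \<le> z powr a / M powr r" using M ra by (intro divide_left_mono powr_mono) auto
    finally have "z\<^sup>2 / M powr 2 \<le> z powr a / M powr r" using z M by (simp add: powr_divide powr_numeral)
    then have "z\<^sup>2 \<le> M powr 2 * (z powr a / M powr r)" using M by (simp add: divide_le_eq mult.commute)
    also have "\<dots> = M powr (2 - r) * z powr a" using M by (simp add: powr_diff)
    finally have "ennreal (z\<^sup>2) \<le> ennreal (M powr (2 - r) * z powr a)" by (rule ennreal_leI)
    also have "\<dots> = ennreal (M powr (2 - r)) * omega (q y) z"
      unfolding omega_eq using 2 by (simp add: ennreal_mult)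
    finally have "ennreal (z\<^sup>2) \<le> ennreal (M powr (2 - r)) * omega (q y) z" .
    then show ?thesis by (simp add: add_increasing)
  qed
qed

section \<open>Convolution of modular densities with the majorant\<close>

text \<open>The height \<open>\<tau> powr (-3 / r)\<close> balances the two parts: the bounded one
  costs \<open>M powr 2\<close> times the mass of the majorant, the other
  \<open>M powr (2 - r)\<close> times its supremum, at most \<open>1 / \<tau> ^ 3\<close>; both are
  of order \<open>\<tau> powr (-6 / r)\<close>. Modular 2 instead of 1 admits the maximum of two
  functions.\<close>

lemma majorant_square_estimate:
  assumes [measurable]: "z \<in> borel_measurable borel" and z: "\<And>y. 0 \<le> z y"
    and le: "(\<integral>\<^sup>+y. omega (q y) (z y) \<partial>lborel) \<le> 2" and \<tau>: "0 < \<tau>" "\<tau> \<le> 1"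
  shows "(\<integral>\<^sup>+y. ennreal (majorant \<tau> (x - y)) * ennreal ((1 + z y)\<^sup>2) \<partial>lborel) \<le> ennreal ((4 * bump_mass + 4) * \<tau> powr (-6 / r))"
proof -
  define M where "M = \<tau> powr (-3 / r)"
  have M: "1 \<le> M" using \<tau> r_ge_2 powr_mono'[of "-3 / r" 0 \<tau>] by (simp add: M_def)
  have M2: "M powr 2 = \<tau> powr (-6 / r)" "M powr (2 - r) = \<tau> powr (-6 / r) * \<tau> ^ 3"
  proof -
    show "M powr 2 = \<tau> powr (-6 / r)" by (simp add: M_def powr_powr)
    have "- 3 / r * (2 - r) = -6 / r + 3" using r_ge_2 by (simp add: field_simps)
    then have "M powr (2 - r) = \<tau> powr (-6 / r + 3)" by (simp only: M_def powr_powr)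
    also have "\<dots> = \<tau> powr (-6 / r) * \<tau> powr 3" by (rule powr_add)
    also have "\<dots> = \<tau> powr (-6 / r) * \<tau> ^ 3" using \<tau> by (simp add: powr_numeral)
    finally show "M powr (2 - r) = \<tau> powr (-6 / r) * \<tau> ^ 3" .
  qed
  define N where "N = M powr 2"
  have N: "1 \<le> N" using M by (simp add: N_def ge_one_powr_ge_zero)
  have "AE y in lborel. ennreal (majorant \<tau> (x - y)) * ennreal ((1 + z y)\<^sup>2)
      \<le> ennreal (4 * N) * ennreal (majorant \<tau> (x - y)) + ennreal (2 * N) * omega (q y) (z y)"
    using r_le
  proof eventually_elim
    case (elim y)
    have "(1 + z y)\<^sup>2 \<le> 2 + 2 * (z y)\<^sup>2"
      using zero_le_power2[of "1 - z y"] by (simp add: power2_eq_square algebra_simps)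
    then have "ennreal ((1 + z y)\<^sup>2) \<le> ennreal (2 + 2 * (z y)\<^sup>2)" by (rule ennreal_leI)
    also have "\<dots> = 2 + 2 * ennreal ((z y)\<^sup>2)" by (simp add: ennreal_plus ennreal_mult)
    also have "\<dots> \<le> 2 + 2 * (ennreal N + ennreal (M powr (2 - r)) * omega (q y) (z y))"
      unfolding N_def by (intro add_left_mono mult_left_mono square_le_omega M elim z) auto
    also have "\<dots> = (2 + 2 * ennreal N) + ennreal (2 * M powr (2 - r)) * omega (q y) (z y)"
      by (simp add: distrib_left ennreal_mult mult.assoc add.assoc)
    also have "2 + 2 * ennreal N = ennreal (2 + 2 * N)" using N by (simp add: ennreal_plus ennreal_mult)
    also have "ennreal (2 + 2 * N) \<le> ennreal (4 * N)" using N by (intro ennreal_leI) simp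
    finally have "ennreal ((1 + z y)\<^sup>2) \<le> ennreal (4 * N) + ennreal (2 * M powr (2 - r)) * omega (q y) (z y)"
      by (simp add: add_right_mono)
    then have "ennreal (majorant \<tau> (x - y)) * ennreal ((1 + z y)\<^sup>2)
       \<le> ennreal (majorant \<tau> (x - y)) * (ennreal (4 * N) + ennreal (2 * M powr (2 - r)) * omega (q y) (z y))"
      by (intro mult_left_mono) auto
    also have "\<dots> = ennreal (4 * N) * ennreal (majorant \<tau> (x - y)) + ennreal (majorant \<tau> (x - y) * (2 * M powr (2 - r))) * omega (q y) (z y)"
      using majorant_nonneg[OF \<tau>(1)] by (simp add: distrib_left ennreal_mult mult_ac)
    also have "\<dots> \<le> ennreal (4 * N) * ennreal (majorant \<tau> (x - y)) + ennreal (2 * N) * omega (q y) (z y)"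
    proof (intro add_left_mono mult_right_mono ennreal_leI)
      have "majorant \<tau> (x - y) * (2 * M powr (2 - r)) \<le> 1 / \<tau> ^ 3 * (2 * M powr (2 - r))"
        by (intro mult_right_mono majorant_le \<tau>) auto
      also have "\<dots> = 2 * N" using \<tau> by (simp add: M2 N_def)
      finally show "majorant \<tau> (x - y) * (2 * M powr (2 - r)) \<le> 2 * N" .
    qed auto
    finally show ?case .
  qed
  then have "(\<integral>\<^sup>+y. ennreal (majorant \<tau> (x - y)) * ennreal ((1 + z y)\<^sup>2) \<partial>lborel)
     \<le> (\<integral>\<^sup>+y. ennreal (4 * N) * ennreal (majorant \<tau> (x - y)) + ennreal (2 * N) * omega (q y) (z y) \<partial>lborel)"
    by (rule nn_integral_mono_AE)
  also have "\<dots> = ennreal (4 * N) * ennreal bump_mass + ennreal (2 * N) * (\<integral>\<^sup>+y. omega (q y) (z y) \<partial>lborel)"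
    using nn_integral_majorant(1)[OF \<tau>(1), of x] by (subst nn_integral_add) (auto simp: nn_integral_cmult)
  also have "\<dots> \<le> ennreal (4 * N) * ennreal bump_mass + ennreal (2 * N) * 2"
    by (intro add_left_mono mult_left_mono le) auto
  also have "(2::ennreal) = ennreal 2" by simp
  also have "ennreal (4 * N) * ennreal bump_mass + ennreal (2 * N) * ennreal 2 = ennreal (4 * N * bump_mass + 2 * N * 2)"
    using N bump_mass_nonneg by (subst (1 2) ennreal_mult[symmetric]) (auto simp flip: ennreal_plus)
  also have "4 * N * bump_mass + 2 * N * 2 = (4 * bump_mass + 4) * N" by (simp add: algebra_simps)
  finally show ?thesis by (simp add: N_def M2)
qed

definition smear_const :: real where "smear_const = (exp (22 * c) + 1) * (bump_mass + 2)"

text \<open>Log-Hoelder continuity makes \<open>X powr g y\<close> comparable with \<open>X powr g x\<close> only for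
  \<open>norm (x - y) \<le> \<tau> powr (1/7)\<close>; the threshold is chosen such that \<open>majorant \<tau>\<close> is bounded by one beyond it.\<close>

lemma majorant_estimate:
  assumes [measurable]: "z \<in> borel_measurable borel" and z: "\<And>y. 0 \<le> z y"
    and le: "(\<integral>\<^sup>+y. omega (q y) (z y) \<partial>lborel) \<le> 1" and \<tau>: "0 < \<tau>" "\<tau> \<le> 1"
  defines "S \<equiv> \<lambda>x. (\<integral>\<^sup>+y. ennreal (majorant \<tau> (x - y)) * omega (q y) (z y) \<partial>lborel)"
  shows "(\<integral>\<^sup>+y. ennreal (majorant \<tau> (x - y)) * ennreal (z y) \<partial>lborel) \<le> ennreal (smear_const * max 1 (enn2real (S x)) powr g x)"
proof -
  \<comment> \<open>The level for \<open>le_omega\<close>, chosen so that the averaged modular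
    density divided by X is at most one.\<close>
  define X where "X = max 1 (enn2real (S x))"
  have X: "1 \<le> X" by (simp add: X_def)
  have "S x \<le> (\<integral>\<^sup>+y. ennreal (1 / \<tau> ^ 3) * omega (q y) (z y) \<partial>lborel)"
    unfolding S_def by (intro nn_integral_mono mult_right_mono ennreal_leI majorant_le \<tau>) auto
  also have "\<dots> = ennreal (1 / \<tau> ^ 3) * (\<integral>\<^sup>+y. omega (q y) (z y) \<partial>lborel)" by (rule nn_integral_cmult) measurable
  also have "\<dots> \<le> ennreal (1 / \<tau> ^ 3) * 1" by (intro mult_left_mono le) auto
  finally have Sle: "S x \<le> ennreal (1 / \<tau> ^ 3)" by simp
  then have fin: "S x \<noteq> \<infinity>" by (auto simp: top_unique)
  have "enn2real (S x) \<le> 1 / \<tau> ^ 3" using enn2real_mono[OF Sle] \<tau> by simp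
  moreover have "1 \<le> 1 / \<tau> ^ 3" using \<tau> by (simp add: power_le_one)
  ultimately have Xle: "X \<le> 1 / \<tau> ^ 3" by (simp add: X_def)
  have SX: "S x \<le> ennreal X"
  proof -
    have "S x = ennreal (enn2real (S x))" using fin by (simp add: less_top)
    also have "\<dots> \<le> ennreal X" unfolding X_def by (intro ennreal_leI) simp
    finally show ?thesis .
  qed
  define \<theta> where "\<theta> = \<tau> powr (1/7)"
  have \<theta>: "0 < \<theta>" using \<tau> by (simp add: \<theta>_def)
  define \<epsilon> where "\<epsilon> = c / ln (exp 1 + 1 / \<theta>)"
  have ln0: "0 < ln (exp 1 + 1 / \<theta>)" using ln_ge_1[of "1 / \<theta>"] \<theta> by simp
  have \<epsilon>0: "0 \<le> \<epsilon>" using c_pos ln0 by (simp add: \<epsilon>_def)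
  \<comment> \<open>X is at most 1 / \<tau>^3 = (1 / \<theta>)^21, so ln X is at most 21 times the
    logarithm in the denominator of \<epsilon> and cancels it. The 22 leaves a margin.\<close>
  have X\<epsilon>: "X powr \<epsilon> \<le> exp (22 * c)"
  proof -
    have "ln X \<le> ln (1 / \<tau> ^ 3)" using X Xle by (intro ln_mono) auto
    also have "\<dots> = 21 * ln (1 / \<theta>)" using \<tau> by (simp add: \<theta>_def ln_div ln_powr ln_realpow)
    also have "\<dots> \<le> 21 * ln (exp 1 + 1 / \<theta>)" using \<theta> by (intro mult_left_mono ln_mono) (auto intro: add_pos_pos)
    finally have "\<epsilon> * ln X \<le> \<epsilon> * (21 * ln (exp 1 + 1 / \<theta>))" using \<epsilon>0 by (intro mult_left_mono) auto
    also have "\<dots> = 21 * c" using ln0 by (simp add: \<epsilon>_def)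
    also have "\<dots> \<le> 22 * c" using c_pos by simp
    finally show ?thesis using X by (simp add: powr_def)
  qed
  define E where "E = exp (22 * c) * X powr g x"
  have E1: "1 \<le> X powr g x" using X g_nonneg by (simp add: ge_one_powr_ge_zero)
  have pw: "ennreal (majorant \<tau> (x - y)) * ennreal (z y)
     \<le> ennreal E * (ennreal (majorant \<tau> (x - y)) + ennreal (majorant \<tau> (x - y)) * omega (q y) (z y) / ennreal X)
       + (ennreal (majorant \<tau> (x - y)) + omega (q y) (z y))" for y
  proof (cases "norm (x - y) \<le> \<theta>")
    case True
    have gy: "g y \<le> g x + \<epsilon>"
    proof (cases "x = y")
      case False
      have "g y \<le> g x + c / ln (exp 1 + 1 / norm (x - y))" using loc[of x y] unfolding g_def by linarith
      moreover have "c / ln (exp 1 + 1 / norm (x - y)) \<le> \<epsilon>" unfolding \<epsilon>_def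
      proof (rule divide_left_mono)
        have "1 / \<theta> \<le> 1 / norm (x - y)" using True False by (intro divide_left_mono) (auto simp: \<theta>)
        then show "ln (exp 1 + 1 / \<theta>) \<le> ln (exp 1 + 1 / norm (x - y))"
          using \<theta> by (intro ln_mono) (auto intro!: add_pos_pos)
        then show "0 < ln (exp 1 + 1 / norm (x - y)) * ln (exp 1 + 1 / \<theta>)"
          using ln0 by (intro mult_pos_pos) auto
      qed (use c_pos in auto)
      ultimately show ?thesis by linarith
    qed (use \<epsilon>0 in auto)
    have "X powr (g x + \<epsilon>) \<le> E"
      unfolding E_def powr_add mult.commute[of "X powr g x"] by (rule mult_right_mono[OF X\<epsilon>]) simp
    have "ennreal (z y) \<le> ennreal (X powr (g x + \<epsilon>)) * (1 + omega (q y) (z y) / ennreal X)"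
      using gy \<epsilon>0 g_nonneg[of x] by (intro le_omega X z) auto
    also have "\<dots> \<le> ennreal E * (1 + omega (q y) (z y) / ennreal X)"
      by (intro mult_right_mono ennreal_leI zero_le) fact
    finally have "ennreal (majorant \<tau> (x - y)) * ennreal (z y) \<le> ennreal (majorant \<tau> (x - y)) * (ennreal E * (1 + omega (q y) (z y) / ennreal X))"
      by (intro mult_left_mono) auto
    also have "\<dots> = ennreal E * (ennreal (majorant \<tau> (x - y)) + ennreal (majorant \<tau> (x - y)) * omega (q y) (z y) / ennreal X)"
      by (simp add: distrib_left mult_ac ennreal_times_divide)
    finally show ?thesis by (simp add: add_increasing2)
  next
    case False
    have m1: "majorant \<tau> (x - y) \<le> 1"
    proof -
      have n: "\<tau> powr (-6/7) \<le> 1 + norm ((x - y) /\<^sub>R \<tau>)"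
      proof -
        have "\<tau> powr (-6/7) = \<tau> powr (1/7 - 1)" by simp
        also have "\<dots> = \<theta> / \<tau>" using \<tau> by (simp only: powr_diff \<theta>_def) simp
        also have "\<dots> \<le> norm (x - y) / \<tau>" using False \<tau> by (intro divide_right_mono) auto
        also have "\<dots> = norm ((x - y) /\<^sub>R \<tau>)" using \<tau> by (simp add: inverse_eq_divide)
        finally show ?thesis by linarith
      qed
      have "bump ((x - y) /\<^sub>R \<tau>) \<le> (\<tau> powr (-6/7)) powr (-7/2)"
        unfolding bump_def using n \<tau> by (intro powr_mono2') auto
      also have "\<dots> = \<tau> ^ 3" using \<tau> by (simp add: powr_powr powr_numeral)
      finally show ?thesis using \<tau> by (simp add: majorant_def divide_le_eq)
    qed
    \<comment> \<open>Beyond the threshold level 1 suffices: the majorant is at most one there, so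
      the density contributes no more than the whole modular.\<close>
    have "ennreal (z y) \<le> ennreal (1 powr g y) * (1 + omega (q y) (z y) / ennreal 1)"
      using g_nonneg by (intro le_omega z) auto
    then have "ennreal (z y) \<le> 1 + omega (q y) (z y)" by (simp add: divide_ennreal_def)
    then have "ennreal (majorant \<tau> (x - y)) * ennreal (z y) \<le> ennreal (majorant \<tau> (x - y)) * (1 + omega (q y) (z y))"
      by (intro mult_left_mono) auto
    also have "\<dots> \<le> ennreal (majorant \<tau> (x - y)) + 1 * omega (q y) (z y)"
      unfolding distrib_left using m1 ennreal_leI[OF m1] by (intro add_mono mult_right_mono) auto
    finally show ?thesis by (simp add: add_increasing)
  qed
  have "(\<integral>\<^sup>+y. ennreal (majorant \<tau> (x - y)) * ennreal (z y) \<partial>lborel)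
     \<le> (\<integral>\<^sup>+y. ennreal E * (ennreal (majorant \<tau> (x - y)) + ennreal (majorant \<tau> (x - y)) * omega (q y) (z y) / ennreal X)
       + (ennreal (majorant \<tau> (x - y)) + omega (q y) (z y)) \<partial>lborel)"
    by (intro nn_integral_mono pw)
  also have "\<dots> = ennreal E * (ennreal bump_mass + S x / ennreal X) + (ennreal bump_mass + (\<integral>\<^sup>+y. omega (q y) (z y) \<partial>lborel))"
    using nn_integral_majorant(1)[OF \<tau>(1), of x]
    by (simp add: nn_integral_add nn_integral_cmult nn_integral_divide S_def)
  also have "\<dots> \<le> ennreal E * (ennreal bump_mass + 1) + (ennreal bump_mass + 1)"
  proof (intro add_mono mult_left_mono le order_refl)
    show "S x / ennreal X \<le> 1" using SX X by (simp add: divide_le_posI_ennreal)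
  qed auto
  also have "\<dots> = ennreal ((E + 1) * (bump_mass + 1))"
    using bump_mass_nonneg by (simp add: E_def ennreal_plus ennreal_mult distrib_right)
  also have "\<dots> \<le> ennreal (smear_const * X powr g x)"
  proof (rule ennreal_leI)
    have "(E + 1) * (bump_mass + 1) \<le> (exp (22 * c) * X powr g x + X powr g x) * (bump_mass + 2)"
      using E1 bump_mass_nonneg by (intro mult_mono) (auto simp: E_def)
    then show "(E + 1) * (bump_mass + 1) \<le> smear_const * X powr g x" by (simp add: smear_const_def algebra_simps)
  qed
  finally show "(\<integral>\<^sup>+y. ennreal (majorant \<tau> (x - y)) * ennreal (z y) \<partial>lborel) \<le> ennreal (smear_const * max 1 (enn2real (S x)) powr g x)"
    unfolding X_def .
qed

text \<open>The factor \<open>exp (4 * c)\<close> is where \<open>q\<close> tending to infinity enters: it makes constants integrable.\<close>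

definition norm_const :: "real \<Rightarrow> real" where "norm_const a = exp (4 * c) * (1 + bump_mass + a)"

text \<open>The power 1 / g x turns \<open>X powr g x\<close> into X, while
  \<open>g x \<le> c / ln (exp 1 + norm x)\<close> makes the power of \<open>exp (4 * c)\<close> at
  least \<open>(exp 1 + norm x) ^ 4\<close>, beyond the reciprocal of \<open>bump\<close>. The
  factor D2 absorbs the total mass. Where g x = 0 the scaled function is at most one and contributes
  nothing.\<close>

lemma modular_le_of_powr_bound:
  fixes S :: "real^3 \<Rightarrow> real"
  assumes [measurable]: "S \<in> borel_measurable borel" and S: "\<And>x. 0 \<le> S x"
    and Sa: "(\<integral>\<^sup>+x. S x \<partial>lborel) \<le> ennreal a" and "0 \<le> a" "0 < B"
    and H: "AE x in lborel. 0 \<le> H x \<and> H x \<le> B * max 1 (S x) powr g x"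
  shows "(\<integral>\<^sup>+x. omega (q x) (H x / (norm_const a * B)) \<partial>lborel) \<le> 1"
proof -
  define D2 where "D2 = 1 + bump_mass + a"
  have D2: "1 \<le> D2" using bump_mass_nonneg \<open>0 \<le> a\<close> by (simp add: D2_def)
  have norm_const: "norm_const a = exp (4 * c) * D2" by (simp add: norm_const_def D2_def)
  have "AE x in lborel. omega (q x) (H x / (norm_const a * B)) \<le> ennreal (bump x + S x) / ennreal D2"
    using H
  proof eventually_elim
    case (elim x)
    define X where "X = max 1 (S x)"
    have X: "1 \<le> X" by (simp add: X_def)
    have HB: "H x / (norm_const a * B) \<le> X powr g x / (exp (4 * c) * D2)"
      using elim \<open>0 < B\<close> D2 by (simp add: norm_const X_def field_simps)
    have H0: "0 \<le> H x / (norm_const a * B)" using elim \<open>0 < B\<close> D2 by (simp add: norm_const)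
    show ?case
    proof (cases "g x = 0")
      case True
      have "1 \<le> exp (4 * c) * D2" using D2 c_pos mult_mono[of 1 "exp (4 * c)" 1 D2] by simp
      then have "H x / (norm_const a * B) \<le> 1" using HB True X by (simp add: order_trans[OF HB])
      then show ?thesis using True by (simp add: omega_eq)
    next
      case False
      then have g: "0 < g x" "g x \<le> 1" using g_nonneg[of x] g_le_1[of x] by auto
      have ex: "exp (4 * c) powr (1 / g x) \<ge> (1 + norm x) powr (7/2)"
      proof -
        have "g x * ln (exp 1 + norm x) \<le> c" using decay[of x] ln_ge_1[of "norm x"] unfolding g_def[symmetric]
          by (simp add: le_divide_eq)
        then have "ln (exp 1 + norm x) \<le> c / g x" using g by (simp add: le_divide_eq mult.commute)
        moreover have "ln (1 + norm x) \<le> ln (exp 1 + norm x)" by (intro ln_mono) (auto intro: add_pos_nonneg)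
        moreover have "0 \<le> ln (1 + norm x)" by (intro ln_ge_zero) auto
        ultimately have "7/2 * ln (1 + norm x) \<le> 4 * (c / g x)" by linarith
        moreover have "(1 + norm x) powr (7/2) = exp (7/2 * ln (1 + norm x))"
          using norm_ge_zero[of x] by (simp add: powr_def del: norm_ge_zero)
        moreover have "exp (4 * c) powr (1 / g x) = exp (4 * (c / g x))" by (simp add: powr_def)
        ultimately show ?thesis by simp
      qed
      have D2p: "D2 \<le> D2 powr (1 / g x)" using D2 g powr_mono[of 1 "1 / g x" D2] by simp
      have "(H x / (norm_const a * B)) powr (1 / g x) \<le> (X powr g x / (exp (4 * c) * D2)) powr (1 / g x)"
        using H0 HB g by (intro powr_mono2) auto
      also have "\<dots> = X / (exp (4 * c) powr (1 / g x) * D2 powr (1 / g x))"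
        using X D2 g by (simp add: powr_divide powr_mult powr_powr)
      also have "\<dots> \<le> X / ((1 + norm x) powr (7/2) * D2)"
      proof (intro divide_left_mono mult_mono mult_pos_pos ex D2p)
        show "0 < (1 + norm x) powr (7/2)" using norm_ge_zero[of x] by (simp del: norm_ge_zero)
      qed (use X D2 in auto)
      also have "\<dots> = X * bump x / D2" by (simp add: bump_def powr_minus_divide)
      also have "\<dots> \<le> (bump x + S x) / D2"
      proof (rule divide_right_mono)
        have "X * bump x \<le> (1 + S x) * bump x" using S[of x] by (intro mult_right_mono) (auto simp: X_def bump_nonneg)
        also have "\<dots> \<le> bump x + S x * 1" using S[of x] mult_left_mono[OF bump_le_1[of x] S[of x]] by (simp add: algebra_simps)
        finally show "X * bump x \<le> bump x + S x" by simp
      qed (use D2 in auto)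
      finally have "(H x / (norm_const a * B)) powr (1 / g x) \<le> (bump x + S x) / D2" .
      moreover have "ennreal (bump x + S x) / ennreal D2 = ennreal ((bump x + S x) / D2)"
        using D2 S[of x] by (intro divide_ennreal) (auto simp: bump_nonneg)
      ultimately show ?thesis using False by (simp only: omega_eq if_False ennreal_leI)
    qed
  qed
  then have "(\<integral>\<^sup>+x. omega (q x) (H x / (norm_const a * B)) \<partial>lborel) \<le> (\<integral>\<^sup>+x. ennreal (bump x + S x) / ennreal D2 \<partial>lborel)"
    by (rule nn_integral_mono_AE)
  also have "\<dots> = (\<integral>\<^sup>+x. ennreal (bump x) + ennreal (S x) \<partial>lborel) / ennreal D2"
    using S by (simp add: nn_integral_divide bump_nonneg ennreal_plus)
  also have "\<dots> = (ennreal bump_mass + (\<integral>\<^sup>+x. S x \<partial>lborel)) / ennreal D2"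
    by (subst nn_integral_add) (auto simp: nn_integral_bump)
  also have "\<dots> \<le> (ennreal bump_mass + ennreal a) / ennreal D2"
    by (intro divide_right_mono_ennreal add_left_mono Sa)
  also have "\<dots> = ennreal ((bump_mass + a) / D2)" using bump_mass_nonneg \<open>0 \<le> a\<close> D2 by (simp add: divide_ennreal flip: ennreal_plus)
  also have "\<dots> \<le> 1" using D2 by (simp add: D2_def divide_le_eq ennreal_le_1)
  finally show ?thesis .
qed

section \<open>Modular and Luxemburg norm\<close>

lemma modular_eq: "modular lebesgue q (\<lambda>x. v x /\<^sub>R l) = (\<integral>\<^sup>+x. omega (q x) (norm (v x) / \<bar>l\<bar>) \<partial>lborel)"
  by (simp add: modular_def nn_integral_completion divide_inverse mult.commute)

lemma modular_mono:
  assumes "0 < l" "l \<le> l'"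
  shows "(\<integral>\<^sup>+x. omega (q x) (norm (v x) / l') \<partial>lborel) \<le> (\<integral>\<^sup>+x. omega (q x) (norm (v x) / l) \<partial>lborel)"
  using assms by (intro nn_integral_mono omega_mono divide_left_mono) auto

text \<open>As exponents are at least one, dividing the function by D \<ge> 1 divides the modular at
  least by D, and one plus the modular is a sufficient D. Thus the infimum in the norm runs over a
  nonempty set.\<close>

lemma Lvar_modular_le_1:
  assumes v: "v \<in> Lvar lebesgue q"
  shows "\<exists>l>0. (\<integral>\<^sup>+x. omega (q x) (norm (v x) / l) \<partial>lborel) \<le> 1"
proof -
  obtain k where k: "0 < k" "modular lebesgue q (\<lambda>x. k *\<^sub>R v x) < \<infinity>"
    and [measurable]: "v \<in> borel_measurable lebesgue" using v by (auto simp: Lvar_def)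
  let ?I = "\<integral>\<^sup>+x. omega (q x) (norm (v x) * k) \<partial>lebesgue"
  have fin: "?I < \<infinity>" using k by (simp add: modular_def mult.commute)
  define D where "D = 1 + enn2real ?I"
  have D: "1 \<le> D" by (simp add: D_def)
  have "(\<integral>\<^sup>+x. omega (q x) (norm (v x) / (D / k)) \<partial>lborel) \<le> (\<integral>\<^sup>+x. ennreal (1 / D) * omega (q x) (norm (v x) * k) \<partial>lborel)"
    using omega_scale[of "norm (v _) * k" D] D k by (intro nn_integral_mono) simp
  also have "\<dots> = (\<integral>\<^sup>+x. ennreal (1 / D) * omega (q x) (norm (v x) * k) \<partial>lebesgue)" by (simp add: nn_integral_completion)
  also have "\<dots> = ennreal (1 / D) * ?I"
  proof (rule nn_integral_cmult)
    have [measurable]: "(\<lambda>x. x) \<in> lebesgue \<rightarrow>\<^sub>M (borel :: (real^3) measure)" by (rule measurable_completion) simp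
    show "(\<lambda>x. omega (q x) (norm (v x) * k)) \<in> borel_measurable lebesgue" by measurable
  qed
  also have "?I = ennreal (D - 1)" using fin by (simp add: D_def)
  also have "ennreal (1 / D) * ennreal (D - 1) \<le> 1"
    using D by (simp add: divide_le_eq flip: ennreal_mult)
  finally show ?thesis using D k by (intro exI[of _ "D / k"]) auto
qed

text \<open>The strict inequality avoids the question whether the infimum is attained.\<close>

lemma Lvar_norm_lessD:
  assumes v: "v \<in> Lvar lebesgue q" and l: "Lvar_norm lebesgue q v < l"
  shows "(\<integral>\<^sup>+x. omega (q x) (norm (v x) / l) \<partial>lborel) \<le> 1"
proof -
  have "{l. 0 < l \<and> modular lebesgue q (\<lambda>x. v x /\<^sub>R l) \<le> 1} \<noteq> {}"
    using Lvar_modular_le_1[OF v] by (auto simp: modular_eq)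
  then obtain l0 where l0: "0 < l0" "modular lebesgue q (\<lambda>x. v x /\<^sub>R l0) \<le> 1" "l0 < l"
    using cInf_lessD[of "{l. 0 < l \<and> modular lebesgue q (\<lambda>x. v x /\<^sub>R l) \<le> 1}" l] l by (auto simp: Lvar_norm_def)
  then show ?thesis using modular_mono[where l = l0 and l' = l and v = v] by (simp add: modular_eq)
qed

lemma Lvar_norm_le:
  assumes "0 < l" "(\<integral>\<^sup>+x. omega (q x) (norm (v x) / l) \<partial>lborel) \<le> 1"
  shows "Lvar_norm lebesgue q v \<le> l"
  unfolding Lvar_norm_def by (rule cInf_lower) (use assms in \<open>auto simp: modular_eq intro!: bdd_belowI[of _ 0]\<close>)

lemma Lvar_norm_nonneg: "v \<in> Lvar lebesgue q \<Longrightarrow> 0 \<le> Lvar_norm lebesgue q v"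
  unfolding Lvar_norm_def
  by (rule cInf_greatest) (use Lvar_modular_le_1[of v] in \<open>auto simp: modular_eq\<close>)

lemma LvarI:
  assumes "0 < l" "(\<integral>\<^sup>+x. omega (q x) (norm (v x) / l) \<partial>lborel) \<le> 1" "v \<in> borel_measurable lebesgue"
  shows "v \<in> Lvar lebesgue q"
proof -
  have "modular lebesgue q (\<lambda>x. inverse l *\<^sub>R v x) \<le> 1" using assms(1,2) modular_eq[where v = v and l = l] by simp
  then show ?thesis using assms(1,3) unfolding Lvar_def
    by (auto intro!: exI[of _ "inverse l"] simp: less_top intro: order_le_less_trans)
qed

text \<open>Since the modular decreases in the scale, the infimum can be tested on rational
  scales.\<close>

lemma borel_measurable_Lvar_norm:
  fixes u :: "real \<Rightarrow> real^3 \<Rightarrow> real^3"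
  assumes [measurable]: "(\<lambda>(t, x). u t x) \<in> borel_measurable (borel \<Otimes>\<^sub>M borel)"
  shows "(\<lambda>t. Lvar_norm lebesgue q (u t)) \<in> borel_measurable borel"
proof (rule borel_measurableI_less)
  fix a :: real
  define I where "I t l = (\<integral>\<^sup>+x. omega (q x) (norm (u t x) / l) \<partial>lborel)" for t l
  have [measurable]: "(\<lambda>t. I t l) \<in> borel_measurable borel" for l
    unfolding I_def by measurable
  have mono: "I t l' \<le> I t l" if "0 < l" "l \<le> l'" for t l l' unfolding I_def by (rule modular_mono[OF that])
  have Seq: "{l. 0 < l \<and> modular lebesgue q (\<lambda>x. u t x /\<^sub>R l) \<le> 1} = {l. 0 < l \<and> I t l \<le> 1}" for t
    by (auto simp: modular_eq I_def)
  \<comment> \<open>The second alternative covers slices without any admissible scale, where the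
    norm is the fixed number \<open>Inf {}\<close>.\<close>
  have iff: "Lvar_norm lebesgue q (u t) < a \<longleftrightarrow>
     (\<exists>l\<in>\<rat>. 0 < l \<and> l < a \<and> I t l \<le> 1) \<or> (Inf {} < a \<and> (\<forall>l\<in>\<rat>. 0 < l \<longrightarrow> \<not> I t l \<le> 1))" for t
  proof (cases "\<exists>l>0. I t l \<le> 1")
    case True
    then obtain l1 where l1: "0 < l1" "I t l1 \<le> 1" by blast
    obtain l2 where l2: "l2 \<in> \<rat>" "l1 < l2" using Rats_dense_in_real[of l1 "l1 + 1"] by auto
    have "I t l2 \<le> 1" using mono[of l1 l2 t] l1 l2 by (auto intro: order_trans)
    then have no: "\<not> (\<forall>l\<in>\<rat>. 0 < l \<longrightarrow> \<not> I t l \<le> 1)" using l1 l2 by (auto intro!: bexI[of _ l2])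
    have "Inf {l. 0 < l \<and> I t l \<le> 1} < a \<longleftrightarrow> (\<exists>l. 0 < l \<and> I t l \<le> 1 \<and> l < a)"
      using l1 by (subst cInf_less_iff) (auto intro!: bdd_belowI[of _ 0])
    also have "\<dots> \<longleftrightarrow> (\<exists>l\<in>\<rat>. 0 < l \<and> l < a \<and> I t l \<le> 1)"
    proof safe
      fix l assume l: "0 < l" "I t l \<le> 1" "l < a"
      obtain l' where "l' \<in> \<rat>" "l < l'" "l' < a" using Rats_dense_in_real[OF l(3)] by auto
      then show "\<exists>l\<in>\<rat>. 0 < l \<and> l < a \<and> I t l \<le> 1" using l mono[of l l' t] by (auto intro!: bexI[of _ l'] intro: order_trans)
    qed auto
    finally show ?thesis using no unfolding Lvar_norm_def Seq by blast
  next
    case False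
    then have "{l. 0 < l \<and> I t l \<le> 1} = {}" by auto
    then show ?thesis using False unfolding Lvar_norm_def Seq by (simp only:) auto
  qed
  have "Measurable.pred borel (\<lambda>t. (\<exists>k::rat. 0 < k \<and> of_rat k < a \<and> I t (of_rat k) \<le> 1) \<or>
      (Inf {} < a \<and> (\<forall>k::rat. 0 < k \<longrightarrow> \<not> I t (of_rat k) \<le> 1)))"
    by measurable
  then show "{t \<in> space borel. Lvar_norm lebesgue q (u t) < a} \<in> sets borel"
    unfolding iff pred_def Rats_def by simp
qed

end

section \<open>Estimates at a fixed time\<close>

lemma borel_measurable_Re_kernel_of_symbol:
  fixes m :: "real \<Rightarrow> real^3 \<Rightarrow> complex"
  assumes "(\<lambda>(t, \<xi>). m t \<xi>) \<in> borel_measurable (borel \<Otimes>\<^sub>M borel)"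
    and [measurable]: "t \<in> borel_measurable M" "x \<in> borel_measurable M"
  shows "(\<lambda>w. Re (kernel_of_symbol (m (t w)) (x w))) \<in> borel_measurable M"
proof -
  note [measurable] = borel_measurable_kernel_of_symbol[OF assms(1)]
  have "(\<lambda>w. (\<lambda>(t, x). kernel_of_symbol (m t) x) (t w, x w)) \<in> borel_measurable M" by measurable
  then show ?thesis by simp
qed

lemma borel_measurable_heat_kernel [measurable (raw)]:
  assumes "t \<in> borel_measurable M" "x \<in> borel_measurable M"
  shows "(\<lambda>w. heat_kernel \<alpha> (t w) (x w)) \<in> borel_measurable M"
  unfolding heat_kernel_def by (rule borel_measurable_Re_kernel_of_symbol[OF _ assms]) measurable

lemma borel_measurable_oseen_kernel [measurable (raw)]:
  assumes "t \<in> borel_measurable M" "x \<in> borel_measurable M"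
  shows "(\<lambda>w. oseen_kernel \<alpha> (t w) j h k (x w)) \<in> borel_measurable M"
  unfolding oseen_kernel_def by (rule borel_measurable_Re_kernel_of_symbol[OF _ assms]) measurable

lemma borel_measurable_vecI:
  fixes f :: "'a \<Rightarrow> real^'n"
  assumes "\<And>j. (\<lambda>x. f x $ j) \<in> borel_measurable M"
  shows "f \<in> borel_measurable M"
  using assms by (subst borel_measurable_euclidean_space) (auto simp: Basis_vec_def inner_axis)

lemma conv_exists_lborel:
  assumes [measurable]: "v \<in> borel_measurable borel" "K \<in> borel_measurable borel"
  shows "conv_exists K v x \<longleftrightarrow> integrable lborel (\<lambda>y. K (x - y) *\<^sub>R v y)"
  unfolding conv_exists_def by (rule integrable_completion) measurable

lemma conv_lborel:
  assumes [measurable]: "v \<in> borel_measurable borel" "K \<in> borel_measurable borel"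
  shows "conv K v x = (LINT y|lborel. K (x - y) *\<^sub>R v y)"
  unfolding conv_def by (rule integral_completion) measurable

lemma conv_bound:
  fixes v :: "real^3 \<Rightarrow> 'b::{banach, second_countable_topology}"
  assumes [measurable]: "v \<in> borel_measurable borel" "K \<in> borel_measurable borel"
    and le: "(\<integral>\<^sup>+y. ennreal (norm (K (x - y)) * norm (v y)) \<partial>lborel) \<le> ennreal b" and b: "0 \<le> b"
  shows "conv_exists K v x" "norm (conv K v x) \<le> b"
proof -
  have int: "integrable lborel (\<lambda>y. K (x - y) *\<^sub>R v y)"
    using le by (intro integrableI_bounded) (auto simp: le_less_trans less_top)
  then show "conv_exists K v x" by (subst conv_exists_lborel) auto
  have "ennreal (norm (conv K v x)) \<le> (\<integral>\<^sup>+y. ennreal (norm (K (x - y) *\<^sub>R v y)) \<partial>lborel)"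
    unfolding conv_lborel[OF assms(1,2)] by (rule integral_norm_bound_ennreal[OF int])
  also have "\<dots> \<le> ennreal b" using le by simp
  finally show "norm (conv K v x) \<le> b" using b by simp
qed

lemma borel_measurable_tensor_square:
  assumes [measurable]: "v \<in> borel_measurable borel"
  shows "(\<lambda>y. tensor_square v y $ h $ k) \<in> borel_measurable borel"
  unfolding tensor_square_def by simp

lemma borel_measurable_oseen_conv [measurable (raw)]:
  fixes u :: "real \<Rightarrow> real^3 \<Rightarrow> real^3"
  assumes u: "(\<lambda>(t, x). u t x) \<in> borel_measurable (borel \<Otimes>\<^sub>M borel)"
    and [measurable]: "t \<in> borel_measurable M" "s \<in> borel_measurable M" "x \<in> borel_measurable M"
  shows "(\<lambda>w. oseen_conv \<alpha> (t w) (tensor_square (u (s w))) (x w)) \<in> borel_measurable M"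
proof -
  have [measurable]: "(\<lambda>w. u (a w) (b w)) \<in> borel_measurable N" if [measurable]: "a \<in> borel_measurable N" "b \<in> borel_measurable N" for a b N
    using measurable_compose[OF measurable_Pair[OF that] u] by simp
  have us[measurable]: "u s \<in> borel_measurable borel" for s
    using measurable_compose[OF measurable_Pair1' u, of s] by simp
  have "(\<lambda>w. \<chi> j. \<Sum>h\<in>UNIV. \<Sum>k\<in>UNIV. LINT y|lborel. oseen_kernel \<alpha> (t w) j h k (x w - y) *\<^sub>R (u (s w) y $ h * u (s w) y $ k)) \<in> borel_measurable M"
    by (rule borel_measurable_vecI, unfold vec_lambda_beta) measurable
  then show ?thesis
    unfolding oseen_conv_def
    by (subst conv_lborel) (auto simp: tensor_square_def)
qed

lemma borel_measurable_heat_conv [measurable (raw)]: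
  fixes u :: "real \<Rightarrow> real^3 \<Rightarrow> real^3"
  assumes u: "(\<lambda>(t, x). u t x) \<in> borel_measurable (borel \<Otimes>\<^sub>M borel)"
    and [measurable]: "t \<in> borel_measurable M" "s \<in> borel_measurable M" "x \<in> borel_measurable M"
  shows "(\<lambda>w. conv (heat_kernel \<alpha> (t w)) (u (s w)) (x w)) \<in> borel_measurable M"
proof -
  have [measurable]: "(\<lambda>w. u (a w) (b w)) \<in> borel_measurable N" if [measurable]: "a \<in> borel_measurable N" "b \<in> borel_measurable N" for a b N
    using measurable_compose[OF measurable_Pair[OF that] u] by simp
  have us[measurable]: "u s \<in> borel_measurable borel" for s
    using measurable_compose[OF measurable_Pair1' u, of s] by simp
  have "(\<lambda>w. LINT y|lborel. heat_kernel \<alpha> (t w) (x w - y) *\<^sub>R u (s w) y) \<in> borel_measurable M"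
    by measurable
  then show ?thesis by (subst conv_lborel) auto
qed

lemma nn_integral_powr_singular:
  assumes "a < 1" "t0 \<le> t"
  shows "(\<integral>\<^sup>+s. ennreal ((t - s) powr - a) * indicator {t0<..<t} s \<partial>lborel) \<le> ennreal ((t - t0) powr (1 - a) / (1 - a))"
proof -
  have "(\<integral>\<^sup>+s. ennreal ((t - s) powr - a) * indicator {t0<..<t} s \<partial>lborel) =
     (\<integral>\<^sup>+s. ennreal (s powr - a) * indicator {t0<..<t} (t - s) \<partial>lborel)"
    using nn_integral_real_affine[of "\<lambda>s. ennreal ((t - s) powr - a) * indicator {t0<..<t} s" "-1" t] by simp
  also have "\<dots> \<le> (\<integral>\<^sup>+s. ennreal (s powr - a) * indicator {0..t - t0} s \<partial>lborel)"
    by (intro nn_integral_mono) (auto simp: indicator_def)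
  also have "\<dots> = ennreal ((t - t0) powr (- a + 1) / (- a + 1))"
    using assms by (intro nn_integral_has_integral_lebesgue' has_integral_powr_from_0) auto
  finally show ?thesis by (simp add: add.commute)
qed

section \<open>Kernel estimates in terms of modulars\<close>

locale ns = log_exp q c r for q c r +
  fixes \<alpha> \<rho> :: real
  assumes \<alpha>: "1 / 2 < \<alpha>" "\<alpha> \<le> 1" and \<rho>: "2 < \<rho>" and gap: "2 * \<alpha> / \<rho> + 3 / r < \<alpha> - 1 / 2"
begin

text \<open>At the length scale \<open>t powr (1 / (2 * \<alpha>))\<close>, squares in L^q cost the
  power -6/r and the derivative in the Oseen kernel the power -1; \<beta> is the exponent without
  the derivative.\<close>

definition \<gamma> :: real where "\<gamma> = (1 + 6 / r) / (2 * \<alpha>)"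
definition \<beta> :: real where "\<beta> = (6 / r) / (2 * \<alpha>)"

text \<open>Doubling \<open>gap\<close>, rearranging and dividing by \<open>2 * \<alpha>\<close>
  gives the form needed for Young's inequality in time.\<close>

lemma \<gamma>_less: "\<gamma> < 1 - 2 / \<rho>"
proof -
  have "(1 - 2 / \<rho>) * (2 * \<alpha>) = 2 * \<alpha> - 2 * (2 * \<alpha> / \<rho>)" by (simp add: algebra_simps)
  moreover have "6 / r = 2 * (3 / r)" by simp
  ultimately have "1 + 6 / r < (1 - 2 / \<rho>) * (2 * \<alpha>)" using gap by linarith
  then show ?thesis using \<alpha> unfolding \<gamma>_def by (subst pos_divide_less_eq) auto
qed

lemma \<gamma>_pos: "0 < \<gamma>" using \<alpha> r_ge_2 unfolding \<gamma>_def by (intro divide_pos_pos add_pos_nonneg) auto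
lemma \<gamma>_less_1: "\<gamma> < 1" using \<gamma>_less \<rho> by (smt (verit) divide_pos_pos)
lemma \<beta>_le: "\<beta> \<le> \<gamma>" using \<alpha> unfolding \<beta>_def \<gamma>_def by (intro divide_right_mono) auto
lemma \<beta>_less_1: "\<beta> < 1" using \<beta>_le \<gamma>_less_1 by simp

definition heat_const where "heat_const = (SOME B. 0 \<le> B \<and> (\<forall>t x. 0 < t \<longrightarrow> \<bar>heat_kernel \<alpha> t x\<bar> \<le> B * majorant (t powr (1 / (2 * \<alpha>))) x))"
definition oseen_const where "oseen_const = (SOME B. 0 \<le> B \<and> (\<forall>t j h k x. 0 < t \<longrightarrow>
     \<bar>oseen_kernel \<alpha> t j h k x\<bar> \<le> B / t powr (1 / (2 * \<alpha>)) * majorant (t powr (1 / (2 * \<alpha>))) x))"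

lemma heat_const: "0 \<le> heat_const" "0 < t \<Longrightarrow> \<bar>heat_kernel \<alpha> t x\<bar> \<le> heat_const * majorant (t powr (1 / (2 * \<alpha>))) x"
  using someI_ex[OF heat_kernel_bound[OF \<alpha>, unfolded Bex_def[symmetric]]] heat_kernel_bound[OF \<alpha>] unfolding heat_const_def
  by (metis (mono_tags, lifting) someI_ex)+

lemma oseen_const: "0 \<le> oseen_const" "0 < t \<Longrightarrow> \<bar>oseen_kernel \<alpha> t j h k x\<bar> \<le> oseen_const / t powr (1 / (2 * \<alpha>)) * majorant (t powr (1 / (2 * \<alpha>))) x"
proof -
  have "0 \<le> oseen_const \<and> (\<forall>t j h k x. 0 < t \<longrightarrow>
     \<bar>oseen_kernel \<alpha> t j h k x\<bar> \<le> oseen_const / t powr (1 / (2 * \<alpha>)) * majorant (t powr (1 / (2 * \<alpha>))) x)"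
    unfolding oseen_const_def by (rule someI_ex) (use oseen_kernel_bound[OF \<alpha>] in blast)
  then show "0 \<le> oseen_const" "0 < t \<Longrightarrow> \<bar>oseen_kernel \<alpha> t j h k x\<bar> \<le> oseen_const / t powr (1 / (2 * \<alpha>)) * majorant (t powr (1 / (2 * \<alpha>))) x"
    by blast+
qed

lemma scale_le_1: "0 < t \<Longrightarrow> t \<le> 1 \<Longrightarrow> t powr (1 / (2 * \<alpha>)) \<le> 1"
  using \<alpha> powr_mono'[of 0 "1 / (2 * \<alpha>)" t] by simp

text \<open>The weight (1 + z)^2 covers a single field as well as a product of two, so one estimate
  serves both kernels.\<close>

lemma nn_integral_kernel_square:
  assumes [measurable]: "z \<in> borel_measurable borel" and z: "\<And>y. 0 \<le> z y"
    and le: "(\<integral>\<^sup>+y. omega (q y) (z y) \<partial>lborel) \<le> 2" and t: "0 < t" "t \<le> 1"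
    and K: "\<And>y. \<bar>K y\<bar> \<le> B * majorant (t powr (1 / (2 * \<alpha>))) y" and B: "0 \<le> B"
    and F: "AE y in lborel. norm (F y) \<le> N * (1 + z y)\<^sup>2" and N: "0 \<le> N"
  shows "(\<integral>\<^sup>+y. ennreal (norm (K (x - y)) * norm (F y)) \<partial>lborel) \<le> ennreal (N * (B * ((4 * bump_mass + 4) * t powr - \<beta>)))"
proof -
  let ?\<tau> = "t powr (1 / (2 * \<alpha>))"
  have \<tau>: "0 < ?\<tau>" "?\<tau> \<le> 1" using t scale_le_1 by auto
  have "(\<integral>\<^sup>+y. ennreal (norm (K (x - y)) * norm (F y)) \<partial>lborel)
      \<le> (\<integral>\<^sup>+y. ennreal (N * B) * (ennreal (majorant ?\<tau> (x - y)) * ennreal ((1 + z y)\<^sup>2)) \<partial>lborel)"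
    using F
  proof (intro nn_integral_mono_AE, eventually_elim)
    case (elim y)
    have "norm (K (x - y)) * norm (F y) \<le> (B * majorant ?\<tau> (x - y)) * (N * (1 + z y)\<^sup>2)"
      using K[of "x - y"] elim B majorant_nonneg[OF \<tau>(1)] by (intro mult_mono) auto
    also have "\<dots> = (N * B) * (majorant ?\<tau> (x - y) * (1 + z y)\<^sup>2)" by simp
    finally have "norm (K (x - y)) * norm (F y) \<le> (N * B) * (majorant ?\<tau> (x - y) * (1 + z y)\<^sup>2)" .
    then show ?case using N B majorant_nonneg[OF \<tau>(1)] by (simp add: ennreal_leI flip: ennreal_mult)
  qed
  also have "\<dots> = ennreal (N * B) * (\<integral>\<^sup>+y. (ennreal (majorant ?\<tau> (x - y)) * ennreal ((1 + z y)\<^sup>2)) \<partial>lborel)"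
    by (rule nn_integral_cmult) measurable
  also have "\<dots> \<le> ennreal (N * B) * ennreal ((4 * bump_mass + 4) * ?\<tau> powr (-6 / r))"
    by (intro mult_left_mono majorant_square_estimate z le \<tau>) auto
  also have "?\<tau> powr (-6 / r) = t powr - \<beta>" by (simp add: powr_powr \<beta>_def mult.commute)
  finally show ?thesis using N B bump_mass_nonneg by (simp add: mult.assoc flip: ennreal_mult)
qed

text \<open>The 27 counts index triples: the norm is bounded by the sum of three coordinates, each a
  sum of nine convolutions.\<close>

definition duhamel_const where "duhamel_const = 27 * (oseen_const * (4 * bump_mass + 4))"

lemma duhamel_const_nonneg: "0 \<le> duhamel_const" using oseen_const(1) bump_mass_nonneg by (simp add: duhamel_const_def)

lemma oseen_conv_bound:
  fixes F :: "real^3 \<Rightarrow> real^3^3"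
  assumes [measurable]: "z \<in> borel_measurable borel" and z: "\<And>y. 0 \<le> z y"
    and le: "(\<integral>\<^sup>+y. omega (q y) (z y) \<partial>lborel) \<le> 2" and t: "0 < t" "t \<le> 1"
    and F[measurable]: "\<And>h k. (\<lambda>y. F y $ h $ k) \<in> borel_measurable borel"
    and FN: "\<And>h k. AE y in lborel. norm (F y $ h $ k) \<le> N * (1 + z y)\<^sup>2" and N: "0 \<le> N"
  shows "oseen_conv_exists \<alpha> t F x" "norm (oseen_conv \<alpha> t F x) \<le> N * duhamel_const * t powr - \<gamma>"
proof -
  let ?\<tau> = "t powr (1 / (2 * \<alpha>))"
  define b where "b = N * (oseen_const / ?\<tau> * ((4 * bump_mass + 4) * t powr - \<beta>))"
  have b: "0 \<le> b" using N oseen_const(1) bump_mass_nonneg by (simp add: b_def)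
  have le: "(\<integral>\<^sup>+y. ennreal (norm (oseen_kernel \<alpha> t j h k (x - y)) * norm (F y $ h $ k)) \<partial>lborel) \<le> ennreal b" for j h k
    unfolding b_def using oseen_const t
    by (intro nn_integral_kernel_square[of z] assms) auto
  note cb = conv_bound[OF F _ le b]
  show "oseen_conv_exists \<alpha> t F x"
    unfolding oseen_conv_exists_def by (intro allI cb(1)) measurable
  have c: "norm (conv (oseen_kernel \<alpha> t j h k) (\<lambda>y. F y $ h $ k) x) \<le> b" for j h k
    by (intro cb(2)) measurable
  have "norm (oseen_conv \<alpha> t F x) \<le> (\<Sum>j\<in>UNIV. \<bar>oseen_conv \<alpha> t F x $ j\<bar>)" by (rule norm_le_l1_cart)
  also have "\<dots> \<le> (\<Sum>j\<in>(UNIV::3 set). \<Sum>h\<in>(UNIV::3 set). \<Sum>k\<in>(UNIV::3 set). b)"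
  proof (rule sum_mono)
    fix j :: 3
    have "\<bar>oseen_conv \<alpha> t F x $ j\<bar> \<le> (\<Sum>h\<in>UNIV. \<bar>\<Sum>k\<in>UNIV. conv (oseen_kernel \<alpha> t j h k) (\<lambda>y. F y $ h $ k) x\<bar>)"
      unfolding oseen_conv_def by (simp add: sum_abs)
    also have "\<dots> \<le> (\<Sum>h\<in>(UNIV::3 set). \<Sum>k\<in>(UNIV::3 set). b)"
      using c by (intro sum_mono order_trans[OF sum_abs]) auto
    finally show "\<bar>oseen_conv \<alpha> t F x $ j\<bar> \<le> (\<Sum>h\<in>(UNIV::3 set). \<Sum>k\<in>(UNIV::3 set). b)" .
  qed
  also have "\<dots> = N * duhamel_const * (t powr - \<beta> / ?\<tau>)" by (simp add: b_def duhamel_const_def)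
  also have "t powr - \<beta> / ?\<tau> = t powr - \<gamma>"
  proof -
    have "- \<beta> - 1 / (2 * \<alpha>) = - \<gamma>" by (simp add: \<beta>_def \<gamma>_def add_divide_distrib)
    then show ?thesis by (metis powr_diff)
  qed
  finally show "norm (oseen_conv \<alpha> t F x) \<le> N * duhamel_const * t powr - \<gamma>" .
qed

lemma oseen_conv_diff:
  assumes "oseen_conv_exists \<alpha> t F x" "oseen_conv_exists \<alpha> t G x"
  shows "oseen_conv \<alpha> t F x - oseen_conv \<alpha> t G x = oseen_conv \<alpha> t (\<lambda>y. F y - G y) x"
proof -
  have "conv (oseen_kernel \<alpha> t j h k) (\<lambda>y. F y $ h $ k) x - conv (oseen_kernel \<alpha> t j h k) (\<lambda>y. G y $ h $ k) x
      = conv (oseen_kernel \<alpha> t j h k) (\<lambda>y. (F y - G y) $ h $ k) x" for j h k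
    using assms unfolding oseen_conv_exists_def conv_exists_def conv_def
    by (subst Bochner_Integration.integral_diff[symmetric]) (auto simp: algebra_simps)
  then show ?thesis by (simp add: oseen_conv_def vec_eq_iff flip: sum_subtractf)
qed

lemma oseen_tensor_bound:
  assumes [measurable]: "v \<in> borel_measurable borel"
    and le: "(\<integral>\<^sup>+y. omega (q y) (norm (v y) / l) \<partial>lborel) \<le> 1" and l: "0 < l" and t: "0 < t" "t \<le> 1"
  shows "oseen_conv_exists \<alpha> t (tensor_square v) x" "norm (oseen_conv \<alpha> t (tensor_square v) x) \<le> l\<^sup>2 * duhamel_const * t powr - \<gamma>"
proof -
  have le2: "(\<integral>\<^sup>+y. omega (q y) (norm (v y) / l) \<partial>lborel) \<le> 2" using le by (rule order_trans) simp
  have F: "norm (tensor_square v y $ h $ k) \<le> l\<^sup>2 * (1 + norm (v y) / l)\<^sup>2" for y h k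
  proof -
    have "norm (tensor_square v y $ h $ k) \<le> norm (v y) * norm (v y)"
      unfolding tensor_square_def by (simp add: abs_mult mult_mono component_le_norm_cart)
    also have "\<dots> = l\<^sup>2 * (norm (v y) / l)\<^sup>2" using l by (simp add: power2_eq_square)
    also have "\<dots> \<le> l\<^sup>2 * (1 + norm (v y) / l)\<^sup>2" using l by (intro mult_left_mono power_mono) auto
    finally show ?thesis .
  qed
  have l0: "0 \<le> norm (v y) / l" for y using l by simp
  have l2: "0 \<le> l\<^sup>2" by simp
  have [measurable]: "(\<lambda>y. norm (v y) / l) \<in> borel_measurable borel" by measurable
  note b = oseen_conv_bound[OF _ l0 le2 t borel_measurable_tensor_square[OF assms(1)] AE_I2[OF F] l2]
  show "oseen_conv_exists \<alpha> t (tensor_square v) x" by (rule b(1)) measurable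
  show "norm (oseen_conv \<alpha> t (tensor_square v) x) \<le> l\<^sup>2 * duhamel_const * t powr - \<gamma>" by (rule b(2)) measurable
qed

text \<open>In the splitting u (u - v) + (u - v) v the difference enters through its bound N, the
  other factor is at most l z, with z the maximum of both scaled norms. The linear quantity 2 z is
  below (1 + z)^2, so the quadratic estimate applies; the modular of z is at most 2.\<close>

lemma oseen_tensor_diff_bound:
  assumes [measurable]: "u \<in> borel_measurable borel" "v \<in> borel_measurable borel"
    and le: "(\<integral>\<^sup>+y. omega (q y) (norm (u y) / l) \<partial>lborel) \<le> 1" "(\<integral>\<^sup>+y. omega (q y) (norm (v y) / l) \<partial>lborel) \<le> 1"
    and l: "0 < l" and t: "0 < t" "t \<le> 1" and N: "AE y in lborel. norm (u y - v y) \<le> N" "0 \<le> N"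
  shows "norm (oseen_conv \<alpha> t (tensor_square u) x - oseen_conv \<alpha> t (tensor_square v) x) \<le> N * l * duhamel_const * t powr - \<gamma>"
proof -
  define z where "z y = max (norm (u y) / l) (norm (v y) / l)" for y
  have [measurable]: "z \<in> borel_measurable borel" unfolding z_def[abs_def] by measurable
  have z0: "0 \<le> z y" for y using l by (simp add: z_def le_max_iff_disj)
  have "(\<integral>\<^sup>+y. omega (q y) (z y) \<partial>lborel) \<le> (\<integral>\<^sup>+y. omega (q y) (norm (u y) / l) + omega (q y) (norm (v y) / l) \<partial>lborel)"
    unfolding z_def by (intro nn_integral_mono omega_max)
  also have "\<dots> = (\<integral>\<^sup>+y. omega (q y) (norm (u y) / l) \<partial>lborel) + (\<integral>\<^sup>+y. omega (q y) (norm (v y) / l) \<partial>lborel)"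
    by (rule nn_integral_add) measurable
  also have "\<dots> \<le> 1 + 1" by (intro add_mono le)
  finally have le2: "(\<integral>\<^sup>+y. omega (q y) (z y) \<partial>lborel) \<le> 2" by simp
  have F: "AE y in lborel. norm ((tensor_square u y - tensor_square v y) $ h $ k) \<le> N * l * (1 + z y)\<^sup>2" for h k
    using N(1)
  proof eventually_elim
    case (elim y)
    have "(tensor_square u y - tensor_square v y) $ h $ k = u y $ h * (u y - v y) $ k + (u y - v y) $ h * v y $ k"
      by (simp add: tensor_square_def algebra_simps)
    then have "norm ((tensor_square u y - tensor_square v y) $ h $ k) \<le> \<bar>u y $ h\<bar> * \<bar>(u y - v y) $ k\<bar> + \<bar>(u y - v y) $ h\<bar> * \<bar>v y $ k\<bar>"
      by (simp only: real_norm_def) (metis abs_mult abs_triangle_ineq)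
    also have "\<dots> \<le> norm (u y) * N + N * norm (v y)"
      using elim N(2) by (intro add_mono mult_mono component_le_norm_cart order_trans[OF component_le_norm_cart]) auto
    also have "\<dots> \<le> (l * z y) * N + N * (l * z y)"
      using l N(2) by (intro add_mono mult_right_mono mult_left_mono) (auto simp: z_def field_simps max_def)
    also have "\<dots> = N * l * (2 * z y)" by simp
    also have "\<dots> \<le> N * l * (1 + z y)\<^sup>2"
      using l N(2) zero_le_power2[of "z y"] by (intro mult_left_mono) (auto simp: power2_eq_square algebra_simps)
    finally show ?case .
  qed
  have "norm (oseen_conv \<alpha> t (\<lambda>y. tensor_square u y - tensor_square v y) x) \<le> N * l * duhamel_const * t powr - \<gamma>"
    using N(2) l borel_measurable_tensor_square
    by (intro oseen_conv_bound[of z] le2 t F z0) auto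
  then show ?thesis
    using oseen_conv_diff[OF oseen_tensor_bound(1)[OF assms(1) le(1) l t] oseen_tensor_bound(1)[OF assms(2) le(2) l t], of x] by simp
qed

text \<open>The second bound is uniform in x and serves integrability in time; the third keeps the
  exponent g x and serves the return to a modular.\<close>

lemma heat_conv_estimates:
  fixes v :: "real^3 \<Rightarrow> real^3"
  assumes [measurable]: "v \<in> borel_measurable borel"
    and le: "(\<integral>\<^sup>+y. omega (q y) (norm (v y) / l) \<partial>lborel) \<le> 1" and l: "0 < l" and t: "0 < t" "t \<le> 1"
  defines "S \<equiv> \<lambda>x. \<integral>\<^sup>+y. ennreal (majorant (t powr (1 / (2 * \<alpha>))) (x - y)) * omega (q y) (norm (v y) / l) \<partial>lborel"
  shows "conv_exists (heat_kernel \<alpha> t) v x"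
    and "norm (conv (heat_kernel \<alpha> t) v x) \<le> l * (heat_const * (4 * bump_mass + 4)) * t powr - \<beta>"
    and "norm (conv (heat_kernel \<alpha> t) v x) \<le> l * (heat_const * smear_const) * max 1 (enn2real (S x)) powr g x"
proof -
  let ?\<tau> = "t powr (1 / (2 * \<alpha>))"
  have \<tau>: "0 < ?\<tau>" "?\<tau> \<le> 1" using t scale_le_1 by auto
  have le2: "(\<integral>\<^sup>+y. omega (q y) (norm (v y) / l) \<partial>lborel) \<le> 2" using le by (rule order_trans) simp
  have F: "norm (v y) \<le> l * (1 + norm (v y) / l)\<^sup>2" for y
  proof -
    have "norm (v y) = l * (norm (v y) / l)" using l by simp
    also have "\<dots> \<le> l * (1 + norm (v y) / l)\<^sup>2"
    proof (rule mult_left_mono)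
      show "norm (v y) / l \<le> (1 + norm (v y) / l)\<^sup>2"
      proof -
        have "x \<le> (1 + x)\<^sup>2" if "0 \<le> x" for x :: real
          using that zero_le_power2[of x] by (simp add: power2_eq_square algebra_simps)
        then show ?thesis using l by simp
      qed
    qed (use l in simp)
    finally show ?thesis .
  qed
  have "(\<integral>\<^sup>+y. ennreal (norm (heat_kernel \<alpha> t (x - y)) * norm (v y)) \<partial>lborel) \<le> ennreal (l * (heat_const * ((4 * bump_mass + 4) * t powr - \<beta>)))"
    using l by (intro nn_integral_kernel_square[of "\<lambda>y. norm (v y) / l"] le2 t AE_I2 F heat_const) auto
  note cb = conv_bound[OF assms(1) _ this]
  show "conv_exists (heat_kernel \<alpha> t) v x" using l heat_const(1) bump_mass_nonneg by (intro cb) auto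
  show "norm (conv (heat_kernel \<alpha> t) v x) \<le> l * (heat_const * (4 * bump_mass + 4)) * t powr - \<beta>"
    using cb(2) l heat_const(1) bump_mass_nonneg by (auto simp: mult.assoc)
  note me = majorant_estimate[of "\<lambda>y. norm (v y) / l", OF _ _ le \<tau>, of x]
  have "(\<integral>\<^sup>+y. ennreal (norm (heat_kernel \<alpha> t (x - y)) * norm (v y)) \<partial>lborel)
     \<le> (\<integral>\<^sup>+y. ennreal (l * heat_const) * (ennreal (majorant ?\<tau> (x - y)) * ennreal (norm (v y) / l)) \<partial>lborel)"
  proof (rule nn_integral_mono)
    fix y
    have "norm (heat_kernel \<alpha> t (x - y)) * norm (v y) \<le> (heat_const * majorant ?\<tau> (x - y)) * norm (v y)"
      using heat_const(2)[OF t(1)] by (intro mult_right_mono) auto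
    also have "\<dots> = (l * heat_const) * (majorant ?\<tau> (x - y) * (norm (v y) / l))" using l by simp
    finally have "ennreal (norm (heat_kernel \<alpha> t (x - y)) * norm (v y)) \<le> ennreal ((l * heat_const) * (majorant ?\<tau> (x - y) * (norm (v y) / l)))"
      by (rule ennreal_leI)
    also have "\<dots> = ennreal (l * heat_const) * (ennreal (majorant ?\<tau> (x - y)) * ennreal (norm (v y) / l))"
    proof -
      have m: "0 \<le> majorant ?\<tau> (x - y)" and w: "0 \<le> norm (v y) / l" and lB: "0 \<le> l * heat_const"
        using l heat_const(1) majorant_nonneg[OF \<tau>(1)] by auto
      show ?thesis by (simp only: ennreal_mult[OF lB mult_nonneg_nonneg[OF m w]] ennreal_mult[OF m w])
    qed
    finally show "ennreal (norm (heat_kernel \<alpha> t (x - y)) * norm (v y)) \<le> ennreal (l * heat_const) * (ennreal (majorant ?\<tau> (x - y)) * ennreal (norm (v y) / l))" .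
  qed
  also have "\<dots> = ennreal (l * heat_const) * (\<integral>\<^sup>+y. (ennreal (majorant ?\<tau> (x - y)) * ennreal (norm (v y) / l)) \<partial>lborel)"
    by (rule nn_integral_cmult) measurable
  also have "\<dots> \<le> ennreal (l * heat_const) * ennreal (smear_const * max 1 (enn2real (S x)) powr g x)"
    unfolding S_def using l by (intro mult_left_mono me) auto
  also have "\<dots> = ennreal (l * (heat_const * smear_const) * max 1 (enn2real (S x)) powr g x)"
    using l heat_const(1) bump_mass_nonneg by (subst ennreal_mult[symmetric]) (auto simp: smear_const_def mult.assoc)
  finally show "norm (conv (heat_kernel \<alpha> t) v x) \<le> l * (heat_const * smear_const) * max 1 (enn2real (S x)) powr g x"
    using l heat_const(1) bump_mass_nonneg by (intro conv_bound(2)) (auto simp: smear_const_def)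
qed

end

section \<open>The bilinear Duhamel term\<close>

abbreviation jointly_measurable :: "(real \<Rightarrow> real^3 \<Rightarrow> real^3) \<Rightarrow> bool" where
  "jointly_measurable u \<equiv> (\<lambda>(t, x). u t x) \<in> borel_measurable (borel \<Otimes>\<^sub>M borel)"

lemma jointly_measurable_comp:
  assumes u: "jointly_measurable u" and "a \<in> borel_measurable N" "b \<in> borel_measurable N"
  shows "(\<lambda>w. u (a w) (b w)) \<in> borel_measurable N"
  using measurable_compose[OF measurable_Pair[OF assms(2,3)] u] by simp

lemma jointly_measurable_slice: "jointly_measurable u \<Longrightarrow> u s \<in> borel_measurable borel"
  by (rule jointly_measurable_comp[where a = "\<lambda>_. s" and b = "\<lambda>x. x"]) auto

lemma set_integral_bound:
  fixes f :: "real \<Rightarrow> real^3"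
  assumes [measurable]: "f \<in> borel_measurable borel" and b: "0 \<le> b"
    and fh: "AE s in lborel. s \<in> {0<..<t} \<longrightarrow> norm (f s) \<le> h s"
    and h: "(\<integral>\<^sup>+s. ennreal (h s) * indicator {0<..<t} s \<partial>lborel) \<le> ennreal b"
  shows "set_integrable lebesgue {0<..<t} f" "norm (LINT s:{0<..<t}|lebesgue. f s) \<le> b"
proof -
  have le: "(\<integral>\<^sup>+s. ennreal (norm (indicator {0<..<t} s *\<^sub>R f s)) \<partial>lborel) \<le> ennreal b"
  proof (rule order_trans[OF nn_integral_mono_AE h])
    show "AE s in lborel. ennreal (norm (indicator {0<..<t} s *\<^sub>R f s)) \<le> ennreal (h s) * indicator {0<..<t} s"
      using fh by eventually_elim (auto simp: indicator_def intro!: ennreal_leI)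
  qed
  have int: "integrable lborel (\<lambda>s. indicator {0<..<t} s *\<^sub>R f s)"
    using le by (intro integrableI_bounded) (auto simp: le_less_trans less_top)
  then show "set_integrable lebesgue {0<..<t} f"
    unfolding set_integrable_def by (subst integrable_completion) auto
  have "(LINT s:{0<..<t}|lebesgue. f s) = (LINT s|lborel. indicator {0<..<t} s *\<^sub>R f s)"
    unfolding set_lebesgue_integral_def by (rule integral_completion) measurable
  then have "ennreal (norm (LINT s:{0<..<t}|lebesgue. f s)) \<le> ennreal b"
    using order_trans[OF integral_norm_bound_ennreal[OF int] le] by simp
  then show "norm (LINT s:{0<..<t}|lebesgue. f s) \<le> b" using b by simp
qed

context ns
begin

definition duhamel :: "(real \<Rightarrow> real^3 \<Rightarrow> real^3) \<Rightarrow> real \<Rightarrow> real^3 \<Rightarrow> real^3" where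
  "duhamel u t x = (LINT s:{0<..<t}|lebesgue. oseen_conv \<alpha> (t - s) (tensor_square (u s)) x)"

lemma jointly_measurable_duhamel:
  assumes u: "jointly_measurable u"
  shows "jointly_measurable (duhamel u)"
proof -
  note [measurable] = borel_measurable_oseen_conv[OF u]
  have "duhamel u t x = (LINT s|lborel. (if 0 < s \<and> s < t then oseen_conv \<alpha> (t - s) (tensor_square (u s)) x else 0))" for t x
    unfolding duhamel_def set_lebesgue_integral_def
    by (subst integral_completion) (auto intro!: Bochner_Integration.integral_cong simp: indicator_def)
  then show ?thesis by simp
qed

text \<open>L is a measurable function of time above the L^q norm, in the form in which it is used.
  With L s \<ge> 1 it is below its own square, so that differences and squares share one time
  integral.\<close>

definition controlled :: "real \<Rightarrow> (real \<Rightarrow> real) \<Rightarrow> (real \<Rightarrow> real^3 \<Rightarrow> real^3) \<Rightarrow> bool" where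
  "controlled t L u \<longleftrightarrow> L \<in> borel_measurable borel \<and> (AE s in lborel. s \<in> {0<..<t} \<longrightarrow>
      1 \<le> L s \<and> (\<integral>\<^sup>+y. omega (q y) (norm (u s y) / L s) \<partial>lborel) \<le> 1)"

lemma controlledD:
  assumes "controlled t L u"
  shows "L \<in> borel_measurable borel" "AE s in lborel. s \<in> {0<..<t} \<longrightarrow>
      1 \<le> L s \<and> (\<integral>\<^sup>+y. omega (q y) (norm (u s y) / L s) \<partial>lborel) \<le> 1"
  using assms by (simp_all add: controlled_def)

definition singular_integral :: "(real \<Rightarrow> real) \<Rightarrow> real \<Rightarrow> real \<Rightarrow> ennreal" where
  "singular_integral L t0 t = (\<integral>\<^sup>+s. ennreal ((L s)\<^sup>2 * (t - s) powr - \<gamma>) * indicator {t0<..<t} s \<partial>lborel)"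

lemma duhamel_bound:
  assumes u: "jointly_measurable u" and cu: "controlled t L u" and t: "0 < t" "t \<le> 1"
    and J: "singular_integral L 0 t \<le> ennreal j" and j: "0 \<le> j"
  shows "AE s in lborel. s \<in> {0<..<t} \<longrightarrow> oseen_conv_exists \<alpha> (t - s) (tensor_square (u s)) x"
    "set_integrable lebesgue {0<..<t} (\<lambda>s. oseen_conv \<alpha> (t - s) (tensor_square (u s)) x)"
    "norm (duhamel u t x) \<le> duhamel_const * j"
proof -
  note [measurable] = borel_measurable_oseen_conv[OF u] jointly_measurable_slice[OF u] controlledD(1)[OF cu]
  show "AE s in lborel. s \<in> {0<..<t} \<longrightarrow> oseen_conv_exists \<alpha> (t - s) (tensor_square (u s)) x"
    using controlledD(2)[OF cu]
    by eventually_elim (use t in \<open>auto intro!: oseen_tensor_bound(1)\<close>)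
  have b: "AE s in lborel. s \<in> {0<..<t} \<longrightarrow> norm (oseen_conv \<alpha> (t - s) (tensor_square (u s)) x) \<le> duhamel_const * ((L s)\<^sup>2 * (t - s) powr - \<gamma>)"
    using controlledD(2)[OF cu]
  proof eventually_elim
    case (elim s)
    show ?case
    proof
      assume s: "s \<in> {0<..<t}"
      then show "norm (oseen_conv \<alpha> (t - s) (tensor_square (u s)) x) \<le> duhamel_const * ((L s)\<^sup>2 * (t - s) powr - \<gamma>)"
        using oseen_tensor_bound(2)[of "u s" "L s" "t - s" x] elim t by (simp add: mult_ac)
    qed
  qed
  have "(\<integral>\<^sup>+s. ennreal (duhamel_const * ((L s)\<^sup>2 * (t - s) powr - \<gamma>)) * indicator {0<..<t} s \<partial>lborel) \<le> ennreal (duhamel_const * j)"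
  proof (cases "duhamel_const = 0")
    case False
    then have c: "0 < duhamel_const" using duhamel_const_nonneg by simp
    have "(\<integral>\<^sup>+s. ennreal (duhamel_const * ((L s)\<^sup>2 * (t - s) powr - \<gamma>)) * indicator {0<..<t} s \<partial>lborel)
        = (\<integral>\<^sup>+s. ennreal duhamel_const * (ennreal ((L s)\<^sup>2 * (t - s) powr - \<gamma>) * indicator {0<..<t} s) \<partial>lborel)"
      using c by (simp add: ennreal_mult mult.assoc)
    also have "\<dots> = ennreal duhamel_const * singular_integral L 0 t"
      unfolding singular_integral_def by (rule nn_integral_cmult) measurable
    also have "\<dots> \<le> ennreal duhamel_const * ennreal j" by (intro mult_left_mono J) auto
    finally show ?thesis using c j by (simp add: ennreal_mult)
  qed simp
  note sb = set_integral_bound[OF _ _ b this]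
  show "set_integrable lebesgue {0<..<t} (\<lambda>s. oseen_conv \<alpha> (t - s) (tensor_square (u s)) x)"
    using duhamel_const_nonneg j by (intro sb(1)) auto
  show "norm (duhamel u t x) \<le> duhamel_const * j"
    unfolding duhamel_def using duhamel_const_nonneg j by (intro sb(2)) auto
qed

text \<open>Up to t0 the fields already agree, so only the singular integral after t0 counts, and it
  is small on short intervals. Finiteness over all of (0, t) serves to subtract the two Duhamel
  integrals.\<close>

lemma duhamel_diff_bound:
  assumes u: "jointly_measurable u" and v: "jointly_measurable v"
    and cu: "controlled t L u" and cv: "controlled t L v" and t: "0 < t" "t \<le> 1" and t0: "0 \<le> t0"
    and fin: "singular_integral L 0 t < \<infinity>" and J: "singular_integral L t0 t \<le> ennreal j" and j: "0 \<le> j"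
    and N: "AE s in lborel. s \<in> {0<..<t} \<longrightarrow> (AE y in lborel. norm (u s y - v s y) \<le> (if t0 < s then N else 0))" "0 \<le> N"
  shows "norm (duhamel u t x - duhamel v t x) \<le> N * duhamel_const * j"
proof -
  note [measurable] = borel_measurable_oseen_conv[OF u] jointly_measurable_slice[OF u] controlledD(1)[OF cu]
     borel_measurable_oseen_conv[OF v] jointly_measurable_slice[OF v]
  let ?h = "\<lambda>s. if t0 < s then N * duhamel_const * ((L s)\<^sup>2 * (t - s) powr - \<gamma>) else 0"
  let ?f = "\<lambda>s. oseen_conv \<alpha> (t - s) (tensor_square (u s)) x - oseen_conv \<alpha> (t - s) (tensor_square (v s)) x"
  have b: "AE s in lborel. s \<in> {0<..<t} \<longrightarrow> norm (?f s) \<le> ?h s"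
    using controlledD(2)[OF cu] controlledD(2)[OF cv] N(1)
  proof eventually_elim
    case (elim s)
    show ?case
    proof
      assume s: "s \<in> {0<..<t}"
      let ?N = "if t0 < s then N else 0"
      have "norm (?f s) \<le> ?N * L s * duhamel_const * (t - s) powr - \<gamma>"
        using oseen_tensor_diff_bound[of "u s" "v s" "L s" "t - s" ?N x] elim s t N(2) by auto
      also have "\<dots> \<le> ?N * (L s)\<^sup>2 * duhamel_const * (t - s) powr - \<gamma>"
        using elim s N(2) duhamel_const_nonneg self_le_power[of "L s" 2]
        by (intro mult_right_mono mult_left_mono) auto
      finally show "norm (?f s) \<le> ?h s" by (cases "t0 < s") (simp_all add: mult_ac)
    qed
  qed
  have "(\<integral>\<^sup>+s. ennreal (?h s) * indicator {0<..<t} s \<partial>lborel) \<le> ennreal (N * duhamel_const * j)"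
  proof -
    have NC: "0 \<le> N * duhamel_const" using N(2) duhamel_const_nonneg by simp
    have "(\<integral>\<^sup>+s. ennreal (?h s) * indicator {0<..<t} s \<partial>lborel)
        \<le> (\<integral>\<^sup>+s. ennreal (N * duhamel_const) * (ennreal ((L s)\<^sup>2 * (t - s) powr - \<gamma>) * indicator {t0<..<t} s) \<partial>lborel)"
      using NC t0 by (intro nn_integral_mono) (auto simp: indicator_def ennreal_mult)
    also have "\<dots> = ennreal (N * duhamel_const) * singular_integral L t0 t"
      unfolding singular_integral_def by (rule nn_integral_cmult) measurable
    also have "\<dots> \<le> ennreal (N * duhamel_const) * ennreal j" by (intro mult_left_mono J) auto
    finally show ?thesis using NC j by (simp add: ennreal_mult)
  qed
  note sb = set_integral_bound(2)[OF _ _ b this]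
  obtain k where k: "singular_integral L 0 t = ennreal k" "0 \<le> k"
    using fin by (cases "singular_integral L 0 t") auto
  have "duhamel u t x - duhamel v t x = (LINT s:{0<..<t}|lebesgue. ?f s)"
    unfolding duhamel_def
    by (rule set_integral_diff(2)[symmetric])
       (use duhamel_bound(2)[OF u cu t _ k(2)] duhamel_bound(2)[OF v cv t _ k(2)] k in auto)
  also have "norm \<dots> \<le> N * duhamel_const * j" using N(2) duhamel_const_nonneg j by (intro sb) auto
  finally show ?thesis .
qed

section \<open>Existence by Picard iteration\<close>

lemma singular_integral_const:
  assumes "0 \<le> t0" "t0 \<le> t"
  shows "singular_integral (\<lambda>_. l) t0 t \<le> ennreal (l\<^sup>2 * ((t - t0) powr (1 - \<gamma>) / (1 - \<gamma>)))"
proof -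
  have "singular_integral (\<lambda>_. l) t0 t = (\<integral>\<^sup>+s. ennreal (l\<^sup>2) * (ennreal ((t - s) powr - \<gamma>) * indicator {t0<..<t} s) \<partial>lborel)"
    unfolding singular_integral_def by (simp add: ennreal_mult mult.assoc)
  also have "\<dots> = ennreal (l\<^sup>2) * (\<integral>\<^sup>+s. (ennreal ((t - s) powr - \<gamma>) * indicator {t0<..<t} s) \<partial>lborel)"
    by (rule nn_integral_cmult) measurable
  also have "\<dots> \<le> ennreal (l\<^sup>2) * ennreal ((t - t0) powr (1 - \<gamma>) / (1 - \<gamma>))"
    by (intro mult_left_mono nn_integral_powr_singular \<gamma>_less_1 assms) auto
  also have "\<dots> = ennreal (l\<^sup>2 * ((t - t0) powr (1 - \<gamma>) / (1 - \<gamma>)))"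
    using \<gamma>_less_1 by (intro ennreal_mult[symmetric]) auto
  finally show ?thesis .
qed

text \<open>By \<open>UL\<close> one scale l serves every correction bounded by one, so the control
  is constant in time. On a short interval the map is a contraction of the unit ball in the supremum
  norm, and the fixed point equation holds at every point, not just almost everywhere.\<close>

lemma picard:
  assumes U: "jointly_measurable U" and l: "1 \<le> l"
    and UL: "\<And>t w. 0 < t \<Longrightarrow> t < 1 \<Longrightarrow> w \<in> borel_measurable borel \<Longrightarrow> (\<And>x. norm (w x) \<le> 1) \<Longrightarrow>
      (\<integral>\<^sup>+x. omega (q x) (norm (U t x + w x) / l) \<partial>lborel) \<le> 1"
  shows "\<exists>T w. 0 < T \<and> T \<le> 1 \<and> jointly_measurable w \<and> (\<forall>t x. norm (w t x) \<le> 1) \<and>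
     (\<forall>t x. 0 < t \<longrightarrow> t < T \<longrightarrow> w t x = - duhamel (\<lambda>t x. U t x + w t x) t x)"
proof -
  note [measurable] = jointly_measurable_comp[OF U]
  \<comment> \<open>The value of \<open>T powr (1 - \<gamma>)\<close> that brings the bound for the
    Duhamel term below 1/2. The summand 1 keeps the denominator positive and gives K \<le>
    1.\<close>
  define K where "K = (1 - \<gamma>) / (2 * l\<^sup>2 * duhamel_const + 1)"
  have K: "0 < K" "K \<le> 1" "duhamel_const * (l\<^sup>2 * (K / (1 - \<gamma>))) \<le> 1 / 2"
  proof -
    have d: "0 < 2 * l\<^sup>2 * duhamel_const + 1" using duhamel_const_nonneg by (simp add: add_nonneg_pos)
    then show "0 < K" using \<gamma>_less_1 by (simp add: K_def)
    have "0 \<le> 2 * l\<^sup>2 * duhamel_const" using duhamel_const_nonneg by simp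
    then have "1 - \<gamma> \<le> 2 * l\<^sup>2 * duhamel_const + 1" using \<gamma>_pos by linarith
    then show "K \<le> 1" unfolding K_def using d by (subst pos_divide_le_eq) auto
    have "duhamel_const * (l\<^sup>2 * (K / (1 - \<gamma>))) = duhamel_const * l\<^sup>2 / (2 * l\<^sup>2 * duhamel_const + 1)" using \<gamma>_less_1 by (simp add: K_def)
    also have "\<dots> \<le> 1 / 2" using d by (simp add: divide_le_eq)
    finally show "duhamel_const * (l\<^sup>2 * (K / (1 - \<gamma>))) \<le> 1 / 2" .
  qed
  define T where "T = K powr (1 / (1 - \<gamma>))"
  have T: "0 < T" "T \<le> 1" using K \<gamma>_less_1 by (auto simp: T_def intro!: powr_le1)
  have TK: "T powr (1 - \<gamma>) = K" using K \<gamma>_less_1 by (simp add: T_def powr_powr)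
  \<comment> \<open>With the value 0 outside (0, T) all bounds hold for every real t and pass
    through the iteration without a condition on time.\<close>
  define \<Phi> where "\<Phi> w = (\<lambda>t x. if 0 < t \<and> t < T then - duhamel (\<lambda>t x. U t x + w t x) t x else 0)" for w
  define ok where "ok w \<longleftrightarrow> jointly_measurable w \<and> (\<forall>t x. norm (w t x) \<le> 1)" for w
  have jm: "jointly_measurable (\<lambda>t x. U t x + w t x)" if "ok w" for w
  proof -
    have [measurable]: "jointly_measurable w" using that by (simp add: ok_def)
    show ?thesis using U by measurable
  qed
  have ctl: "controlled t (\<lambda>_. l) (\<lambda>t x. U t x + w t x)" if "ok w" "t < T" for w t
    unfolding controlled_def using that T(2) l
    by (intro conjI AE_I2) (auto simp: ok_def intro!: UL jointly_measurable_slice)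
  have si: "singular_integral (\<lambda>_. l) 0 t \<le> ennreal (l\<^sup>2 * (K / (1 - \<gamma>)))" if "0 < t" "t < T" for t
  proof (rule order_trans[OF singular_integral_const ennreal_leI])
    have "t powr (1 - \<gamma>) \<le> K" unfolding TK[symmetric] using that \<gamma>_less_1 by (intro powr_mono2) auto
    then show "l\<^sup>2 * ((t - 0) powr (1 - \<gamma>) / (1 - \<gamma>)) \<le> l\<^sup>2 * (K / (1 - \<gamma>))"
      using \<gamma>_less_1 by (intro mult_left_mono divide_right_mono) auto
  qed (use that in auto)
  have k0: "0 \<le> l\<^sup>2 * (K / (1 - \<gamma>))" using K \<gamma>_less_1 by simp
  have \<Phi>ok: "ok (\<Phi> w)" if w: "ok w" for w
  proof -
    have [measurable]: "jointly_measurable (duhamel (\<lambda>t x. U t x + w t x))"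
      by (rule jointly_measurable_duhamel[OF jm[OF w]])
    have "norm (\<Phi> w t x) \<le> 1" for t x
    proof (cases "0 < t \<and> t < T")
      case True
      then have "norm (\<Phi> w t x) \<le> duhamel_const * (l\<^sup>2 * (K / (1 - \<gamma>)))"
        using duhamel_bound(3)[OF jm[OF w] ctl[OF w] _ _ si k0, of t x] T by (simp add: \<Phi>_def)
      then show ?thesis using K(3) by linarith
    qed (auto simp: \<Phi>_def)
    moreover have "jointly_measurable (\<Phi> w)" unfolding \<Phi>_def by measurable
    ultimately show ?thesis by (simp add: ok_def)
  qed
  have contr: "norm (\<Phi> w t x - \<Phi> w' t x) \<le> N / 2"
    if w: "ok w" "ok w'" and N: "\<And>t x. norm (w t x - w' t x) \<le> N" "0 \<le> N" for w w' N t x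
  proof (cases "0 < t \<and> t < T")
    case True
    then have t: "0 < t" "t < T" "t \<le> 1" using T by auto
    have fin: "singular_integral (\<lambda>_. l) 0 t < \<infinity>" using si[OF t(1,2)] by (auto intro: le_less_trans)
    have "norm (duhamel (\<lambda>t x. U t x + w t x) t x - duhamel (\<lambda>t x. U t x + w' t x) t x) \<le> N * duhamel_const * (l\<^sup>2 * (K / (1 - \<gamma>)))"
      by (rule duhamel_diff_bound[OF jm[OF w(1)] jm[OF w(2)] ctl[OF w(1) t(2)] ctl[OF w(2) t(2)] t(1,3) order_refl
            fin si[OF t(1,2)] k0 _ N(2)]) (use N(1) in auto)
    also have "\<dots> \<le> N * (1 / 2)" using mult_left_mono[OF K(3) N(2)] by (simp add: mult.assoc)
    finally show ?thesis using True by (simp add: \<Phi>_def norm_minus_commute)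
  qed (use N in \<open>auto simp: \<Phi>_def\<close>)
  define W where "W n = (\<Phi> ^^ n) (\<lambda>t x. 0)" for n
  have Wok: "ok (W n)" for n
    by (induct n) (auto simp: W_def ok_def[of "\<lambda>t x. 0"] intro: \<Phi>ok)
  have W_Suc: "W (Suc n) = \<Phi> (W n)" for n by (simp add: W_def)
  have Wd: "norm (W (Suc n) t x - W n t x) \<le> (1 / 2) ^ n" for n t x
  proof (induct n arbitrary: t x)
    case 0
    then show ?case using Wok[of 1] by (simp add: W_def ok_def)
  next
    case (Suc n)
    show ?case unfolding W_Suc[of "Suc n"] W_Suc[of n] 
      using contr[OF Wok[of "Suc n"] Wok[of n] Suc] by (simp add: W_Suc)
  qed
  have summ: "summable (\<lambda>n. W (Suc n) t x - W n t x)" for t x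
    by (rule summable_comparison_test'[where g = "\<lambda>n. (1 / 2) ^ n" and N = 0]) (auto intro: Wd simp: summable_geometric)
  define w where "w t x = (\<Sum>n. W (Suc n) t x - W n t x)" for t x
  have W0: "W 0 t x = 0" for t x by (simp add: W_def)
  have partial: "(\<Sum>k<n. W (Suc k) t x - W k t x) = W n t x" for n t x
    by (subst sum_lessThan_telescope) (simp add: W0)
  have lim: "(\<lambda>n. W n t x) \<longlonglongrightarrow> w t x" for t x
    using summable_LIMSEQ[OF summ[of t x]] unfolding partial w_def .
  have wW: "norm (w t x - W n t x) \<le> 2 * (1 / 2) ^ n" for n t x
  proof (rule LIMSEQ_le_const2)
    show "(\<lambda>m. norm (W m t x - W n t x)) \<longlonglongrightarrow> norm (w t x - W n t x)"
      by (intro tendsto_intros lim)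
    \<comment> \<open>The right side is the partial geometric sum from n to n + k - 1; without the
      subtracted tail the induction would not close.\<close>
    have "norm (W (n + k) t x - W n t x) \<le> 2 * (1 / 2) ^ n - 2 * (1 / 2) ^ (n + k)" for k
    proof (induct k)
      case (Suc k)
      have "norm (W (n + Suc k) t x - W n t x) \<le> norm (W (Suc (n + k)) t x - W (n + k) t x) + norm (W (n + k) t x - W n t x)"
        using norm_triangle_ineq[of "W (Suc (n + k)) t x - W (n + k) t x" "W (n + k) t x - W n t x"] by simp
      also have "\<dots> \<le> (1 / 2) ^ (n + k) + (2 * (1 / 2) ^ n - 2 * (1 / 2) ^ (n + k))" by (intro add_mono Wd Suc)
      finally show ?case by simp
    qed simp
    moreover have "2 * (1 / 2) ^ n - 2 * (1 / 2) ^ (n + k) \<le> 2 * (1 / 2 :: real) ^ n" for k by simp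
    ultimately have "norm (W (n + k) t x - W n t x) \<le> 2 * (1 / 2) ^ n" for k by (blast intro: order_trans)
    then show "\<exists>N. \<forall>m\<ge>N. norm (W m t x - W n t x) \<le> 2 * (1 / 2) ^ n"
      by (metis le_add_diff_inverse)
  qed
  have wok: "ok w"
  proof -
    have "jointly_measurable w"
    proof (rule borel_measurable_LIMSEQ_metric)
      show "(\<lambda>(t, x). W n t x) \<in> borel_measurable (borel \<Otimes>\<^sub>M borel)" for n using Wok[of n] by (simp add: ok_def)
      show "\<And>p. p \<in> space (borel \<Otimes>\<^sub>M borel) \<Longrightarrow> (\<lambda>n. (case p of (t, x) \<Rightarrow> W n t x)) \<longlonglongrightarrow> (case p of (t, x) \<Rightarrow> w t x)"
        using lim by (auto simp: case_prod_unfold)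
    qed
    moreover have "norm (w t x) \<le> 1" for t x
      by (rule LIMSEQ_le_const2[OF tendsto_norm[OF lim]]) (use Wok in \<open>auto simp: ok_def\<close>)
    ultimately show ?thesis by (simp add: ok_def)
  qed
  have fp: "\<Phi> w t x = w t x" for t x
  proof -
    have "\<exists>N. \<forall>n\<ge>N. norm (\<Phi> w t x - w t x) \<le> 2 * (1 / 2) ^ n"
    proof (intro exI allI impI)
      fix n
      have "norm (\<Phi> w t x - W (Suc n) t x) \<le> (2 * (1 / 2) ^ n) / 2"
        unfolding W_Suc by (rule contr[OF wok Wok wW]) simp
      moreover have "norm (W (Suc n) t x - w t x) \<le> 2 * (1 / 2) ^ Suc n"
        using wW[of t x "Suc n"] by (simp add: norm_minus_commute)
      moreover have "norm (\<Phi> w t x - w t x) \<le> norm (\<Phi> w t x - W (Suc n) t x) + norm (W (Suc n) t x - w t x)"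
        using norm_triangle_ineq[of "\<Phi> w t x - W (Suc n) t x" "W (Suc n) t x - w t x"] by simp
      ultimately show "norm (\<Phi> w t x - w t x) \<le> 2 * (1 / 2) ^ n" by simp
    qed
    moreover have "(\<lambda>n. 2 * (1 / 2 :: real) ^ n) \<longlonglongrightarrow> 2 * 0"
      by (intro tendsto_mult tendsto_const LIMSEQ_power_zero) simp
    ultimately have "norm (\<Phi> w t x - w t x) \<le> 2 * 0"
      by (intro LIMSEQ_le_const)
    then show ?thesis by simp
  qed
  show ?thesis
  proof (intro exI[of _ T] exI[of _ w] conjI allI impI)
    fix t x assume "0 < t" "t < T"
    then show "w t x = - duhamel (\<lambda>t x. U t x + w t x) t x"
      using fp[of t x] by (simp add: \<Phi>_def)
  qed (use T wok in \<open>auto simp: ok_def\<close>)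
qed

end

section \<open>The linear part\<close>

lemma nn_integral_powr_singular_right:
  assumes "a < 1" "s \<le> t1"
  shows "(\<integral>\<^sup>+t. ennreal ((t - s) powr - a) * indicator {s<..<t1} t \<partial>lborel) \<le> ennreal ((t1 - s) powr (1 - a) / (1 - a))"
proof -
  have "(\<integral>\<^sup>+t. ennreal ((t - s) powr - a) * indicator {s<..<t1} t \<partial>lborel) =
     (\<integral>\<^sup>+t. ennreal (t powr - a) * indicator {s<..<t1} (s + t) \<partial>lborel)"
    using nn_integral_real_affine[of "\<lambda>t. ennreal ((t - s) powr - a) * indicator {s<..<t1} t" "1" s] by simp
  also have "\<dots> \<le> (\<integral>\<^sup>+t. ennreal (t powr - a) * indicator {0..t1 - s} t \<partial>lborel)"
    by (intro nn_integral_mono) (auto simp: indicator_def)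
  also have "\<dots> = ennreal ((t1 - s) powr (- a + 1) / (- a + 1))"
    using assms by (intro nn_integral_has_integral_lebesgue' has_integral_powr_from_0) auto
  finally show ?thesis by (simp add: add.commute)
qed

lemma ennreal_enn2real_le: "ennreal (enn2real x) \<le> x"
  by (cases x) auto

text \<open>An affine bound for the concave power, adapted to the level Y: the power g of X / Y is
  at most 1 + X / Y. Being affine in \<sigma>, it can be integrated in time while Y stays
  fixed.\<close>

lemma powr_le_shifted:
  fixes X Y g \<sigma> :: real
  assumes "X = max 1 \<sigma>" "1 \<le> Y" "0 \<le> g" "g \<le> 1" "0 \<le> \<sigma>"
  shows "X powr g \<le> Y powr g * (2 + \<sigma> / Y)"
proof -
  have X: "1 \<le> X" using assms by simp
  have "(X / Y) powr g \<le> 1 + X / Y"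
  proof (cases "X / Y \<le> 1")
    case True
    then have "(X / Y) powr g \<le> 1" using assms X by (intro powr_le1) auto
    also have "\<dots> \<le> 1 + X / Y" using assms X by simp
    finally show ?thesis .
  next
    case False
    then have "(X / Y) powr g \<le> (X / Y) powr 1" using assms by (intro powr_mono) auto
    then show ?thesis using assms X by simp
  qed
  also have "X / Y \<le> 1 + \<sigma> / Y"
  proof -
    have "X \<le> 1 + \<sigma>" using assms by simp
    then have "X / Y \<le> (1 + \<sigma>) / Y" using assms by (intro divide_right_mono) auto
    also have "\<dots> = 1 / Y + \<sigma> / Y" by (rule add_divide_distrib)
    also have "1 / Y \<le> 1" using assms by simp
    finally show ?thesis by simp
  qed
  finally have "(X / Y) powr g \<le> 2 + \<sigma> / Y" by simp
  moreover have "X powr g = Y powr g * (X / Y) powr g" using assms X by (simp add: powr_divide)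
  ultimately show ?thesis using assms by (simp add: mult_left_mono)
qed

context ns
begin

text \<open>The modular density of z averaged over the length belonging to time t; it takes the
  place of a maximal function.\<close>

definition smear :: "real \<Rightarrow> (real^3 \<Rightarrow> real) \<Rightarrow> real^3 \<Rightarrow> ennreal" where
  "smear t z x = (\<integral>\<^sup>+y. ennreal (majorant (t powr (1 / (2 * \<alpha>))) (x - y)) * omega (q y) (z y) \<partial>lborel)"

lemma borel_measurable_smear [measurable (raw)]:
  assumes [measurable]: "t \<in> borel_measurable M" "x \<in> borel_measurable M"
    and z[measurable]: "(\<lambda>(w, y). z w y) \<in> borel_measurable (M \<Otimes>\<^sub>M borel)"
  shows "(\<lambda>w. smear (t w) (z w) (x w)) \<in> borel_measurable M"
proof -
  have "(\<lambda>p. (\<lambda>(w, y). z w y) p) \<in> borel_measurable (M \<Otimes>\<^sub>M lborel)"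
    using z by (subst measurable_cong_sets[OF sets_pair_measure_cong[OF refl sets_lborel] refl])
  then have [measurable]: "(\<lambda>p. z (fst p) (snd p)) \<in> borel_measurable (M \<Otimes>\<^sub>M lborel)"
    by (simp add: case_prod_unfold)
  show ?thesis unfolding smear_def by measurable
qed

lemma nn_integral_smear:
  assumes [measurable]: "z \<in> borel_measurable borel" and le: "(\<integral>\<^sup>+y. omega (q y) (z y) \<partial>lborel) \<le> 1" and t: "0 < t"
  shows "(\<integral>\<^sup>+x. smear t z x \<partial>lborel) \<le> ennreal bump_mass"
proof -
  let ?\<tau> = "t powr (1 / (2 * \<alpha>))"
  have \<tau>: "0 < ?\<tau>" using t by simp
  have "(\<integral>\<^sup>+x. smear t z x \<partial>lborel) = (\<integral>\<^sup>+y. (\<integral>\<^sup>+x. ennreal (majorant ?\<tau> (x - y)) * omega (q y) (z y) \<partial>lborel) \<partial>lborel)"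
    unfolding smear_def by (rule lborel_pair.Fubini'[symmetric]) measurable
  also have "\<dots> = (\<integral>\<^sup>+y. ennreal bump_mass * omega (q y) (z y) \<partial>lborel)"
    by (subst nn_integral_multc) (auto simp: nn_integral_majorant(2)[OF \<tau>])
  also have "\<dots> = ennreal bump_mass * (\<integral>\<^sup>+y. omega (q y) (z y) \<partial>lborel)" by (rule nn_integral_cmult) measurable
  also have "\<dots> \<le> ennreal bump_mass * 1" by (intro mult_left_mono le) auto
  finally show ?thesis by simp
qed

definition force :: "(real \<Rightarrow> real^3 \<Rightarrow> real^3) \<Rightarrow> real \<Rightarrow> real^3 \<Rightarrow> real^3" where
  "force f t x = (LINT s:{0<..<t}|lebesgue. conv (heat_kernel \<alpha> (t - s)) (f s) x)"

lemma jointly_measurable_force: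
  assumes f: "jointly_measurable f"
  shows "jointly_measurable (force f)"
proof -
  note [measurable] = borel_measurable_heat_conv[OF f]
  have "force f t x = (LINT s|lborel. (if 0 < s \<and> s < t then conv (heat_kernel \<alpha> (t - s)) (f s) x else 0))" for t x
    unfolding force_def set_lebesgue_integral_def
    by (subst integral_completion) (auto intro!: Bochner_Integration.integral_cong simp: indicator_def)
  then show ?thesis by simp
qed

lemma controlled_mono: "controlled t L u \<Longrightarrow> t' \<le> t \<Longrightarrow> controlled t' L u"
  unfolding controlled_def by (auto elim!: eventually_mono)

text \<open>L is merely integrable, so its convolution with the power -\<beta> is known to be finite
  only for almost every t, by Tonelli. The bound does not involve x, hence neither does the
  exceptional set of times.\<close>

lemma force_exists:
  assumes f: "jointly_measurable f" and cf: "controlled 1 L f"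
    and Lfin: "(\<integral>\<^sup>+s. ennreal (L s) * indicator {0<..<1} s \<partial>lborel) < \<infinity>"
  shows "AE t in lborel. t \<in> {0<..<1} \<longrightarrow> (\<forall>x.
      (AE s in lborel. s \<in> {0<..<t} \<longrightarrow> conv_exists (heat_kernel \<alpha> (t - s)) (f s) x) \<and>
      set_integrable lebesgue {0<..<t} (\<lambda>s. conv (heat_kernel \<alpha> (t - s)) (f s) x))"
proof -
  note [measurable] = controlledD(1)[OF cf] borel_measurable_heat_conv[OF f] jointly_measurable_slice[OF f]
  define G where "G t s = ennreal (L s) * indicator {0<..<1} s * (ennreal ((t - s) powr - \<beta>) * (if s < t \<and> t < 1 then 1 else 0))" for t s
  have [measurable]: "(\<lambda>(t, s). G t s) \<in> borel_measurable (lborel \<Otimes>\<^sub>M lborel)"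
    unfolding G_def by measurable
  have [measurable]: "G t \<in> borel_measurable borel" for t unfolding G_def by measurable
  have "(\<integral>\<^sup>+t. (\<integral>\<^sup>+s. G t s \<partial>lborel) \<partial>lborel) = (\<integral>\<^sup>+s. (\<integral>\<^sup>+t. G t s \<partial>lborel) \<partial>lborel)"
    by (rule lborel_pair.Fubini'[symmetric]) measurable
  also have "\<dots> \<le> (\<integral>\<^sup>+s. ennreal (L s) * indicator {0<..<1} s * ennreal (1 / (1 - \<beta>)) \<partial>lborel)"
  proof (rule nn_integral_mono)
    fix s :: real
    show "(\<integral>\<^sup>+t. G t s \<partial>lborel) \<le> ennreal (L s) * indicator {0<..<1} s * ennreal (1 / (1 - \<beta>))"
    proof (cases "s \<in> {0<..<1}")
      case True
      have "(\<integral>\<^sup>+t. G t s \<partial>lborel) = ennreal (L s) * indicator {0<..<1} s * (\<integral>\<^sup>+t. ennreal ((t - s) powr - \<beta>) * indicator {s<..<1} t \<partial>lborel)"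
        unfolding G_def by (subst nn_integral_cmult[symmetric]) (auto intro!: nn_integral_cong simp: indicator_def)
      also have "\<dots> \<le> ennreal (L s) * indicator {0<..<1} s * ennreal ((1 - s) powr (1 - \<beta>) / (1 - \<beta>))"
        using True by (intro mult_left_mono nn_integral_powr_singular_right \<beta>_less_1) auto
      also have "\<dots> \<le> ennreal (L s) * indicator {0<..<1} s * ennreal (1 / (1 - \<beta>))"
        using True \<beta>_less_1 by (intro mult_left_mono ennreal_leI divide_right_mono powr_le1) auto
      finally show ?thesis .
    qed (simp add: G_def)
  qed
  also have "\<dots> = (\<integral>\<^sup>+s. ennreal (L s) * indicator {0<..<1} s \<partial>lborel) * ennreal (1 / (1 - \<beta>))"
    by (rule nn_integral_multc) measurable
  also have "\<dots> < \<infinity>" using Lfin by (simp add: ennreal_mult_less_top)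
  finally have "AE t in lborel. (\<integral>\<^sup>+s. G t s \<partial>lborel) \<noteq> \<infinity>"
    by (intro nn_integral_PInf_AE) auto
  then show ?thesis
  proof (eventually_elim, intro impI allI)
    fix t x assume fin: "(\<integral>\<^sup>+s. G t s \<partial>lborel) \<noteq> \<infinity>" and t: "t \<in> {0<..<1::real}"
    have cf': "AE s in lborel. s \<in> {0<..<t} \<longrightarrow>
      1 \<le> L s \<and> (\<integral>\<^sup>+y. omega (q y) (norm (f s y) / L s) \<partial>lborel) \<le> 1"
      using controlledD(2)[OF controlled_mono[OF cf, of t]] t by simp
    have e: "AE s in lborel. s \<in> {0<..<t} \<longrightarrow> conv_exists (heat_kernel \<alpha> (t - s)) (f s) x"
      using cf' by eventually_elim (use t in \<open>auto intro!: heat_conv_estimates(1)\<close>)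
    define c0 where "c0 = heat_const * (4 * bump_mass + 4)"
    have c0: "0 \<le> c0" using heat_const(1) bump_mass_nonneg by (simp add: c0_def)
    have b: "AE s in lborel. s \<in> {0<..<t} \<longrightarrow> norm (conv (heat_kernel \<alpha> (t - s)) (f s) x) \<le> c0 * (L s * (t - s) powr - \<beta>)"
      using cf'
    proof eventually_elim
      case (elim s)
      then show ?case using t heat_conv_estimates(2)[of "f s" "L s" "t - s" x] by (auto simp: c0_def mult_ac)
    qed
    have "(\<integral>\<^sup>+s. ennreal (c0 * (L s * (t - s) powr - \<beta>)) * indicator {0<..<t} s \<partial>lborel)
        \<le> (\<integral>\<^sup>+s. ennreal c0 * G t s \<partial>lborel)"
    proof (rule nn_integral_mono)
      fix s
      show "ennreal (c0 * (L s * (t - s) powr - \<beta>)) * indicator {0<..<t} s \<le> ennreal c0 * G t s"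
        using c0 t by (auto simp: G_def indicator_def ennreal_mult' ennreal_mult'' mult.assoc)
    qed
    also have "\<dots> = ennreal c0 * (\<integral>\<^sup>+s. G t s \<partial>lborel)" by (rule nn_integral_cmult) measurable
    also have "\<dots> \<le> ennreal (c0 * enn2real (\<integral>\<^sup>+s. G t s \<partial>lborel))"
      using c0 fin by (simp add: ennreal_mult less_top)
    finally have "set_integrable lebesgue {0<..<t} (\<lambda>s. conv (heat_kernel \<alpha> (t - s)) (f s) x)"
      using c0 by (intro set_integral_bound(1)[OF _ _ b]) auto
    with e show "(AE s in lborel. s \<in> {0<..<t} \<longrightarrow> conv_exists (heat_kernel \<alpha> (t - s)) (f s) x) \<and>
      set_integrable lebesgue {0<..<t} (\<lambda>s. conv (heat_kernel \<alpha> (t - s)) (f s) x)" by blast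
  qed
qed

lemma smear_const_nonneg: "0 \<le> smear_const" using bump_mass_nonneg by (simp add: smear_const_def)

text \<open>Convexity of the modular in \<open>s\<close>, in the form of \<open>powr_le_shifted\<close> applied to the average of the
  functions \<open>smear (t - s)\<close> with weight \<open>L / \<Lambda>\<close>.\<close>

lemma force_bound:
  assumes f: "jointly_measurable f" and cf: "controlled 1 L f"
    and Lfin: "(\<integral>\<^sup>+s. ennreal (L s) * indicator {0<..<1} s \<partial>lborel) \<le> ennreal \<Lambda>" and \<Lambda>: "0 < \<Lambda>"
    and t: "0 < t" "t < 1"
  shows "\<exists>S. S \<in> borel_measurable borel \<and> (\<forall>x. 0 \<le> S x) \<and> (\<integral>\<^sup>+x. ennreal (S x) \<partial>lborel) \<le> ennreal bump_mass \<and>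
     (AE x in lborel. norm (force f t x) \<le> 3 * \<Lambda> * (heat_const * smear_const) * max 1 (S x) powr g x)"
proof -
  note [measurable] = controlledD(1)[OF cf] borel_measurable_heat_conv[OF f] jointly_measurable_comp[OF f]
  note cf' = controlledD(2)[OF controlled_mono[OF cf less_imp_le[OF t(2)]]]
  define S where "S s x = smear (t - s) (\<lambda>y. norm (f s y) / L s) x" for s x
  have [measurable]: "(\<lambda>w. S (a w) (b w)) \<in> borel_measurable M" if [measurable]: "a \<in> borel_measurable M" "b \<in> borel_measurable M" for a b M
    unfolding S_def by measurable
  \<comment> \<open>The weight L / \<Lambda> has total mass at most one, so the average still has
    integral at most \<open>bump_mass\<close>.\<close>
  define Sbar where "Sbar x = (\<integral>\<^sup>+s. ennreal (L s / \<Lambda>) * indicator {0<..<t} s * S s x \<partial>lborel)" for x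
  have [measurable]: "Sbar \<in> borel_measurable borel" unfolding Sbar_def[abs_def] by measurable
  have Lt: "(\<integral>\<^sup>+s. ennreal (L s) * indicator {0<..<t} s \<partial>lborel) \<le> ennreal \<Lambda>"
    using t by (intro order_trans[OF nn_integral_mono Lfin]) (auto simp: indicator_def)
  have L\<Lambda>: "(\<integral>\<^sup>+s. ennreal (L s / \<Lambda>) * indicator {0<..<t} s \<partial>lborel) \<le> 1"
  proof -
    have "(\<integral>\<^sup>+s. ennreal (L s / \<Lambda>) * indicator {0<..<t} s \<partial>lborel) = (\<integral>\<^sup>+s. ennreal (1 / \<Lambda>) * (ennreal (L s) * indicator {0<..<t} s) \<partial>lborel)"
      using \<Lambda> by (intro nn_integral_cong) (simp add: ennreal_mult'[symmetric] mult.assoc[symmetric])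
    also have "\<dots> = ennreal (1 / \<Lambda>) * (\<integral>\<^sup>+s. (ennreal (L s) * indicator {0<..<t} s) \<partial>lborel)"
      by (rule nn_integral_cmult) measurable
    also have "\<dots> \<le> ennreal (1 / \<Lambda>) * ennreal \<Lambda>" by (intro mult_left_mono Lt) auto
    also have "\<dots> = 1" using \<Lambda> by (simp flip: ennreal_mult)
    finally show ?thesis .
  qed
  have SbarA: "(\<integral>\<^sup>+x. Sbar x \<partial>lborel) \<le> ennreal bump_mass"
  proof -
    have "(\<integral>\<^sup>+x. Sbar x \<partial>lborel) = (\<integral>\<^sup>+s. (\<integral>\<^sup>+x. ennreal (L s / \<Lambda>) * indicator {0<..<t} s * S s x \<partial>lborel) \<partial>lborel)"
      unfolding Sbar_def by (rule lborel_pair.Fubini'[symmetric]) measurable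
    also have "\<dots> = (\<integral>\<^sup>+s. ennreal (L s / \<Lambda>) * indicator {0<..<t} s * (\<integral>\<^sup>+x. S s x \<partial>lborel) \<partial>lborel)"
      by (intro nn_integral_cong nn_integral_cmult) measurable
    also have "\<dots> \<le> (\<integral>\<^sup>+s. ennreal (L s / \<Lambda>) * indicator {0<..<t} s * ennreal bump_mass \<partial>lborel)"
    proof (rule nn_integral_mono_AE)
      show "AE s in lborel. ennreal (L s / \<Lambda>) * indicator {0<..<t} s * (\<integral>\<^sup>+x. S s x \<partial>lborel) \<le> ennreal (L s / \<Lambda>) * indicator {0<..<t} s * ennreal bump_mass"
        using cf'
      proof eventually_elim
        case (elim s)
        show ?case
        proof (cases "s \<in> {0<..<t}")
          case True
          then have "(\<integral>\<^sup>+x. S s x \<partial>lborel) \<le> ennreal bump_mass"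
            unfolding S_def using elim by (intro nn_integral_smear) auto
          then show ?thesis by (intro mult_left_mono) auto
        qed simp
      qed
    qed
    also have "\<dots> = (\<integral>\<^sup>+s. ennreal (L s / \<Lambda>) * indicator {0<..<t} s \<partial>lborel) * ennreal bump_mass"
      by (rule nn_integral_multc) measurable
    also have "\<dots> \<le> 1 * ennreal bump_mass" by (intro mult_right_mono L\<Lambda>) auto
    finally show ?thesis by simp
  qed
  \<comment> \<open>Where \<open>Sbar\<close> is infinite, \<open>enn2real\<close> would turn it
    into 0; such points form a null set.\<close>
  have Sfin: "AE x in lborel. Sbar x \<noteq> \<infinity>"
    using SbarA by (intro nn_integral_PInf_AE) (auto simp: top_unique)
  define c0 where "c0 = heat_const * smear_const"
  have c0: "0 \<le> c0" using heat_const(1) smear_const_nonneg by (simp add: c0_def)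
  have main: "norm (force f t x) \<le> 3 * \<Lambda> * c0 * max 1 (enn2real (Sbar x)) powr g x" if fin: "Sbar x \<noteq> \<infinity>" for x
  proof -
    \<comment> \<open>One level for all s, so that \<open>Y powr g x\<close> leaves the time
      integral.\<close>
    define Y where "Y = max 1 (enn2real (Sbar x))"
    have Y: "1 \<le> Y" by (simp add: Y_def)
    define E where "E = c0 * Y powr g x"
    have E: "0 \<le> E" using c0 by (simp add: E_def)
    have b: "AE s in lborel. s \<in> {0<..<t} \<longrightarrow> norm (conv (heat_kernel \<alpha> (t - s)) (f s) x) \<le> E * (L s * (2 + enn2real (S s x) / Y))"
      using cf'
    proof eventually_elim
      case (elim s)
      show ?case
      proof
        assume s: "s \<in> {0<..<t}"
        have "norm (conv (heat_kernel \<alpha> (t - s)) (f s) x) \<le> L s * c0 * max 1 (enn2real (S s x)) powr g x"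
          unfolding S_def smear_def c0_def using s elim t by (intro heat_conv_estimates(3)) auto
        also have "\<dots> \<le> L s * c0 * (Y powr g x * (2 + enn2real (S s x) / Y))"
          using c0 elim s by (intro mult_left_mono powr_le_shifted[OF refl Y g_nonneg g_le_1]) auto
        finally show "norm (conv (heat_kernel \<alpha> (t - s)) (f s) x) \<le> E * (L s * (2 + enn2real (S s x) / Y))"
          by (simp add: E_def mult_ac)
      qed
    qed
    \<comment> \<open>The two terms integrate to at most \<open>2 * E * \<Lambda>\<close> and
      \<open>E * \<Lambda>\<close>, which is the 3 in the statement.\<close>
    have "(\<integral>\<^sup>+s. ennreal (E * (L s * (2 + enn2real (S s x) / Y))) * indicator {0<..<t} s \<partial>lborel)
       \<le> (\<integral>\<^sup>+s. ennreal (2 * E) * (ennreal (L s) * indicator {0<..<t} s) + ennreal (E * \<Lambda> / Y) * (ennreal (L s / \<Lambda>) * indicator {0<..<t} s * S s x) \<partial>lborel)"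
    proof (rule nn_integral_mono_AE)
      show "AE s in lborel. ennreal (E * (L s * (2 + enn2real (S s x) / Y))) * indicator {0<..<t} s \<le>
         ennreal (2 * E) * (ennreal (L s) * indicator {0<..<t} s) + ennreal (E * \<Lambda> / Y) * (ennreal (L s / \<Lambda>) * indicator {0<..<t} s * S s x)"
        using cf'
      proof eventually_elim
        case (elim s)
        show ?case
        proof (cases "s \<in> {0<..<t}")
          case True
          let ?e = "enn2real (S s x)"
          have L0: "0 \<le> L s" using elim True by simp
          have eq: "E * (L s * (2 + ?e / Y)) = 2 * E * L s + (E * \<Lambda> / Y) * (L s / \<Lambda> * ?e)"
            using \<Lambda> by (simp add: algebra_simps)
          have sp: "ennreal (a * b + c * (d * e)) = ennreal a * ennreal b + ennreal c * (ennreal d * ennreal e)"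
            if "0 \<le> a" "0 \<le> b" "0 \<le> c" "0 \<le> d" "0 \<le> e" for a b c d e
            using that by (simp add: ennreal_plus ennreal_mult)
          have "ennreal (E * (L s * (2 + ?e / Y))) = ennreal (2 * E) * ennreal (L s) + ennreal (E * \<Lambda> / Y) * (ennreal (L s / \<Lambda>) * ennreal ?e)"
            unfolding eq using E L0 \<Lambda> Y by (intro sp) auto
          also have "\<dots> \<le> ennreal (2 * E) * ennreal (L s) + ennreal (E * \<Lambda> / Y) * (ennreal (L s / \<Lambda>) * S s x)"
            by (intro add_left_mono mult_left_mono ennreal_enn2real_le) auto
          finally show ?thesis using True by simp
        qed simp
      qed
    qed
    also have "\<dots> = ennreal (2 * E) * (\<integral>\<^sup>+s. ennreal (L s) * indicator {0<..<t} s \<partial>lborel) + ennreal (E * \<Lambda> / Y) * Sbar x"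
      unfolding Sbar_def by (subst nn_integral_add) (auto simp: nn_integral_cmult)
    also have "\<dots> \<le> ennreal (2 * E) * ennreal \<Lambda> + ennreal (E * \<Lambda> / Y) * ennreal Y"
    proof (intro add_mono mult_left_mono Lt)
      have "Sbar x = ennreal (enn2real (Sbar x))" using fin by (simp add: less_top)
      also have "\<dots> \<le> ennreal Y" unfolding Y_def by (intro ennreal_leI) simp
      finally show "Sbar x \<le> ennreal Y" .
    qed auto
    also have "\<dots> = ennreal (2 * E * \<Lambda> + E * \<Lambda> / Y * Y)"
    proof -
      have "0 \<le> 2 * E" "0 \<le> E * \<Lambda> / Y" "0 \<le> 2 * E * \<Lambda>" "0 \<le> E * \<Lambda> / Y * Y" using E \<Lambda> Y by auto
      then show ?thesis using \<Lambda> Y by (simp only: ennreal_plus ennreal_mult less_imp_le order_trans[OF zero_le_one])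
    qed
    also have "2 * E * \<Lambda> + E * \<Lambda> / Y * Y = 3 * \<Lambda> * c0 * Y powr g x" using Y by (simp add: E_def)
    finally have "(\<integral>\<^sup>+s. ennreal (E * (L s * (2 + enn2real (S s x) / Y))) * indicator {0<..<t} s \<partial>lborel) \<le> ennreal (3 * \<Lambda> * c0 * Y powr g x)" .
    then show ?thesis
      unfolding force_def Y_def[symmetric] using c0 \<Lambda> by (intro set_integral_bound(2)[OF _ _ b]) auto
  qed
  show ?thesis
  proof (intro exI[of _ "\<lambda>x. enn2real (Sbar x)"] conjI allI)
    show "(\<integral>\<^sup>+x. ennreal (enn2real (Sbar x)) \<partial>lborel) \<le> ennreal bump_mass"
      by (rule order_trans[OF nn_integral_mono[OF ennreal_enn2real_le] SbarA])
    show "AE x in lborel. norm (force f t x) \<le> 3 * \<Lambda> * (heat_const * smear_const) * max 1 (enn2real (Sbar x)) powr g x"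
      using Sfin by eventually_elim (use main in \<open>auto simp: c0_def\<close>)
  qed auto
qed

lemma norm_const_ge_1: "0 \<le> a \<Longrightarrow> 1 \<le> norm_const a"
  unfolding norm_const_def using c_pos bump_mass_nonneg mult_mono[of 1 "exp (4 * c)" 1 "1 + bump_mass + a"] by simp

text \<open>One scale for all times and all perturbations bounded by one: as
  \<open>max 1 (S1 x + S2 x) powr g x\<close> is at least 1, a bounded function obeys the same
  pointwise bound as the heat flow and the force, and the three add up.\<close>

lemma data_modular_bound:
  assumes f: "jointly_measurable f" and cf: "controlled 1 L f"
    and Lfin: "(\<integral>\<^sup>+s. ennreal (L s) * indicator {0<..<1} s \<partial>lborel) < \<infinity>"
    and v[measurable]: "v \<in> borel_measurable borel" and lv: "0 < lv" "(\<integral>\<^sup>+y. omega (q y) (norm (v y) / lv) \<partial>lborel) \<le> 1"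
  shows "\<exists>l\<ge>1. \<forall>t w. 0 < t \<longrightarrow> t < 1 \<longrightarrow> w \<in> borel_measurable borel \<longrightarrow> (\<forall>x. norm (w x) \<le> 1) \<longrightarrow>
      (\<integral>\<^sup>+x. omega (q x) (norm ((conv (heat_kernel \<alpha> t) v x + force f t x) + w x) / l) \<partial>lborel) \<le> 1"
proof -
  define \<Lambda> where "\<Lambda> = 1 + enn2real (\<integral>\<^sup>+s. ennreal (L s) * indicator {0<..<1} s \<partial>lborel)"
  have \<Lambda>: "0 < \<Lambda>" by (simp add: \<Lambda>_def add_pos_nonneg)
  have L\<Lambda>: "(\<integral>\<^sup>+s. ennreal (L s) * indicator {0<..<1} s \<partial>lborel) \<le> ennreal \<Lambda>"
    using Lfin unfolding \<Lambda>_def by (simp add: ennreal_plus add_increasing)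
  define B1 B2 where "B1 = lv * (heat_const * smear_const)" and "B2 = 3 * \<Lambda> * (heat_const * smear_const)"
  have B: "0 \<le> B1" "0 \<le> B2" using \<Lambda> lv heat_const(1) smear_const_nonneg by (auto simp: B1_def B2_def)
  define B where "B = B1 + B2 + 1"
  have B0: "1 \<le> B" using B by (simp add: B_def)
  have A2: "0 \<le> 2 * bump_mass" using bump_mass_nonneg by simp
  have "(\<integral>\<^sup>+x. omega (q x) (norm ((conv (heat_kernel \<alpha> t) v x + force f t x) + w x) / (norm_const (2 * bump_mass) * B)) \<partial>lborel) \<le> 1"
    if t: "0 < t" "t < 1" and w[measurable]: "w \<in> borel_measurable borel" and w1: "\<And>x. norm (w x) \<le> 1" for t w
  proof -
    obtain S2 where [measurable]: "S2 \<in> borel_measurable borel" and S2: "\<And>x. 0 \<le> S2 x"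
      "(\<integral>\<^sup>+x. ennreal (S2 x) \<partial>lborel) \<le> ennreal bump_mass" "AE x in lborel. norm (force f t x) \<le> B2 * max 1 (S2 x) powr g x"
      using force_bound[OF f cf L\<Lambda> \<Lambda> t] unfolding B2_def by blast
    define S1 where "S1 x = enn2real (smear t (\<lambda>y. norm (v y) / lv) x)" for x
    have [measurable]: "S1 \<in> borel_measurable borel" unfolding S1_def[abs_def] by measurable
    have S1: "0 \<le> S1 x" "norm (conv (heat_kernel \<alpha> t) v x) \<le> B1 * max 1 (S1 x) powr g x" for x
      unfolding S1_def smear_def B1_def using t lv by (auto intro!: heat_conv_estimates(3))
    have S1A: "(\<integral>\<^sup>+x. ennreal (S1 x) \<partial>lborel) \<le> ennreal bump_mass"
      unfolding S1_def using t lv(2)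
      by (intro order_trans[OF nn_integral_mono[OF ennreal_enn2real_le] nn_integral_smear]) auto
    have "(\<integral>\<^sup>+x. ennreal (S1 x + S2 x) \<partial>lborel) = (\<integral>\<^sup>+x. ennreal (S1 x) \<partial>lborel) + (\<integral>\<^sup>+x. ennreal (S2 x) \<partial>lborel)"
      using S1(1) S2(1) by (simp add: ennreal_plus nn_integral_add)
    also have "\<dots> \<le> ennreal bump_mass + ennreal bump_mass" by (intro add_mono S1A S2)
    also have "\<dots> = ennreal (2 * bump_mass)" using bump_mass_nonneg by (simp flip: ennreal_plus)
    finally have S12: "(\<integral>\<^sup>+x. ennreal (S1 x + S2 x) \<partial>lborel) \<le> ennreal (2 * bump_mass)" .
    show ?thesis
    proof (rule modular_le_of_powr_bound[OF _ _ S12 A2])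
      show "AE x in lborel. 0 \<le> norm ((conv (heat_kernel \<alpha> t) v x + force f t x) + w x) \<and>
          norm ((conv (heat_kernel \<alpha> t) v x + force f t x) + w x) \<le> B * max 1 (S1 x + S2 x) powr g x"
        using S2(3)
      proof eventually_elim
        case (elim x)
        let ?X = "max 1 (S1 x + S2 x) powr g x"
        have X: "1 \<le> ?X" using g_nonneg[of x] by (intro ge_one_powr_ge_zero) auto
        have "norm ((conv (heat_kernel \<alpha> t) v x + force f t x) + w x)
            \<le> norm (conv (heat_kernel \<alpha> t) v x) + norm (force f t x) + norm (w x)"
          by (intro order_trans[OF norm_triangle_ineq] add_right_mono norm_triangle_ineq)
        also have "\<dots> \<le> B1 * max 1 (S1 x) powr g x + B2 * max 1 (S2 x) powr g x + 1"
          by (intro add_mono S1(2) elim w1)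
        also have "\<dots> \<le> B1 * ?X + B2 * ?X + 1 * ?X"
          using B X S1(1)[of x] S2(1)[of x] g_nonneg[of x]
          by (intro add_mono mult_left_mono powr_mono2) auto
        finally show ?case by (simp add: B_def distrib_right)
      qed
    qed (use S1(1) S2(1) B0 in auto)
  qed
  moreover have "1 \<le> norm_const (2 * bump_mass) * B" using norm_const_ge_1[OF A2] B0 mult_mono[of 1 "norm_const (2 * bump_mass)" 1 B] by simp
  ultimately show ?thesis by (intro exI[of _ "norm_const (2 * bump_mass) * B"]) blast
qed

section \<open>Young's inequality in time and uniqueness\<close>

text \<open>Young's inequality for the dual exponents \<rho>/2 and \<rho>/(\<rho> - 2), without
  sharp constants: either a is below \<open>\<epsilon> * l powr (\<rho> - 2)\<close> and the first
  term suffices, or the square of l is bounded by a power of a / \<epsilon>.\<close>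

lemma young_square:
  fixes a l \<epsilon> :: real
  assumes "0 < a" "1 \<le> l" "0 < \<epsilon>"
  shows "l\<^sup>2 * a \<le> \<epsilon> * l powr \<rho> + \<epsilon> powr (- 2 / (\<rho> - 2)) * a powr (\<rho> / (\<rho> - 2))"
proof (cases "a \<le> \<epsilon> * l powr (\<rho> - 2)")
  case True
  have "l\<^sup>2 * a \<le> l\<^sup>2 * (\<epsilon> * l powr (\<rho> - 2))" using True by (intro mult_left_mono) auto
  also have "\<dots> = \<epsilon> * (l powr (\<rho> - 2) * l powr 2)" using assms by (simp add: powr_numeral)
  also have "l powr (\<rho> - 2) * l powr 2 = l powr \<rho>" by (subst powr_add[symmetric]) simp
  finally show ?thesis using assms by (simp add: add_increasing2)
next
  case False
  have "(\<rho> - 2) * (2 / (\<rho> - 2)) = 2" using \<rho> by (simp add: field_simps)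
  then have "l\<^sup>2 = (l powr (\<rho> - 2)) powr (2 / (\<rho> - 2))" using assms by (simp only: powr_powr) (simp add: powr_numeral)
  also have "\<dots> \<le> (a / \<epsilon>) powr (2 / (\<rho> - 2))"
    using False assms \<rho> by (intro powr_mono2) (auto simp: le_divide_eq mult.commute)
  also have "\<dots> = \<epsilon> powr (- 2 / (\<rho> - 2)) * a powr (2 / (\<rho> - 2))"
    using assms by (simp add: powr_divide powr_minus_divide)
  finally have "l\<^sup>2 * a \<le> \<epsilon> powr (- 2 / (\<rho> - 2)) * a powr (2 / (\<rho> - 2)) * a" using assms by (intro mult_right_mono) auto
  also have "a powr (2 / (\<rho> - 2)) * a = a powr (2 / (\<rho> - 2) + 1)" using assms by (simp add: powr_add)
  then have "\<epsilon> powr (- 2 / (\<rho> - 2)) * a powr (2 / (\<rho> - 2)) * a = \<epsilon> powr (- 2 / (\<rho> - 2)) * a powr (2 / (\<rho> - 2) + 1)"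
    by (simp only: mult.assoc)
  also have "2 / (\<rho> - 2) + 1 = \<rho> / (\<rho> - 2)" using \<rho> by (simp add: field_simps)
  finally show ?thesis using assms by (simp add: add_increasing)
qed

text \<open>The order of the singularity after the kernel is raised to the power dual to \<rho>/2;
  the condition \<open>\<gamma> < 1 - 2 / \<rho>\<close> is exactly that it is below 1.\<close>

definition \<gamma>' where "\<gamma>' = \<gamma> * (\<rho> / (\<rho> - 2))"

lemma \<gamma>'_less_1: "\<gamma>' < 1"
proof -
  have "\<gamma> * \<rho> < (1 - 2 / \<rho>) * \<rho>" using \<gamma>_less \<rho> by (intro mult_strict_right_mono) auto
  also have "\<dots> = \<rho> - 2" using \<rho> by (simp add: left_diff_distrib)
  finally show ?thesis using \<rho> by (simp add: \<gamma>'_def)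
qed

lemma singular_integral_le:
  assumes cu: "controlled T L u" and t: "0 \<le> t0" "t0 \<le> t" "t \<le> T" and \<epsilon>: "0 < \<epsilon>"
    and Lfin: "(\<integral>\<^sup>+s. ennreal (L s powr \<rho>) * indicator {0<..<T} s \<partial>lborel) \<le> ennreal M" and M: "0 \<le> M"
  shows "singular_integral L t0 t \<le> ennreal (\<epsilon> * M + \<epsilon> powr (- 2 / (\<rho> - 2)) * ((t - t0) powr (1 - \<gamma>') / (1 - \<gamma>')))"
proof -
  note [measurable] = controlledD(1)[OF cu]
  let ?c = "\<epsilon> powr (- 2 / (\<rho> - 2))"
  have "singular_integral L t0 t \<le> (\<integral>\<^sup>+s. ennreal \<epsilon> * (ennreal (L s powr \<rho>) * indicator {0<..<T} s)
      + ennreal ?c * (ennreal ((t - s) powr - \<gamma>') * indicator {t0<..<t} s) \<partial>lborel)"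
    unfolding singular_integral_def
  proof (rule nn_integral_mono_AE)
    show "AE s in lborel. ennreal ((L s)\<^sup>2 * (t - s) powr - \<gamma>) * indicator {t0<..<t} s \<le>
      ennreal \<epsilon> * (ennreal (L s powr \<rho>) * indicator {0<..<T} s) + ennreal ?c * (ennreal ((t - s) powr - \<gamma>') * indicator {t0<..<t} s)"
      using controlledD(2)[OF cu]
    proof eventually_elim
      case (elim s)
      show ?case
      proof (cases "s \<in> {t0<..<t}")
        case True
        then have s: "s \<in> {0<..<T}" "0 < t - s" using t by auto
        have "(L s)\<^sup>2 * (t - s) powr - \<gamma> \<le> \<epsilon> * L s powr \<rho> + ?c * ((t - s) powr - \<gamma>) powr (\<rho> / (\<rho> - 2))"
          using elim s \<epsilon> by (intro young_square) auto
        also have "((t - s) powr - \<gamma>) powr (\<rho> / (\<rho> - 2)) = (t - s) powr - \<gamma>'" by (simp add: powr_powr \<gamma>'_def)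
        finally have "ennreal ((L s)\<^sup>2 * (t - s) powr - \<gamma>) \<le> ennreal (\<epsilon> * L s powr \<rho> + ?c * (t - s) powr - \<gamma>')" by (rule ennreal_leI)
        also have "\<dots> = ennreal \<epsilon> * ennreal (L s powr \<rho>) + ennreal ?c * ennreal ((t - s) powr - \<gamma>')"
          using \<epsilon> by (simp add: ennreal_plus ennreal_mult)
        finally show ?thesis using True s by simp
      qed simp
    qed
  qed
  also have "\<dots> = ennreal \<epsilon> * (\<integral>\<^sup>+s. ennreal (L s powr \<rho>) * indicator {0<..<T} s \<partial>lborel)
      + ennreal ?c * (\<integral>\<^sup>+s. ennreal ((t - s) powr - \<gamma>') * indicator {t0<..<t} s \<partial>lborel)"
    by (subst nn_integral_add) (auto simp: nn_integral_cmult)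
  also have "\<dots> \<le> ennreal \<epsilon> * ennreal M + ennreal ?c * ennreal ((t - t0) powr (1 - \<gamma>') / (1 - \<gamma>'))"
    by (intro add_mono mult_left_mono Lfin nn_integral_powr_singular \<gamma>'_less_1 t) auto
  also have "\<dots> = ennreal (\<epsilon> * M + ?c * ((t - t0) powr (1 - \<gamma>') / (1 - \<gamma>')))"
  proof -
    have "0 \<le> (t - t0) powr (1 - \<gamma>') / (1 - \<gamma>')" "0 \<le> \<epsilon> * M" using \<gamma>'_less_1 \<epsilon> M by auto
    then show ?thesis using \<epsilon> M by (simp only: ennreal_plus ennreal_mult mult_nonneg_nonneg powr_ge_zero less_imp_le)
  qed
  finally show ?thesis .
qed

lemma singular_integral_bounded:
  assumes cu: "controlled T L u" and T: "T \<le> 1"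
    and Lfin: "(\<integral>\<^sup>+s. ennreal (L s powr \<rho>) * indicator {0<..<T} s \<partial>lborel) \<le> ennreal M" and M: "0 \<le> M"
  shows "\<exists>j\<ge>0. \<forall>t. 0 < t \<longrightarrow> t \<le> T \<longrightarrow> singular_integral L 0 t \<le> ennreal j"
proof (intro exI[of _ "M + 1 / (1 - \<gamma>')"] conjI allI impI)
  fix t assume t: "0 < t" "t \<le> T"
  have "singular_integral L 0 t \<le> ennreal (1 * M + 1 powr (- 2 / (\<rho> - 2)) * ((t - 0) powr (1 - \<gamma>') / (1 - \<gamma>')))"
    using t by (intro singular_integral_le[OF cu _ _ _ _ Lfin M]) auto
  also have "\<dots> \<le> ennreal (M + 1 / (1 - \<gamma>'))"
    using t T \<gamma>'_less_1 by (intro ennreal_leI) (auto intro!: divide_right_mono powr_le1)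
  finally show "singular_integral L 0 t \<le> ennreal (M + 1 / (1 - \<gamma>'))" .
qed (use M \<gamma>'_less_1 in auto)

text \<open>The part \<open>\<epsilon> * M\<close> does not shrink with the interval, so \<epsilon>
  is fixed to make it at most half of \<kappa> before \<delta> is chosen for the rest. Independence
  of \<delta> from t0 is what lets finitely many steps reach T.\<close>

lemma singular_integral_small:
  assumes cu: "controlled T L u" and T: "T \<le> 1" and \<kappa>: "0 < \<kappa>"
    and Lfin: "(\<integral>\<^sup>+s. ennreal (L s powr \<rho>) * indicator {0<..<T} s \<partial>lborel) \<le> ennreal M" and M: "0 \<le> M"
  shows "\<exists>\<delta>>0. \<forall>t0 t. 0 \<le> t0 \<longrightarrow> t0 \<le> t \<longrightarrow> t \<le> t0 + \<delta> \<longrightarrow> t \<le> T \<longrightarrow> singular_integral L t0 t \<le> ennreal \<kappa>"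
proof -
  define \<epsilon> where "\<epsilon> = \<kappa> / (2 * (M + 1))"
  have \<epsilon>: "0 < \<epsilon>" using \<kappa> M by (simp add: \<epsilon>_def)
  have \<epsilon>M: "\<epsilon> * M \<le> \<kappa> / 2"
  proof -
    have "\<epsilon> * M \<le> \<epsilon> * (M + 1)" using \<epsilon> by (intro mult_left_mono) auto
    also have "\<dots> = \<kappa> / 2" using M by (simp add: \<epsilon>_def field_simps)
    finally show ?thesis .
  qed
  define c0 where "c0 = \<epsilon> powr (- 2 / (\<rho> - 2)) / (1 - \<gamma>')"
  have c0: "0 < c0" using \<epsilon> \<gamma>'_less_1 by (simp add: c0_def)
  define \<delta> where "\<delta> = (\<kappa> / (2 * c0)) powr (1 / (1 - \<gamma>'))"
  have \<delta>: "0 < \<delta>" using \<kappa> c0 by (simp add: \<delta>_def)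
  have \<delta>\<gamma>: "\<delta> powr (1 - \<gamma>') = \<kappa> / (2 * c0)" using \<kappa> c0 \<gamma>'_less_1 by (simp add: \<delta>_def powr_powr)
  show ?thesis
  proof (intro exI[of _ \<delta>] conjI allI impI \<delta>)
    fix t0 t assume t: "0 \<le> t0" "t0 \<le> t" "t \<le> t0 + \<delta>" "t \<le> T"
    have "singular_integral L t0 t \<le> ennreal (\<epsilon> * M + \<epsilon> powr (- 2 / (\<rho> - 2)) * ((t - t0) powr (1 - \<gamma>') / (1 - \<gamma>')))"
      using t by (intro singular_integral_le[OF cu _ _ _ \<epsilon> Lfin M]) auto
    also have "\<dots> \<le> ennreal \<kappa>"
    proof (rule ennreal_leI)
      have "(t - t0) powr (1 - \<gamma>') \<le> \<kappa> / (2 * c0)" unfolding \<delta>\<gamma>[symmetric] using t \<gamma>'_less_1 by (intro powr_mono2) auto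
      then have "c0 * (t - t0) powr (1 - \<gamma>') \<le> c0 * (\<kappa> / (2 * c0))" using c0 by (intro mult_left_mono) auto
      also have "\<dots> = \<kappa> / 2" using c0 by simp
      finally have "c0 * (t - t0) powr (1 - \<gamma>') \<le> \<kappa> / 2" .
      moreover have "\<epsilon> powr (- 2 / (\<rho> - 2)) * ((t - t0) powr (1 - \<gamma>') / (1 - \<gamma>')) = c0 * (t - t0) powr (1 - \<gamma>')"
        by (simp add: c0_def)
      ultimately show "\<epsilon> * M + \<epsilon> powr (- 2 / (\<rho> - 2)) * ((t - t0) powr (1 - \<gamma>') / (1 - \<gamma>')) \<le> \<kappa>"
        using \<epsilon>M by linarith
    qed
    finally show "singular_integral L t0 t \<le> ennreal \<kappa>" .
  qed
qed

text \<open>Steps of length \<delta> exhaust the interval. Agreement at earlier times removes the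
  history, so within a step the bound of the difference can be halved indefinitely; the a priori
  bound N0 gives this a start.\<close>

lemma duhamel_unique:
  assumes u: "jointly_measurable u" and v: "jointly_measurable v"
    and cu: "controlled T L u" and cv: "controlled T L v" and T: "T \<le> 1"
    and Lfin: "(\<integral>\<^sup>+s. ennreal (L s powr \<rho>) * indicator {0<..<T} s \<partial>lborel) \<le> ennreal M" and M: "0 \<le> M"
    and eq: "AE t in lborel. t \<in> {0<..<T} \<longrightarrow> (AE x in lborel. norm (u t x - v t x) = norm (duhamel u t x - duhamel v t x))"
    and N0: "AE t in lborel. t \<in> {0<..<T} \<longrightarrow> (AE x in lborel. norm (u t x - v t x) \<le> N0)" "0 \<le> N0"
  shows "AE t in lborel. t \<in> {0<..<T} \<longrightarrow> (AE x in lborel. u t x = v t x)"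
proof -
  \<comment> \<open>With this value the factor in \<open>duhamel_diff_bound\<close> is at most
    1/2.\<close>
  define \<kappa> where "\<kappa> = 1 / (2 * (duhamel_const + 1))"
  have \<kappa>: "0 < \<kappa>" "duhamel_const * \<kappa> \<le> 1 / 2" using duhamel_const_nonneg by (auto simp: \<kappa>_def divide_le_eq)
  obtain \<delta> where \<delta>: "0 < \<delta>"
    "\<And>t0 t. 0 \<le> t0 \<Longrightarrow> t0 \<le> t \<Longrightarrow> t \<le> t0 + \<delta> \<Longrightarrow> t \<le> T \<Longrightarrow> singular_integral L t0 t \<le> ennreal \<kappa>"
    using singular_integral_small[OF cu T \<kappa>(1) Lfin M] by blast
  obtain j where j: "0 \<le> j" "\<And>t. 0 < t \<Longrightarrow> t \<le> T \<Longrightarrow> singular_integral L 0 t \<le> ennreal j"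
    using singular_integral_bounded[OF cu T Lfin M] by blast
  have Z: "AE t in lborel. t \<in> {0<..<T} \<and> t < real k * \<delta> \<longrightarrow> (AE x in lborel. u t x = v t x)" for k
  proof (induct k)
    case (Suc k)
    define t0 where "t0 = real k * \<delta>"
    have t0: "0 \<le> t0" using \<delta>(1) by (simp add: t0_def)
    have D: "AE t in lborel. t \<in> {0<..<T} \<and> t < t0 + \<delta> \<longrightarrow> (AE x in lborel. norm (u t x - v t x) \<le> N0 / 2 ^ n)" for n
    proof (induct n)
      case 0
      show ?case using N0(1) by eventually_elim auto
    next
      case IH: (Suc n)
      \<comment> \<open>The previous step gives agreement only for times below t0; the single time
        t0 is discarded.\<close>
      have ne: "AE t in lborel. t \<noteq> t0" by (rule AE_lborel_singleton)
      have N: "AE s in lborel. s \<in> {0<..<T} \<and> s < t0 + \<delta> \<longrightarrow>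
          (AE y in lborel. norm (u s y - v s y) \<le> (if t0 < s then N0 / 2 ^ n else 0))"
        using IH Suc ne by eventually_elim (auto simp: t0_def[symmetric])
      show ?case
        using eq Suc
      proof (eventually_elim, intro impI)
        fix t assume e: "t \<in> {0<..<T} \<longrightarrow> (AE x in lborel. norm (u t x - v t x) = norm (duhamel u t x - duhamel v t x))"
          and z: "t \<in> {0<..<T} \<and> t < real k * \<delta> \<longrightarrow> (AE x in lborel. u t x = v t x)"
          and t: "t \<in> {0<..<T} \<and> t < t0 + \<delta>"
        show "AE x in lborel. norm (u t x - v t x) \<le> N0 / 2 ^ Suc n"
        proof (cases "t < t0")
          case True
          then have "AE x in lborel. u t x = v t x" using z t by (simp add: t0_def)
          then show ?thesis by eventually_elim (use N0(2) in auto)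
        next
          case False
          have tT: "t \<le> T" "0 < t" "t \<le> 1" using t T by auto
          have "norm (duhamel u t x - duhamel v t x) \<le> N0 / 2 ^ n * duhamel_const * \<kappa>" for x
          proof (rule duhamel_diff_bound[OF u v controlled_mono[OF cu tT(1)] controlled_mono[OF cv tT(1)] tT(2,3) t0])
            show "singular_integral L 0 t < \<infinity>" using j(2)[OF tT(2,1)] by (auto intro: le_less_trans)
            show "singular_integral L t0 t \<le> ennreal \<kappa>" using False t t0 by (intro \<delta>(2)) auto
            show "AE s in lborel. s \<in> {0<..<t} \<longrightarrow> (AE y in lborel. norm (u s y - v s y) \<le> (if t0 < s then N0 / 2 ^ n else 0))"
              using N by eventually_elim (use t in auto)
          qed (use \<kappa> N0(2) in auto)
          moreover have "N0 / 2 ^ n * duhamel_const * \<kappa> \<le> N0 / 2 ^ n * (1 / 2)"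
            unfolding mult.assoc using \<kappa>(2) N0(2) by (intro mult_left_mono) auto
          ultimately have "norm (duhamel u t x - duhamel v t x) \<le> N0 / 2 ^ Suc n" for x
            by (rule order_trans[THEN order_trans]) simp
          then show ?thesis using e t by (auto elim!: eventually_mono)
        qed
      qed
    qed
    \<comment> \<open>As there are countably many n, one null set of times, and below one null set
      of points, serves all of them.\<close>
    have "AE t in lborel. \<forall>n. t \<in> {0<..<T} \<and> t < t0 + \<delta> \<longrightarrow> (AE x in lborel. norm (u t x - v t x) \<le> N0 / 2 ^ n)"
      using D unfolding AE_all_countable by blast
    then show ?case
    proof (eventually_elim, intro impI)
      fix t assume *: "\<forall>n. t \<in> {0<..<T} \<and> t < t0 + \<delta> \<longrightarrow> (AE x in lborel. norm (u t x - v t x) \<le> N0 / 2 ^ n)"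
        and t: "t \<in> {0<..<T} \<and> t < real (Suc k) * \<delta>"
      have "AE x in lborel. \<forall>n. norm (u t x - v t x) \<le> N0 / 2 ^ n"
        using * t by (subst AE_all_countable) (auto simp: t0_def algebra_simps)
      then show "AE x in lborel. u t x = v t x"
      proof eventually_elim
        case (elim x)
        have "(\<lambda>n. N0 * (1 / 2) ^ n) \<longlonglongrightarrow> N0 * 0" by (intro tendsto_mult tendsto_const LIMSEQ_power_zero) simp
        then have "norm (u t x - v t x) \<le> N0 * 0"
          by (rule LIMSEQ_le_const) (use elim in \<open>auto simp: power_divide\<close>)
        then show ?case by simp
      qed
    qed
  qed (auto intro!: AE_I2)
  obtain k :: nat where k: "T < real k * \<delta>" using reals_Archimedean3[OF \<delta>(1)] by blast
  show ?thesis using Z[of k] by eventually_elim (use k in auto)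
qed

end

section \<open>Passage to Borel representatives\<close>

lemma AE_lebesgue_on_iff:
  fixes S :: "'a::euclidean_space set"
  assumes "S \<in> sets borel"
  shows "(AE x in lebesgue_on S. P x) \<longleftrightarrow> (AE x in lborel. x \<in> S \<longrightarrow> P x)"
  using assms by (subst AE_restrict_space_iff) (auto simp: AE_completion_iff)

lemma AE_lborel_fst:
  assumes "AE t in (lborel :: real measure). P t"
  shows "AE z in (lborel :: (real \<times> (real^3)) measure). P (fst z)"
proof -
  obtain N where N: "\<And>t. t \<in> space lborel - N \<Longrightarrow> P t" "N \<in> null_sets lborel"
    by (rule AE_E3[OF assms]) (rule that)
  have [measurable]: "N \<in> sets borel" using N by (auto simp: null_sets_def)
  have "AE z in (lborel \<Otimes>\<^sub>M lborel :: (real \<times> (real^3)) measure). fst z \<notin> N"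
  proof (rule lborel_pair.AE_pair_measure)
    have "AE t in lborel. t \<notin> N" by (rule AE_not_in[OF N(2)])
    then show "AE t in lborel. AE x in (lborel :: (real^3) measure). fst (t, x) \<notin> N" by eventually_elim simp
  qed measurable
  then have "AE z in (lborel :: (real \<times> (real^3)) measure). fst z \<notin> N" unfolding lborel_prod .
  then show ?thesis by eventually_elim (use N in auto)
qed

lemma borel_representative:
  fixes F :: "'a::euclidean_space \<Rightarrow> real^3"
  assumes "F \<in> borel_measurable lebesgue"
  shows "\<exists>G\<in>borel_measurable borel. AE z in lborel. F z = G z"
proof -
  have "\<exists>g\<in>borel_measurable lborel. AE z in lborel. F z $ i = g z" for i
    by (rule completion_ex_borel_measurable_real) (use measurable_compose[OF assms borel_measurable_vec_nth] in simp)
  then obtain g where g: "\<And>i. g i \<in> borel_measurable lborel" "\<And>i. AE z in lborel. F z $ i = g i z" by metis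
  have "AE z in lborel. \<forall>i. F z $ i = g i z" by (simp add: AE_all_countable g(2))
  moreover have "(\<lambda>z. \<chi> i. g i z) \<in> borel_measurable borel"
    by (rule borel_measurable_vecI) (use g(1) in simp)
  ultimately show ?thesis by (intro bexI[of _ "\<lambda>z. \<chi> i. g i z"]) (auto simp: vec_eq_iff)
qed

text \<open>Agreement is recorded in two forms: slicewise for the convolutions, which integrate over
  a whole slice, and jointly for the equation, which holds at almost every point of
  space-time.\<close>

lemma jointly_measurable_representative:
  fixes f :: "real \<Rightarrow> real^3 \<Rightarrow> real^3"
  assumes f: "(\<lambda>(t, x). f t x) \<in> borel_measurable (lebesgue_on (S \<times> UNIV))" and S: "S \<in> sets borel"
  obtains f' where "jointly_measurable f'" "AE z in lborel. fst z \<in> S \<longrightarrow> f (fst z) (snd z) = f' (fst z) (snd z)"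
    "AE t in lborel. t \<in> S \<longrightarrow> (AE x in lborel. f t x = f' t x)"
proof -
  have "S \<times> (UNIV :: (real^3) set) \<in> sets (borel \<Otimes>\<^sub>M borel)" using S by simp
  then have S': "S \<times> (UNIV :: (real^3) set) \<in> sets borel" by (simp only: borel_prod)
  then have "S \<times> (UNIV :: (real^3) set) \<in> sets lebesgue" by simp
  \<comment> \<open>Extension by zero turns measurability on the slab into measurability on the
    whole space.\<close>
  then have "(\<lambda>z. if z \<in> S \<times> UNIV then (\<lambda>(t, x). f t x) z else 0) \<in> borel_measurable lebesgue"
    using f by (simp add: borel_measurable_if)
  from borel_representative[OF this] obtain G where G: "G \<in> borel_measurable borel"
    "AE z in lborel. (if z \<in> S \<times> UNIV then (\<lambda>(t, x). f t x) z else 0) = G z" by blast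
  define f' where "f' t x = G (t, x)" for t x
  have jm: "jointly_measurable f'" using G(1) by (simp add: f'_def borel_prod)
  have j: "AE z in lborel. fst z \<in> S \<longrightarrow> f (fst z) (snd z) = f' (fst z) (snd z)"
    using G(2) by eventually_elim (auto simp: f'_def split: if_splits)
  have "AE t in lborel. AE x in lborel. fst (t, x) \<in> S \<longrightarrow> f (fst (t, x)) (snd (t, x)) = f' (fst (t, x)) (snd (t, x))"
    by (rule lborel_pair.AE_pair) (use j in \<open>simp only: lborel_prod\<close>)
  then have "AE t in lborel. t \<in> S \<longrightarrow> (AE x in lborel. f t x = f' t x)"
    by eventually_elim auto
  with jm j show ?thesis by (rule that)
qed

lemma conv_cong_AE:
  fixes v v' :: "real^3 \<Rightarrow> 'b::euclidean_space"
  assumes "v' \<in> borel_measurable borel" "AE y in lborel. v y = v' y" and [measurable]: "K \<in> borel_measurable borel"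
  shows "conv_exists K v x \<longleftrightarrow> conv_exists K v' x" "conv K v x = conv K v' x"
proof -
  have v': "v' \<in> borel_measurable lebesgue" using assms(1) by (intro measurable_completion) simp
  have ae: "AE y in lebesgue. v' y = v y" using assms(2) by (auto simp: AE_completion_iff eq_commute)
  have v: "v \<in> borel_measurable lebesgue" by (rule borel_measurable_AE[OF v' ae])
  have K: "(\<lambda>y. K (x - y)) \<in> borel_measurable lebesgue" by (rule measurable_completion) measurable
  have m: "(\<lambda>y. K (x - y) *\<^sub>R v y) \<in> borel_measurable lebesgue" "(\<lambda>y. K (x - y) *\<^sub>R v' y) \<in> borel_measurable lebesgue"
    using K v v' by auto
  have e: "AE y in lebesgue. K (x - y) *\<^sub>R v y = K (x - y) *\<^sub>R v' y" using ae by eventually_elim simp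
  show "conv_exists K v x \<longleftrightarrow> conv_exists K v' x" unfolding conv_exists_def by (rule integrable_cong_AE[OF m e])
  show "conv K v x = conv K v' x" unfolding conv_def by (rule integral_cong_AE[OF m e])
qed

lemma oseen_conv_cong_AE:
  assumes v': "v' \<in> borel_measurable borel" and ae: "AE y in lborel. v y = v' y"
  shows "oseen_conv_exists \<alpha> t (tensor_square v) x \<longleftrightarrow> oseen_conv_exists \<alpha> t (tensor_square v') x"
    "oseen_conv \<alpha> t (tensor_square v) x = oseen_conv \<alpha> t (tensor_square v') x"
proof -
  have "AE y in lborel. tensor_square v y $ h $ k = tensor_square v' y $ h $ k" for h k
    using ae by eventually_elim (simp add: tensor_square_def)
  note c = conv_cong_AE[OF borel_measurable_tensor_square[OF v'] this]
  show "oseen_conv_exists \<alpha> t (tensor_square v) x \<longleftrightarrow> oseen_conv_exists \<alpha> t (tensor_square v') x"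
    unfolding oseen_conv_exists_def by (subst c(1)) auto
  show "oseen_conv \<alpha> t (tensor_square v) x = oseen_conv \<alpha> t (tensor_square v') x"
    unfolding oseen_conv_def by (subst c(2)) auto
qed

lemma set_integral_cong_AE:
  fixes f h :: "real \<Rightarrow> real^3"
  assumes [measurable]: "h \<in> borel_measurable borel" and ae: "AE s in lborel. s \<in> {0<..<t} \<longrightarrow> f s = h s"
  shows "set_integrable lebesgue {0<..<t} f \<longleftrightarrow> set_integrable lebesgue {0<..<t} h"
    "(LINT s:{0<..<t}|lebesgue. f s) = (LINT s:{0<..<t}|lebesgue. h s)"
proof -
  have m: "(\<lambda>s. indicator {0<..<t} s *\<^sub>R h s) \<in> borel_measurable lebesgue"
    by (rule measurable_completion) measurable
  have e: "AE s in lebesgue. indicator {0<..<t} s *\<^sub>R h s = indicator {0<..<t} s *\<^sub>R f s"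
    using ae unfolding AE_completion_iff by eventually_elim (auto simp: indicator_def)
  note m' = borel_measurable_AE[OF m e]
  show "set_integrable lebesgue {0<..<t} f \<longleftrightarrow> set_integrable lebesgue {0<..<t} h"
    unfolding set_integrable_def by (rule integrable_cong_AE[OF m m' e, symmetric])
  show "(LINT s:{0<..<t}|lebesgue. f s) = (LINT s:{0<..<t}|lebesgue. h s)"
    unfolding set_lebesgue_integral_def by (rule integral_cong_AE[OF m m' e, symmetric])
qed

section \<open>Integrability of the norm in time\<close>

text \<open>On a bounded interval the variable space embeds into the one with constant exponent
  \<rho> below P: a \<rho>-th power is at most one or at most the modular density. The added 1
  matches the control functions, which are multiples of one plus the norm.\<close>

lemma powr_integral_of_Lvar:
  fixes n :: "real \<Rightarrow> real"
  assumes n: "n \<in> Lvar (lebesgue_on {0<..<T}) P" and P: "P \<in> borel_measurable (lebesgue_on {0<..<T})"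
    and \<rho>P: "AE t in lborel. t \<in> {0<..<T} \<longrightarrow> ennreal \<rho> \<le> P t" and \<rho>: "1 \<le> \<rho>" and T: "0 < T"
  shows "(\<integral>\<^sup>+t. ennreal ((1 + \<bar>n t\<bar>) powr \<rho>) * indicator {0<..<T} t \<partial>lborel) < \<infinity>"
proof -
  let ?M = "lebesgue_on {0<..<T}"
  have sp: "{0<..<T} \<inter> space lebesgue \<in> sets lebesgue" by simp
  obtain l where l: "0 < l" "modular ?M P (\<lambda>t. l *\<^sub>R n t) < \<infinity>" and nm: "n \<in> borel_measurable ?M"
    using n by (auto simp: Lvar_def)
  note [measurable] = nm P
  let ?\<omega> = "\<lambda>t. omega (P t) (norm (l *\<^sub>R n t))"
  have [measurable]: "?\<omega> \<in> borel_measurable ?M" unfolding omega_def by measurable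
  have \<omega>: "(\<integral>\<^sup>+t. ?\<omega> t \<partial>?M) < \<infinity>" using l(2) by (simp add: modular_def)
  define K where "K = 2 powr \<rho>"
  have K: "0 \<le> K" by (simp add: K_def)
  have pw: "ennreal ((1 + \<bar>n t\<bar>) powr \<rho>) \<le> ennreal K + ennreal (K * l powr - \<rho>) * (1 + ?\<omega> t)" if r: "ennreal \<rho> \<le> P t" for t
  proof -
    have "(l * \<bar>n t\<bar>) powr \<rho> \<le> 1 \<or> ennreal ((l * \<bar>n t\<bar>) powr \<rho>) \<le> ?\<omega> t"
    proof (cases "l * \<bar>n t\<bar> \<le> 1")
      case True
      then show ?thesis using l \<rho> by (intro disjI1 powr_le1) auto
    next
      case False
      show ?thesis
      proof (cases "P t")
        case (real a)
        have "\<rho> \<le> a" using r real \<rho> by simp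
        then have "(l * \<bar>n t\<bar>) powr \<rho> \<le> (l * \<bar>n t\<bar>) powr a" using False by (intro powr_mono) auto
        then show ?thesis using real l by (auto simp: omega_def abs_mult intro!: ennreal_leI)
      qed (use False l in \<open>auto simp: omega_def abs_mult\<close>)
    qed
    then have lp: "ennreal ((l * \<bar>n t\<bar>) powr \<rho>) \<le> 1 + ?\<omega> t"
    proof
      assume "(l * \<bar>n t\<bar>) powr \<rho> \<le> 1"
      then have "ennreal ((l * \<bar>n t\<bar>) powr \<rho>) \<le> 1" by (simp add: ennreal_le_1)
      then show ?thesis by (simp add: add_increasing2)
    qed (simp add: add_increasing)
    have "(1 + \<bar>n t\<bar>) powr \<rho> \<le> (2 * max 1 \<bar>n t\<bar>) powr \<rho>" using \<rho> by (intro powr_mono2) auto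
    also have "\<dots> = K * max 1 \<bar>n t\<bar> powr \<rho>" by (simp add: K_def powr_mult)
    also have "max 1 \<bar>n t\<bar> powr \<rho> \<le> 1 + \<bar>n t\<bar> powr \<rho>" by (auto simp: max_def)
    also have "\<bar>n t\<bar> powr \<rho> = l powr - \<rho> * (l * \<bar>n t\<bar>) powr \<rho>"
      using l by (simp add: powr_mult powr_minus)
    finally have "(1 + \<bar>n t\<bar>) powr \<rho> \<le> K + K * l powr - \<rho> * (l * \<bar>n t\<bar>) powr \<rho>"
      using K by (simp add: algebra_simps mult_left_mono mult_right_mono)
    then have "ennreal ((1 + \<bar>n t\<bar>) powr \<rho>) \<le> ennreal (K + K * l powr - \<rho> * (l * \<bar>n t\<bar>) powr \<rho>)" by (rule ennreal_leI)
    also have "\<dots> = ennreal K + ennreal (K * l powr - \<rho>) * ennreal ((l * \<bar>n t\<bar>) powr \<rho>)"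
      using K by (simp add: ennreal_plus ennreal_mult)
    also have "\<dots> \<le> ennreal K + ennreal (K * l powr - \<rho>) * (1 + ?\<omega> t)" by (intro add_left_mono mult_left_mono lp) auto
    finally show ?thesis .
  qed
  have "(\<integral>\<^sup>+t. ennreal ((1 + \<bar>n t\<bar>) powr \<rho>) * indicator {0<..<T} t \<partial>lborel)
     = (\<integral>\<^sup>+t. ennreal ((1 + \<bar>n t\<bar>) powr \<rho>) \<partial>?M)"
    using sp by (simp add: nn_integral_restrict_space nn_integral_completion)
  also have "\<dots> \<le> (\<integral>\<^sup>+t. ennreal K + ennreal (K * l powr - \<rho>) * (1 + ?\<omega> t) \<partial>?M)"
  proof (rule nn_integral_mono_AE)
    have "AE t in ?M. ennreal \<rho> \<le> P t" using \<rho>P by (subst AE_lebesgue_on_iff) auto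
    then show "AE t in ?M. ennreal ((1 + \<bar>n t\<bar>) powr \<rho>) \<le> ennreal K + ennreal (K * l powr - \<rho>) * (1 + ?\<omega> t)"
      by eventually_elim (rule pw)
  qed
  also have "\<dots> = (\<integral>\<^sup>+t. ennreal K \<partial>?M) + (\<integral>\<^sup>+t. ennreal (K * l powr - \<rho>) * (1 + ?\<omega> t) \<partial>?M)"
    by (rule nn_integral_add) measurable
  also have "(\<integral>\<^sup>+t. ennreal (K * l powr - \<rho>) * (1 + ?\<omega> t) \<partial>?M) = ennreal (K * l powr - \<rho>) * (\<integral>\<^sup>+t. 1 + ?\<omega> t \<partial>?M)"
    by (rule nn_integral_cmult) measurable
  also have "(\<integral>\<^sup>+t. 1 + ?\<omega> t \<partial>?M) = (\<integral>\<^sup>+t. 1 \<partial>?M) + (\<integral>\<^sup>+t. ?\<omega> t \<partial>?M)"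
    by (rule nn_integral_add) measurable
  also have "(\<integral>\<^sup>+t. ennreal K \<partial>?M) + ennreal (K * l powr - \<rho>) * \<dots> < \<infinity>"
  proof -
    have e: "emeasure ?M {0<..<T} = ennreal T" using T by (subst emeasure_restrict_space) auto
    have "(\<integral>\<^sup>+t. c \<partial>?M) = c * ennreal T" for c
      using e by (simp only: nn_integral_const space_restrict_space) simp
    then show ?thesis using \<omega> by (simp only:) (simp add: ennreal_mult_less_top)
  qed
  finally show ?thesis .
qed

context log_exp
begin

lemma Lvar_cong_AE:
  assumes ae: "AE y in lborel. v y = v' y"
  shows "Lvar_norm lebesgue q v = Lvar_norm lebesgue q v'"
    and "v' \<in> borel_measurable lebesgue \<Longrightarrow> v \<in> Lvar lebesgue q \<Longrightarrow> v' \<in> Lvar lebesgue q"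
proof -
  have m: "(\<integral>\<^sup>+x. omega (q x) (norm (v x) / l) \<partial>lborel) = (\<integral>\<^sup>+x. omega (q x) (norm (v' x) / l) \<partial>lborel)" for l
    by (rule nn_integral_cong_AE) (use ae in \<open>eventually_elim, simp\<close>)
  then show "Lvar_norm lebesgue q v = Lvar_norm lebesgue q v'" unfolding Lvar_norm_def modular_eq by simp
  show "v' \<in> Lvar lebesgue q" if v': "v' \<in> borel_measurable lebesgue" and v: "v \<in> Lvar lebesgue q"
  proof -
    obtain l where l: "0 < l" "(\<integral>\<^sup>+x. omega (q x) (norm (v x) / l) \<partial>lborel) \<le> 1"
      using Lvar_modular_le_1[OF v] by blast
    show ?thesis by (rule LvarI[OF l(1) l(2)[unfolded m] v'])
  qed
qed

text \<open>The summand 1 creates the strict inequality that \<open>Lvar_norm_lessD\<close> asks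
  for.\<close>

lemma Lvar_slice_modular:
  assumes "jointly_measurable f'" "f s \<in> Lvar lebesgue q" "AE y in lborel. f s y = f' s y" "1 + Lvar_norm lebesgue q (f' s) \<le> l"
  shows "(\<integral>\<^sup>+y. omega (q y) (norm (f' s y) / l) \<partial>lborel) \<le> 1" "0 \<le> Lvar_norm lebesgue q (f' s)"
proof -
  have "f' s \<in> borel_measurable lebesgue"
    using jointly_measurable_slice[OF assms(1), of s] by (intro measurable_completion) simp
  then have f': "f' s \<in> Lvar lebesgue q" using Lvar_cong_AE(2)[OF assms(3)] assms(2) by simp
  show "(\<integral>\<^sup>+y. omega (q y) (norm (f' s y) / l) \<partial>lborel) \<le> 1" using assms(4) by (intro Lvar_norm_lessD[OF f']) simp
  show "0 \<le> Lvar_norm lebesgue q (f' s)" by (rule Lvar_norm_nonneg[OF f'])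
qed

end

context ns
begin

definition data :: "(real^3 \<Rightarrow> real^3) \<Rightarrow> (real \<Rightarrow> real^3 \<Rightarrow> real^3) \<Rightarrow> real \<Rightarrow> real^3 \<Rightarrow> real^3" where
  "data v f t x = conv (heat_kernel \<alpha> t) v x + force f t x"

lemma jointly_measurable_data:
  assumes [measurable]: "v \<in> borel_measurable borel" and f: "jointly_measurable f"
  shows "jointly_measurable (data v f)"
proof -
  have v: "jointly_measurable (\<lambda>_. v)" by measurable
  have [measurable]: "jointly_measurable (\<lambda>t x. conv (heat_kernel \<alpha> t) v x)"
    unfolding case_prod_unfold by (rule borel_measurable_heat_conv[OF v, where s = "\<lambda>_. 0"]) measurable
  note [measurable] = jointly_measurable_force[OF f]
  show ?thesis unfolding data_def by measurable
qed

text \<open>Serves the force with exponent 1 and an arbitrary solution with exponent p. The factor l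
  makes the control dominate the constant scale of the constructed solution as well, so that both
  solutions share one L.\<close>

lemma controlled_of_Lvar:
  assumes f': "jointly_measurable f'" and T: "0 < T"
    and f: "AE s in lborel. s \<in> {0<..<T} \<longrightarrow> f s \<in> Lvar lebesgue q"
    and ff': "AE s in lborel. s \<in> {0<..<T} \<longrightarrow> (AE y in lborel. f s y = f' s y)"
    and n: "(\<lambda>s. Lvar_norm lebesgue q (f s)) \<in> Lvar (lebesgue_on {0<..<T}) P"
    and P: "P \<in> borel_measurable (lebesgue_on {0<..<T})"
    and \<sigma>P: "AE t in lborel. t \<in> {0<..<T} \<longrightarrow> ennreal \<sigma> \<le> P t" and \<sigma>: "1 \<le> \<sigma>" and l: "1 \<le> l"
  defines "L \<equiv> \<lambda>s. l * (1 + Lvar_norm lebesgue q (f' s))"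
  shows "controlled T L f'" "(\<integral>\<^sup>+s. ennreal (L s powr \<sigma>) * indicator {0<..<T} s \<partial>lborel) < \<infinity>"
    "AE s in lborel. s \<in> {0<..<T} \<longrightarrow> l \<le> L s"
proof -
  note [measurable] = borel_measurable_Lvar_norm[OF f']
  have [measurable]: "L \<in> borel_measurable borel" unfolding L_def by measurable
  have pos: "AE s in lborel. s \<in> {0<..<T} \<longrightarrow> 0 \<le> Lvar_norm lebesgue q (f' s)"
    using f ff' by eventually_elim (use Lvar_slice_modular(2)[OF f'] in blast)
  then show lL: "AE s in lborel. s \<in> {0<..<T} \<longrightarrow> l \<le> L s"
  proof eventually_elim
    case (elim s)
    show ?case
    proof
      assume "s \<in> {0<..<T}"
      then have "l * 1 \<le> l * (1 + Lvar_norm lebesgue q (f' s))" using elim l by (intro mult_left_mono) auto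
      then show "l \<le> L s" by (simp add: L_def)
    qed
  qed
  have "AE s in lborel. s \<in> {0<..<T} \<longrightarrow> 1 \<le> L s \<and> (\<integral>\<^sup>+y. omega (q y) (norm (f' s y) / L s) \<partial>lborel) \<le> 1"
    using f ff' pos lL
  proof eventually_elim
    case (elim s)
    show ?case
    proof
      assume s: "s \<in> {0<..<T}"
      have "1 * (1 + Lvar_norm lebesgue q (f' s)) \<le> L s"
        unfolding L_def using elim s l by (intro mult_right_mono) auto
      then have "(\<integral>\<^sup>+y. omega (q y) (norm (f' s y) / L s) \<partial>lborel) \<le> 1"
        using elim s by (intro Lvar_slice_modular(1)[OF f', of f]) auto
      then show "1 \<le> L s \<and> (\<integral>\<^sup>+y. omega (q y) (norm (f' s y) / L s) \<partial>lborel) \<le> 1"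
        using elim s l by auto
    qed
  qed
  then show "controlled T L f'" by (simp add: controlled_def)
  let ?n = "\<lambda>s. Lvar_norm lebesgue q (f s)"
  have "(\<integral>\<^sup>+s. ennreal (L s powr \<sigma>) * indicator {0<..<T} s \<partial>lborel)
     = (\<integral>\<^sup>+s. ennreal (L s powr \<sigma>) * indicator {0<..<T} s \<partial>lebesgue)" by (simp add: nn_integral_completion)
  also have "\<dots> = (\<integral>\<^sup>+s. ennreal (l powr \<sigma>) * (ennreal ((1 + \<bar>Lvar_norm lebesgue q (f' s)\<bar>) powr \<sigma>) * indicator {0<..<T} s) \<partial>lborel)"
    unfolding nn_integral_completion
  proof (rule nn_integral_cong_AE)
    show "AE s in lborel. ennreal (L s powr \<sigma>) * indicator {0<..<T} s =
       ennreal (l powr \<sigma>) * (ennreal ((1 + \<bar>Lvar_norm lebesgue q (f' s)\<bar>) powr \<sigma>) * indicator {0<..<T} s)"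
      using pos
    proof eventually_elim
      case (elim s)
      then show ?case
        using l by (cases "s \<in> {0<..<T}") (simp_all add: L_def powr_mult ennreal_mult del: greaterThanLessThan_iff)
    qed
  qed
  also have "\<dots> = ennreal (l powr \<sigma>) * (\<integral>\<^sup>+s. (ennreal ((1 + \<bar>Lvar_norm lebesgue q (f' s)\<bar>) powr \<sigma>) * indicator {0<..<T} s) \<partial>lborel)"
    by (rule nn_integral_cmult) measurable
  also have "(\<integral>\<^sup>+s. (ennreal ((1 + \<bar>Lvar_norm lebesgue q (f' s)\<bar>) powr \<sigma>) * indicator {0<..<T} s) \<partial>lborel)
     = (\<integral>\<^sup>+s. (ennreal ((1 + \<bar>?n s\<bar>) powr \<sigma>) * indicator {0<..<T} s) \<partial>lborel)"
  proof (rule nn_integral_cong_AE)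
    show "AE s in lborel. ennreal ((1 + \<bar>Lvar_norm lebesgue q (f' s)\<bar>) powr \<sigma>) * indicator {0<..<T} s =
        ennreal ((1 + \<bar>?n s\<bar>) powr \<sigma>) * indicator {0<..<T} s"
      using ff' by eventually_elim (auto simp: indicator_def Lvar_cong_AE(1))
  qed
  also have "ennreal (l powr \<sigma>) * \<dots> < \<infinity>"
    using powr_integral_of_Lvar[OF n P \<sigma>P \<sigma> T] by (simp add: ennreal_mult_less_top)
  finally show "(\<integral>\<^sup>+s. ennreal (L s powr \<sigma>) * indicator {0<..<T} s \<partial>lborel) < \<infinity>" .
qed

section \<open>Mild solutions\<close>

text \<open>Only the existence of the integrals: these conditions are insensitive to changes of the
  slices on null sets, whereas the equation contains the value \<open>u t x\<close> itself.\<close>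

definition mild_at ::
  "(real^3 \<Rightarrow> real^3) \<Rightarrow> (real \<Rightarrow> real^3 \<Rightarrow> real^3) \<Rightarrow> (real \<Rightarrow> real^3 \<Rightarrow> real^3) \<Rightarrow> real \<Rightarrow> real^3 \<Rightarrow> bool"
  where
  "mild_at v f u t x \<longleftrightarrow>
     conv_exists (heat_kernel \<alpha> t) v x \<and>
     (AE s in lborel. s \<in> {0<..<t} \<longrightarrow> conv_exists (heat_kernel \<alpha> (t - s)) (f s) x) \<and>
     set_integrable lebesgue {0<..<t} (\<lambda>s. conv (heat_kernel \<alpha> (t - s)) (f s) x) \<and>
     (AE s in lborel. s \<in> {0<..<t} \<longrightarrow> oseen_conv_exists \<alpha> (t - s) (tensor_square (u s)) x) \<and>
     set_integrable lebesgue {0<..<t} (\<lambda>s. oseen_conv \<alpha> (t - s) (tensor_square (u s)) x)"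

lemma slab_in_borel: "{0<..<T::real} \<times> (UNIV :: (real^3) set) \<in> sets borel"
proof -
  have "{0<..<T} \<times> (UNIV :: (real^3) set) \<in> sets (borel \<Otimes>\<^sub>M borel)" by simp
  then show ?thesis by (simp only: borel_prod)
qed

lemma mild_solution_iff:
  "mild_solution \<alpha> v f T u \<longleftrightarrow> (AE z in lborel. fst z \<in> {0<..<T} \<longrightarrow>
     mild_at v f u (fst z) (snd z) \<and> u (fst z) (snd z) = data v f (fst z) (snd z) - duhamel u (fst z) (snd z))"
proof -
  have AE: "(AE s in lebesgue_on {0<..<t}. Q s) \<longleftrightarrow> (AE s in lborel. s \<in> {0<..<t} \<longrightarrow> Q s)" for t :: real and Q
    by (rule AE_lebesgue_on_iff) simp
  show ?thesis
    unfolding mild_solution_def AE_lebesgue_on_iff[OF slab_in_borel] mild_at_def data_def force_def duhamel_def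
    by (simp only: split_beta mem_Times_iff UNIV_I simp_thms AE conj_assoc)
qed

text \<open>All three expressions see f and u only through time integrals of space integrals, so
  slicewise agreement gives equality at every point x and every time of the interval.\<close>

lemma mild_at_cong_AE:
  assumes v': "v' \<in> borel_measurable borel" "AE y in lborel. v y = v' y"
    and f': "jointly_measurable f'" "AE s in lborel. s \<in> {0<..<1} \<longrightarrow> (AE y in lborel. f s y = f' s y)"
    and u': "jointly_measurable u'" "AE s in lborel. s \<in> {0<..<T} \<longrightarrow> (AE y in lborel. u s y = u' s y)"
    and T: "T \<le> 1" and t: "t \<in> {0<..<T}"
  shows "mild_at v f u t x \<longleftrightarrow> mild_at v' f' u' t x" "data v f t x = data v' f' t x" "duhamel u t x = duhamel u' t x"
proof -
  have [measurable]: "heat_kernel \<alpha> t \<in> borel_measurable borel" for t by measurable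
  note [measurable] = borel_measurable_heat_conv[OF f'(1)] borel_measurable_oseen_conv[OF u'(1)]
  have cf: "AE s in lborel. s \<in> {0<..<t} \<longrightarrow> (conv_exists (heat_kernel \<alpha> (t - s)) (f s) x \<longleftrightarrow> conv_exists (heat_kernel \<alpha> (t - s)) (f' s) x) \<and>
      conv (heat_kernel \<alpha> (t - s)) (f s) x = conv (heat_kernel \<alpha> (t - s)) (f' s) x"
    using f'(2)
  proof eventually_elim
    case (elim s)
    then show ?case using t T conv_cong_AE[OF jointly_measurable_slice[OF f'(1)], of "f s" s "heat_kernel \<alpha> (t - s)" x] by auto
  qed
  have cu: "AE s in lborel. s \<in> {0<..<t} \<longrightarrow> (oseen_conv_exists \<alpha> (t - s) (tensor_square (u s)) x \<longleftrightarrow> oseen_conv_exists \<alpha> (t - s) (tensor_square (u' s)) x) \<and>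
      oseen_conv \<alpha> (t - s) (tensor_square (u s)) x = oseen_conv \<alpha> (t - s) (tensor_square (u' s)) x"
    using u'(2)
  proof eventually_elim
    case (elim s)
    then show ?case using t T oseen_conv_cong_AE[OF jointly_measurable_slice[OF u'(1)], of "u s" s \<alpha> "t - s" x] by auto
  qed
  have e: "(AE s in lborel. s \<in> {0<..<t} \<longrightarrow> conv_exists (heat_kernel \<alpha> (t - s)) (f s) x) \<longleftrightarrow>
       (AE s in lborel. s \<in> {0<..<t} \<longrightarrow> conv_exists (heat_kernel \<alpha> (t - s)) (f' s) x)"
    "(AE s in lborel. s \<in> {0<..<t} \<longrightarrow> oseen_conv_exists \<alpha> (t - s) (tensor_square (u s)) x) \<longleftrightarrow>
       (AE s in lborel. s \<in> {0<..<t} \<longrightarrow> oseen_conv_exists \<alpha> (t - s) (tensor_square (u' s)) x)"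
    by (rule eventually_cong[OF cf], blast) (rule eventually_cong[OF cu], blast)
  have "AE s in lborel. s \<in> {0<..<t} \<longrightarrow> conv (heat_kernel \<alpha> (t - s)) (f s) x = conv (heat_kernel \<alpha> (t - s)) (f' s) x"
    using cf by eventually_elim blast
  note i = set_integral_cong_AE[OF _ this]
  have "AE s in lborel. s \<in> {0<..<t} \<longrightarrow> oseen_conv \<alpha> (t - s) (tensor_square (u s)) x = oseen_conv \<alpha> (t - s) (tensor_square (u' s)) x"
    using cu by eventually_elim blast
  note j = set_integral_cong_AE[OF _ this]
  note c = conv_cong_AE[OF v', of "heat_kernel \<alpha> t" x]
  show "mild_at v f u t x \<longleftrightarrow> mild_at v' f' u' t x"
    unfolding mild_at_def e by (subst c(1), measurable, subst i(1), measurable, subst j(1), measurable)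
  show "data v f t x = data v' f' t x"
    unfolding data_def force_def by (subst c(2), measurable, subst i(2), measurable)
  show "duhamel u t x = duhamel u' t x"
    unfolding duhamel_def by (rule j(2)) measurable
qed

lemma exists_unique_mild_solution:
  assumes P: "P \<in> borel_measurable (lebesgue_on {0..1})" and P\<rho>: "AE t in lebesgue_on {0..1}. ennreal \<rho> \<le> P t"
    and f: "f \<in> mixed_Lvar {0<..<1} (\<lambda>_. 1) q" and v: "v \<in> Lvar lebesgue q"
  shows "\<exists>T. 0 < T \<and> T \<le> 1 \<and> (\<exists>u. u \<in> mixed_Lvar {0<..<T} P q \<and> mild_solution \<alpha> v f T u \<and>
     (\<forall>w. w \<in> mixed_Lvar {0<..<T} P q \<and> mild_solution \<alpha> v f T w \<longrightarrow>
       (AE (t, x) in lebesgue_on ({0<..<T} \<times> UNIV). w t x = u t x)))"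
proof -
  obtain v' where v': "v' \<in> borel_measurable borel" "AE y in lborel. v y = v' y"
    using v borel_representative[of v] by (auto simp: Lvar_def)
  have v'L: "v' \<in> Lvar lebesgue q"
    using Lvar_cong_AE(2)[OF v'(2) _ v] measurable_completion[of v' lborel borel] v'(1) by simp
  obtain lv where lv: "0 < lv" "(\<integral>\<^sup>+y. omega (q y) (norm (v' y) / lv) \<partial>lborel) \<le> 1"
    using Lvar_modular_le_1[OF v'L] by blast
  have fm: "(\<lambda>(t, x). f t x) \<in> borel_measurable (lebesgue_on ({0<..<1} \<times> UNIV))" using f by (simp add: mixed_Lvar_def)
  obtain f' where f': "jointly_measurable f'" "AE s in lborel. s \<in> {0<..<1} \<longrightarrow> (AE y in lborel. f s y = f' s y)"
    by (rule jointly_measurable_representative[OF fm]) auto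
  have fL: "AE s in lborel. s \<in> {0<..<1} \<longrightarrow> f s \<in> Lvar lebesgue q"
    and fn: "(\<lambda>s. Lvar_norm lebesgue q (f s)) \<in> Lvar (lebesgue_on {0<..<1}) (\<lambda>_. 1)"
    using f by (auto simp: mixed_Lvar_def AE_lebesgue_on_iff)
  define Lf where "Lf s = 1 * (1 + Lvar_norm lebesgue q (f' s))" for s
  have cf: "controlled 1 Lf f'" and Lf1: "(\<integral>\<^sup>+s. ennreal (Lf s powr 1) * indicator {0<..<1} s \<partial>lborel) < \<infinity>"
    unfolding Lf_def by (rule controlled_of_Lvar[OF f'(1) _ fL f'(2) fn, where \<sigma> = 1 and l = 1]; simp)+
  have "(\<integral>\<^sup>+s. ennreal (Lf s) * indicator {0<..<1} s \<partial>lborel) \<le> (\<integral>\<^sup>+s. ennreal (Lf s powr 1) * indicator {0<..<1} s \<partial>lborel)"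
    by (intro nn_integral_mono mult_right_mono ennreal_leI) auto
  then have Lf2: "(\<integral>\<^sup>+s. ennreal (Lf s) * indicator {0<..<1} s \<partial>lborel) < \<infinity>" using Lf1 by (rule le_less_trans)
  define U where "U = data v' f'"
  have U: "jointly_measurable U" unfolding U_def by (rule jointly_measurable_data[OF v'(1) f'(1)])
  obtain l where l: "1 \<le> l" and UL: "\<And>t w. 0 < t \<Longrightarrow> t < 1 \<Longrightarrow> w \<in> borel_measurable borel \<Longrightarrow> (\<And>x. norm (w x) \<le> 1) \<Longrightarrow>
      (\<integral>\<^sup>+x. omega (q x) (norm (U t x + w x) / l) \<partial>lborel) \<le> 1"
    using data_modular_bound[OF f'(1) cf Lf2 v'(1) lv] unfolding U_def data_def by blast
  obtain T w where T: "0 < T" "T \<le> 1" and w: "jointly_measurable w" "\<And>t x. norm (w t x) \<le> 1"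
    and fp: "\<And>t x. 0 < t \<Longrightarrow> t < T \<Longrightarrow> w t x = - duhamel (\<lambda>t x. U t x + w t x) t x"
    using picard[OF U l UL] by blast
  define u where "u = (\<lambda>t x. U t x + w t x)"
  have ujm: "jointly_measurable u" unfolding u_def using U w(1) by measurable
  have ul: "(\<integral>\<^sup>+x. omega (q x) (norm (u t x) / l) \<partial>lborel) \<le> 1" if "t \<in> {0<..<T}" for t
    unfolding u_def using that T w by (intro UL jointly_measurable_slice) auto
  have P': "P \<in> borel_measurable (lebesgue_on {0<..<T})"
    by (rule measurable_restrict_mono[OF P]) (use T in auto)
  have P\<rho>': "AE t in lborel. t \<in> {0<..<T} \<longrightarrow> ennreal \<rho> \<le> P t"
    using P\<rho> T by (subst (asm) AE_lebesgue_on_iff) (auto elim!: eventually_mono)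
  have um: "u \<in> mixed_Lvar {0<..<T} P q"
  proof -
    have "u t \<in> Lvar lebesgue q" if "t \<in> {0<..<T}" for t
      using l ul[OF that] jointly_measurable_slice[OF ujm, of t]
      by (intro LvarI[of l]) (auto intro: measurable_completion)
    note uL = this
    have nle: "\<bar>Lvar_norm lebesgue q (u t)\<bar> \<le> l" if "t \<in> {0<..<T}" for t
      using Lvar_norm_le[OF _ ul[OF that]] Lvar_norm_nonneg[OF uL[OF that]] l by auto
    have nm: "(\<lambda>t. Lvar_norm lebesgue q (u t)) \<in> borel_measurable (lebesgue_on {0<..<T})"
      using borel_measurable_Lvar_norm[OF ujm] by (intro measurable_restrict_space1 measurable_completion) simp
    \<comment> \<open>On a bounded interval a function bounded by l lies in L^P whatever the
      exponent: divided by l it has modular density at most one.\<close>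
    have "modular (lebesgue_on {0<..<T}) P (\<lambda>t. (1 / l) *\<^sub>R Lvar_norm lebesgue q (u t)) \<le> (\<integral>\<^sup>+t. 1 \<partial>lebesgue_on {0<..<T})"
      unfolding modular_def
    proof (rule nn_integral_mono)
      fix t assume "t \<in> space (lebesgue_on {0<..<T})"
      then have "norm ((1 / l) *\<^sub>R Lvar_norm lebesgue q (u t)) \<le> 1" using nle[of t] l by simp
      moreover have "omega a b \<le> 1" if "0 \<le> b" "b \<le> 1" for a b
        using that by (auto simp: omega_def ennreal_le_1 intro!: powr_le1)
      ultimately show "omega (P t) (norm ((1 / l) *\<^sub>R Lvar_norm lebesgue q (u t))) \<le> 1" by simp
    qed
    also have "\<dots> < \<infinity>" using T by (simp add: emeasure_restrict_space)
    finally have "(\<lambda>t. Lvar_norm lebesgue q (u t)) \<in> Lvar (lebesgue_on {0<..<T}) P"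
      using nm l unfolding Lvar_def by (auto intro!: exI[of _ "1 / l"])
    moreover have "(\<lambda>(t, x). u t x) \<in> borel_measurable (lebesgue_on ({0<..<T} \<times> UNIV))"
      using ujm by (intro measurable_restrict_space1 measurable_completion) (simp add: borel_prod)
    moreover have "AE t in lebesgue_on {0<..<T}. u t \<in> Lvar lebesgue q"
      by (intro AE_I2) (use uL in auto)
    ultimately show ?thesis by (simp add: mixed_Lvar_def)
  qed
  have cu: "controlled T (\<lambda>_. l) u" using l ul by (auto simp: controlled_def)
  have si: "singular_integral (\<lambda>_. l) 0 t \<le> ennreal (l\<^sup>2 * ((t - 0) powr (1 - \<gamma>) / (1 - \<gamma>)))"
    "0 \<le> l\<^sup>2 * ((t - 0) powr (1 - \<gamma>) / (1 - \<gamma>))" if "0 < t" for t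
    using that \<gamma>_less_1 singular_integral_const[of 0 t l] by auto
  have equ: "u t x = U t x - duhamel u t x" if "t \<in> {0<..<T}" for t x
    using fp[of t x] that by (simp add: u_def)
  have usol: "mild_solution \<alpha> v f T u"
  proof -
    have "AE t in lborel. t \<in> {0<..<T} \<longrightarrow> (\<forall>x. mild_at v f u t x \<and> u t x = data v f t x - duhamel u t x)"
      using force_exists[OF f'(1) cf Lf2]
    proof (eventually_elim, intro impI allI)
      fix t x
      assume F: "t \<in> {0<..<1} \<longrightarrow> (\<forall>x. (AE s in lborel. s \<in> {0<..<t} \<longrightarrow> conv_exists (heat_kernel \<alpha> (t - s)) (f' s) x) \<and>
          set_integrable lebesgue {0<..<t} (\<lambda>s. conv (heat_kernel \<alpha> (t - s)) (f' s) x))" and t: "t \<in> {0<..<T}"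
      have t1: "t \<in> {0<..<1}" "0 < t" "t \<le> 1" "t \<le> T" using t T by auto
      have "AE s in lborel. s \<in> {0<..<T} \<longrightarrow> (AE y in lborel. u s y = u s y)" by simp
      note cong = mild_at_cong_AE[OF v' f' ujm this T(2) t, of x]
      have "conv_exists (heat_kernel \<alpha> t) v' x" by (rule heat_conv_estimates(1)[OF v'(1) lv(2,1) t1(2,3)])
      then have "mild_at v' f' u t x"
        unfolding mild_at_def
        using F t1(1) duhamel_bound(1,2)[OF ujm controlled_mono[OF cu t1(4)] t1(2,3) si[OF t1(2)], of x] by blast
      moreover have "u t x = data v' f' t x - duhamel u t x" using equ[OF t] by (simp add: U_def)
      ultimately show "mild_at v f u t x \<and> u t x = data v f t x - duhamel u t x" unfolding cong(1,2) ..
    qed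
    from AE_lborel_fst[OF this] show ?thesis
      unfolding mild_solution_iff by eventually_elim blast
  qed
  have "AE (t, x) in lebesgue_on ({0<..<T} \<times> UNIV). \<omega> t x = u t x"
    if \<omega>: "\<omega> \<in> mixed_Lvar {0<..<T} P q" "mild_solution \<alpha> v f T \<omega>" for \<omega>
  proof -
    have \<omega>m: "(\<lambda>(t, x). \<omega> t x) \<in> borel_measurable (lebesgue_on ({0<..<T} \<times> UNIV))" using \<omega>(1) by (simp add: mixed_Lvar_def)
    obtain \<omega>' where \<omega>': "jointly_measurable \<omega>'" "AE z in lborel. fst z \<in> {0<..<T} \<longrightarrow> \<omega> (fst z) (snd z) = \<omega>' (fst z) (snd z)"
      "AE s in lborel. s \<in> {0<..<T} \<longrightarrow> (AE y in lborel. \<omega> s y = \<omega>' s y)"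
      by (rule jointly_measurable_representative[OF \<omega>m]) auto
    have \<omega>L: "AE s in lborel. s \<in> {0<..<T} \<longrightarrow> \<omega> s \<in> Lvar lebesgue q"
      and \<omega>n: "(\<lambda>s. Lvar_norm lebesgue q (\<omega> s)) \<in> Lvar (lebesgue_on {0<..<T}) P"
      using \<omega>(1) by (auto simp: mixed_Lvar_def AE_lebesgue_on_iff)
    define L where "L s = l * (1 + Lvar_norm lebesgue q (\<omega>' s))" for s
    have \<rho>1: "1 \<le> \<rho>" using \<rho> by simp
    note col = controlled_of_Lvar[OF \<omega>'(1) T(1) \<omega>L \<omega>'(3) \<omega>n P' P\<rho>' \<rho>1 l, folded L_def]
    note c\<omega> = col(1)
    \<comment> \<open>One control has to serve both fields: L dominates l, the scale of u, and the
      modular decreases in the scale.\<close>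
    have cuL: "controlled T L u"
      unfolding controlled_def
    proof
      show "L \<in> borel_measurable borel" by (rule controlledD(1)[OF c\<omega>])
      show "AE s in lborel. s \<in> {0<..<T} \<longrightarrow> 1 \<le> L s \<and> (\<integral>\<^sup>+y. omega (q y) (norm (u s y) / L s) \<partial>lborel) \<le> 1"
        using col(3)
      proof eventually_elim
        case (elim s)
        show ?case
        proof
          assume s: "s \<in> {0<..<T}"
          then have "l \<le> L s" using elim by blast
          then show "1 \<le> L s \<and> (\<integral>\<^sup>+y. omega (q y) (norm (u s y) / L s) \<partial>lborel) \<le> 1"
            using l ul[OF s] modular_mono[of l "L s" "u s"] by (auto intro: order_trans)
        qed
      qed
    qed
    define M where "M = enn2real (\<integral>\<^sup>+s. ennreal (L s powr \<rho>) * indicator {0<..<T} s \<partial>lborel)"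
    have M: "(\<integral>\<^sup>+s. ennreal (L s powr \<rho>) * indicator {0<..<T} s \<partial>lborel) \<le> ennreal M" "0 \<le> M"
      using col(2) by (auto simp: M_def)
    obtain j where j: "0 \<le> j" "\<And>t. 0 < t \<Longrightarrow> t \<le> T \<Longrightarrow> singular_integral L 0 t \<le> ennreal j"
      using singular_integral_bounded[OF c\<omega> T(2) M] by blast
    have "AE z in lborel. fst z \<in> {0<..<T} \<longrightarrow> \<omega>' (fst z) (snd z) = U (fst z) (snd z) - duhamel \<omega>' (fst z) (snd z)"
      using \<omega>(2) \<omega>'(2) unfolding mild_solution_iff U_def
      by eventually_elim (use mild_at_cong_AE(2,3)[OF v' f' \<omega>'(1,3) T(2)] in auto)
    then have "AE t in lborel. AE x in lborel. fst (t, x) \<in> {0<..<T} \<longrightarrow> \<omega>' (fst (t, x)) (snd (t, x)) = U (fst (t, x)) (snd (t, x)) - duhamel \<omega>' (fst (t, x)) (snd (t, x))"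
      by (intro lborel_pair.AE_pair) (simp only: lborel_prod)
    then have \<omega>'eq: "AE t in lborel. t \<in> {0<..<T} \<longrightarrow> (AE x in lborel. \<omega>' t x = U t x - duhamel \<omega>' t x)"
      by eventually_elim auto
    have "AE t in lborel. t \<in> {0<..<T} \<longrightarrow> (AE x in lborel. \<omega>' t x = u t x)"
    proof (rule duhamel_unique[OF \<omega>'(1) ujm c\<omega> cuL T(2) M])
      show "AE t in lborel. t \<in> {0<..<T} \<longrightarrow> (AE x in lborel. norm (\<omega>' t x - u t x) = norm (duhamel \<omega>' t x - duhamel u t x))"
        using \<omega>'eq
      proof (eventually_elim, intro impI)
        fix t assume "t \<in> {0<..<T} \<longrightarrow> (AE x in lborel. \<omega>' t x = U t x - duhamel \<omega>' t x)" and t: "t \<in> {0<..<T}"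
        then have "AE x in lborel. \<omega>' t x = U t x - duhamel \<omega>' t x" by blast
        then show "AE x in lborel. norm (\<omega>' t x - u t x) = norm (duhamel \<omega>' t x - duhamel u t x)"
          by eventually_elim (simp add: equ[OF t] norm_minus_commute)
      qed
      \<comment> \<open>The linear parts cancel and both Duhamel terms are bounded in space and
        time; this is the bound from which the halving starts.\<close>
      show "AE t in lborel. t \<in> {0<..<T} \<longrightarrow> (AE x in lborel. norm (\<omega>' t x - u t x) \<le> duhamel_const * j + duhamel_const * j)"
        using \<omega>'eq
      proof (eventually_elim, intro impI)
        fix t assume "t \<in> {0<..<T} \<longrightarrow> (AE x in lborel. \<omega>' t x = U t x - duhamel \<omega>' t x)" and t: "t \<in> {0<..<T}"
        then have "AE x in lborel. \<omega>' t x = U t x - duhamel \<omega>' t x" by blast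
        then show "AE x in lborel. norm (\<omega>' t x - u t x) \<le> duhamel_const * j + duhamel_const * j"
        proof eventually_elim
          case (elim x)
          have t1: "t \<le> T" "0 < t" "t \<le> 1" using t T by auto
          have "norm (\<omega>' t x - u t x) = norm (duhamel u t x - duhamel \<omega>' t x)" by (simp add: elim equ[OF t])
          also have "\<dots> \<le> norm (duhamel u t x) + norm (duhamel \<omega>' t x)" by (rule norm_triangle_ineq4)
          also have "\<dots> \<le> duhamel_const * j + duhamel_const * j"
            by (intro add_mono duhamel_bound(3)[OF ujm controlled_mono[OF cuL t1(1)] t1(2,3) j(2)[OF t1(2,1)] j(1)]
               duhamel_bound(3)[OF \<omega>'(1) controlled_mono[OF c\<omega> t1(1)] t1(2,3) j(2)[OF t1(2,1)] j(1)])
          finally show ?case .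
        qed
      qed
    qed (use duhamel_const_nonneg j in auto)
    then have "AE t in lborel. AE x in (lborel :: (real^3) measure). fst (t, x) \<in> {0<..<T} \<longrightarrow> \<omega>' (fst (t, x)) (snd (t, x)) = u (fst (t, x)) (snd (t, x))"
      by eventually_elim auto
    \<comment> \<open>Passing from slices to the product requires the set of agreement to be
      measurable, hence the Borel representatives.\<close>
    moreover have "{z \<in> space (lborel \<Otimes>\<^sub>M lborel). fst z \<in> {0<..<T} \<longrightarrow> \<omega>' (fst z) (snd z) = u (fst z) (snd z)} \<in> sets (lborel \<Otimes>\<^sub>M (lborel :: (real^3) measure))"
    proof -
      note [measurable] = jointly_measurable_comp[OF \<omega>'(1)] jointly_measurable_comp[OF ujm]
      show ?thesis by measurable
    qed
    ultimately have "AE z in lborel \<Otimes>\<^sub>M lborel. fst z \<in> {0<..<T} \<longrightarrow> \<omega>' (fst z) (snd z) = u (fst z) (snd z)"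
      by (intro lborel_pair.AE_pair_measure) auto
    then have "AE z in lborel. fst z \<in> {0<..<T} \<longrightarrow> \<omega>' (fst z) (snd z) = u (fst z) (snd z)" by (simp only: lborel_prod)
    then have e: "AE z in lborel. fst z \<in> {0<..<T} \<longrightarrow> \<omega> (fst z) (snd z) = u (fst z) (snd z)"
      using \<omega>'(2) by eventually_elim auto
    show ?thesis unfolding AE_lebesgue_on_iff[OF slab_in_borel] using e by eventually_elim auto
  qed
  then show ?thesis using T um usol by blast
qed

end

section \<open>Choice of the exponents\<close>

lemma AE_ge_of_less_essinf:
  assumes "a < essinf M p"
  shows "AE x in M. a \<le> p x"
proof -
  obtain z where "a < z" "AE x in M. z \<le> p x" using assms by (auto simp: essinf_def less_Sup_iff)
  then show ?thesis by (auto elim!: eventually_mono)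
qed

text \<open>The number is chosen so that a divided by it equals a / P + e. This covers infinite P as
  well, where the quotient a / P is 0.\<close>

lemma real_below_exponent:
  assumes a: "0 < a" and e: "0 < e" and P: "0 < P" and fin: "ennreal a / P < \<infinity>"
  shows "ennreal (a / (enn2real (ennreal a / P) + e)) < P"
proof (cases P)
  case (real b)
  then have b: "0 < b" using P by simp
  have "enn2real (ennreal a / P) = a / b" using real a b by (simp add: divide_ennreal)
  moreover have "a / (a / b + e) < b"
  proof (subst pos_divide_less_eq)
    show "0 < a / b + e" using a b e by (simp add: add_pos_pos)
    have "b * (a / b + e) = a + b * e" using b by (simp add: distrib_left)
    then show "a < b * (a / b + e)" using b e by simp
  qed
  ultimately show ?thesis using real a b e by (simp add: ennreal_less_iff)
qed simp

text \<open>The constant in the decay condition is the limit of 1/q up to its sign; an infinite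
  exponent at infinity excludes positive values, so the condition bounds 1/q itself.\<close>

lemma log_exponent_decay:
  assumes q: "log_exponent q" and inf: "exponent_at_infinity q = \<infinity>"
  obtains c where "0 < c"
    "\<And>x y. \<bar>enn2real (1 / q x) - enn2real (1 / q y)\<bar> \<le> c / ln (exp 1 + 1 / norm (x - y))"
    "\<And>x. enn2real (1 / q x) \<le> c / ln (exp 1 + norm x)"
proof -
  obtain c G where c: "0 < c"
    and loc: "\<And>x y. \<bar>enn2real (1 / q x) - enn2real (1 / q y)\<bar> \<le> c / ln (exp 1 + 1 / norm (x - y))"
    and dec: "\<And>x. \<bar>enn2real (1 / q x) - G\<bar> \<le> c / ln (exp 1 + norm x)"
    using q by (auto simp: log_exponent_def)
  have q1: "1 \<le> q x" for x using q by (simp add: log_exponent_def variable_exponent_def)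
  have "((\<lambda>x::real^3. c / ln (exp 1 + norm x)) \<longlongrightarrow> 0) at_infinity"
    by (rule tendsto_divide_0[OF tendsto_const])
       (intro filterlim_at_top_imp_at_infinity filterlim_compose[OF ln_at_top]
         filterlim_tendsto_add_at_top[OF tendsto_const] filterlim_norm_at_top)
  then have "((\<lambda>x. enn2real (1 / q x) - G) \<longlongrightarrow> 0) at_infinity"
    by (rule Lim_null_comparison[rotated]) (use dec in auto)
  then have "((\<lambda>x. enn2real (1 / q x)) \<longlongrightarrow> G) at_infinity" using LIM_zero_iff by blast
  then have "((\<lambda>x. ennreal (enn2real (1 / q x))) \<longlongrightarrow> ennreal G) at_infinity" by (rule tendsto_ennrealI)
  moreover have "ennreal (enn2real (1 / q x)) = 1 / q x" for x
  proof -
    have "1 / q x \<le> 1" using q1[of x] by (intro divide_le_posI_ennreal) (auto intro: less_le_trans[OF zero_less_one])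
    then have "1 / q x < top" by (rule le_less_trans) simp
    then show ?thesis by simp
  qed
  ultimately have "((\<lambda>x. 1 / q x) \<longlongrightarrow> ennreal G) at_infinity" by simp
  then have "Lim at_infinity (\<lambda>x. 1 / q x) = ennreal G" by (intro tendsto_Lim trivial_limit_at_infinity)
  then have "1 / ennreal G = \<infinity>" using inf by (simp add: exponent_at_infinity_def)
  \<comment> \<open>Since \<open>ennreal G\<close> is 0 for every G \<le> 0, only the sign is
    obtained, and it is enough to drop G from the upper bound.\<close>
  then have G: "G \<le> 0" by (cases "G \<le> 0") (auto simp: divide_ennreal_def)
  have "enn2real (1 / q x) \<le> c / ln (exp 1 + norm x)" for x using dec[of x] G by (simp add: abs_le_iff)
  with c loc show ?thesis by (rule that)
qed

theorem theorem4p9: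
  fixes \<alpha> :: real
    and p :: "real \<Rightarrow> ennreal"
    and q :: "real^3 \<Rightarrow> ennreal"
    and f :: "real \<Rightarrow> real^3 \<Rightarrow> real^3"
    and u0 :: "real^3 \<Rightarrow> real^3"
  assumes "1 / 2 < \<alpha>" and "\<alpha> \<le> 1"
    and "variable_exponent (lebesgue_on {0..1}) p"
    and "log_exponent q"
    and "essinf lebesgue q > 2"
    and "exponent_at_infinity q = \<infinity>"
    and "essinf (lebesgue_on {0..1}) p > 2"
    and "ennreal (2 * \<alpha>) / essinf (lebesgue_on {0..1}) p + 3 / essinf lebesgue q
           < ennreal (\<alpha> - 1 / 2)"
    and "f \<in> mixed_Lvar {0<..<1} (\<lambda>_. 1) q"
    and "AE t in lebesgue_on {0<..<1}. divergence_free (f t)"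
    and "u0 \<in> Lvar lebesgue q"
    and "divergence_free u0"
  shows "\<exists>T. 0 < T \<and> T \<le> 1 \<and>
           (\<exists>u. u \<in> mixed_Lvar {0<..<T} p q \<and> mild_solution \<alpha> u0 f T u \<and>
              (\<forall>v. v \<in> mixed_Lvar {0<..<T} p q \<and> mild_solution \<alpha> u0 f T v \<longrightarrow>
                 (AE (t, x) in lebesgue_on ({0<..<T} \<times> UNIV). v t x = u t x)))"
proof -
  let ?P = "essinf (lebesgue_on {0..1}) p" and ?Q = "essinf lebesgue q"
  have sum: "ennreal (2 * \<alpha>) / ?P + ennreal 3 / ?Q < ennreal (\<alpha> - 1 / 2)" using assms(8) by simp
  then have "ennreal (2 * \<alpha>) / ?P + ennreal 3 / ?Q < top" by (rule less_trans) simp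
  then have fin: "ennreal (2 * \<alpha>) / ?P < \<infinity>" "ennreal 3 / ?Q < \<infinity>" by (simp_all only: ennreal_add_less_top infinity_ennreal_def)
  define a where "a = enn2real (ennreal (2 * \<alpha>) / ?P)"
  define b where "b = enn2real (ennreal 3 / ?Q)"
  have a0: "0 \<le> a" "0 \<le> b" by (simp_all add: a_def b_def)
  have "ennreal a = ennreal (2 * \<alpha>) / ?P" "ennreal b = ennreal 3 / ?Q"
    using fin by (simp_all only: a_def b_def ennreal_enn2real infinity_ennreal_def)
  then have "ennreal (a + b) < ennreal (\<alpha> - 1 / 2)" using sum a0 by (simp only: ennreal_plus)
  then have ab: "a + b < \<alpha> - 1 / 2" using a0 by (simp add: ennreal_less_iff del: ennreal_plus)
  \<comment> \<open>A third of the slack for each exponent; the last third keeps the inequality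
    strict after both have been moved below the essential infima.\<close>
  define e where "e = (\<alpha> - 1 / 2 - a - b) / 3"
  have e: "0 < e" "a + e + (b + e) < \<alpha> - 1 / 2" using ab by (auto simp: e_def field_simps)
  define \<rho> where "\<rho> = 2 * \<alpha> / (a + e)"
  define r where "r = 3 / (b + e)"
  have "ennreal \<rho> < ?P" unfolding \<rho>_def a_def
    using assms(1,7) e fin by (intro real_below_exponent) (auto intro: less_trans[of 0 2])
  then have \<rho>P: "AE t in lebesgue_on {0..1}. ennreal \<rho> \<le> p t" by (rule AE_ge_of_less_essinf)
  have "ennreal r < ?Q" unfolding r_def b_def
    using assms(5) e fin by (intro real_below_exponent) (auto intro: less_trans[of 0 2])
  then have rQ: "AE x in lborel. ennreal r \<le> q x" using AE_ge_of_less_essinf AE_completion_iff by blast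
  \<comment> \<open>From a + e < \<alpha> - 1/2 < \<alpha> follows \<rho> > 2, and b + e < 1/2 makes
    r more than large enough.\<close>
  have \<rho>: "2 < \<rho>" using e a0 assms(1) by (simp add: \<rho>_def less_divide_eq)
  have r: "2 \<le> r" using e a0 assms(2) by (simp add: r_def le_divide_eq)
  have gap: "2 * \<alpha> / \<rho> + 3 / r < \<alpha> - 1 / 2" 
  proof -
    have "2 * \<alpha> / \<rho> = a + e" "3 / r = b + e" using e(1) a0 assms(1) by (simp_all add: \<rho>_def r_def)
    then show ?thesis using e(2) by simp
  qed
  obtain c where c: "0 < c"
    "\<And>x y. \<bar>enn2real (1 / q x) - enn2real (1 / q y)\<bar> \<le> c / ln (exp 1 + 1 / norm (x - y))"
    "\<And>x. enn2real (1 / q x) \<le> c / ln (exp 1 + norm x)"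
    using log_exponent_decay[OF assms(4,6)] by blast
  interpret ns q c r \<alpha> \<rho>
    by unfold_locales (use assms(1,2,4) c \<rho> r gap rQ in \<open>auto simp: log_exponent_def variable_exponent_def\<close>)
  show ?thesis
    using assms(3) by (intro exists_unique_mild_solution[OF _ \<rho>P assms(9,11)]) (simp add: variable_exponent_def)
qed

end
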